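(* The following two statements are equivalent over $\mathbf{RCA}_0$: (i) arithmetical comprehension; (ii) (the extended Goodstein theorem for the binary representation) for every Goodstein system $(b,c)$ and every natural number $m<2^{b(0)}$ there is an $i\in\mathbb N$ with $G^{2}_{b,c,m}(i)=0$.
   Context: $\mathbf{RCA}_0$ is the usual base theory of reverse mathematics (second order arithmetic with recursive comprehension and $\Sigma^0_1$-induction). Goodstein system: a pair $(b,c)$ consisting of a non-decreasing function $b:\mathbb N\to\mathbb N$ with $b(0)>0$ and a family $c=\langle c_i\rangle_{i\in\mathbb N}$ of strictly increasing functions $c_i:\{0,\dots,b(i)-1\}\to\{0,\dots,b(i+1)-1\}$ with the following property: for any function $d:\mathbb N\to\mathbb N$ with $d(i)<b(i)$ for all $i\in\mathbb N$ and any infinite $Y\subseteq\mathbb N$, there are $i,j\in Y$ with $i<j$ and $c_{ij}(d(i))\leq d(j)$, where $c_{ij}:=c_{j-1}\circ\dots\circ c_i:\{0,\dots,b(i)-1\}\to\{0,\dots,b(j)-1\}$. Goodstein sequence for the binary representation: for a Goodstein system $(b,c)$ and $m<2^{b(0)}$, put $G^2_{b,c,m}(0)=m$. If $G^2_{b,c,m}(i)=0$, put $G^2_{b,c,m}(i+1)=0$. Otherwise write $G^2_{b,c,m}(i)=2^{n_0}+\dots+2^{n_k}$ with $b(i)>n_0>\dots>n_k$ and put $G^2_{b,c,m}(i+1)=2^{c_i(n_0)}+\dots+2^{c_i(n_k)}-1$. *)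

theory Defs
  imports Main
begin

text \<open>
  Statements ``over \<open>RCA\<^sub>0\<close>'' are read as statements about all models of \<open>RCA\<^sub>0\<close>, standard or
  not.  A structure for the language of second order arithmetic has the whole type \<open>'a\<close> as its
  number domain, and \<open>sets M\<close> is the range of its set quantifiers.
\<close>

record 'a l2_structure =
  zero :: 'a  ("\<zero>\<index>")
  one :: 'a  ("\<one>\<index>")
  add :: "'a \<Rightarrow> 'a \<Rightarrow> 'a"  (infixl "\<oplus>\<index>" 65)
  mul :: "'a \<Rightarrow> 'a \<Rightarrow> 'a"  (infixl "\<otimes>\<index>" 70)
  less :: "'a \<Rightarrow> 'a \<Rightarrow> bool"  (infix "\<prec>\<index>" 50)
  sets :: "'a set set"

section \<open>Formulas of second order arithmetic\<close>

text \<open>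
  Number variables and set variables are named by natural numbers, independently of each other.
  Equality of sets is not primitive.
\<close>

datatype tm = Var nat | Zero | One | Add tm tm | Mul tm tm

datatype fm =
    Eq tm tm | Less tm tm | Mem tm nat
  | Neg fm | Conj fm fm | Disj fm fm | Imp fm fm | Iff fm fm
  | AllN nat fm | ExN nat fm | AllS nat fm | ExS nat fm

primrec tvars :: "tm \<Rightarrow> nat set" where
  "tvars (Var x) = {x}"
| "tvars Zero = {}"
| "tvars One = {}"
| "tvars (Add s t) = tvars s \<union> tvars t"
| "tvars (Mul s t) = tvars s \<union> tvars t"

primrec tval :: "'a l2_structure \<Rightarrow> (nat \<Rightarrow> 'a) \<Rightarrow> tm \<Rightarrow> 'a" where
  "tval M e (Var x) = e x"
| "tval M e Zero = zero M"
| "tval M e One = one M"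
| "tval M e (Add s t) = add M (tval M e s) (tval M e t)"
| "tval M e (Mul s t) = mul M (tval M e s) (tval M e t)"

primrec sat :: "'a l2_structure \<Rightarrow> (nat \<Rightarrow> 'a) \<Rightarrow> (nat \<Rightarrow> 'a set) \<Rightarrow> fm \<Rightarrow> bool" where
  "sat M e E (Eq s t) \<longleftrightarrow> tval M e s = tval M e t"
| "sat M e E (Less s t) \<longleftrightarrow> less M (tval M e s) (tval M e t)"
| "sat M e E (Mem t X) \<longleftrightarrow> tval M e t \<in> E X"
| "sat M e E (Neg p) \<longleftrightarrow> \<not> sat M e E p"
| "sat M e E (Conj p q) \<longleftrightarrow> sat M e E p \<and> sat M e E q"
| "sat M e E (Disj p q) \<longleftrightarrow> sat M e E p \<or> sat M e E q"
| "sat M e E (Imp p q) \<longleftrightarrow> (sat M e E p \<longrightarrow> sat M e E q)"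
| "sat M e E (Iff p q) \<longleftrightarrow> (sat M e E p \<longleftrightarrow> sat M e E q)"
| "sat M e E (AllN x p) \<longleftrightarrow> (\<forall>a. sat M (e(x := a)) E p)"
| "sat M e E (ExN x p) \<longleftrightarrow> (\<exists>a. sat M (e(x := a)) E p)"
| "sat M e E (AllS X p) \<longleftrightarrow> (\<forall>A\<in>sets M. sat M e (E(X := A)) p)"
| "sat M e E (ExS X p) \<longleftrightarrow> (\<exists>A\<in>sets M. sat M e (E(X := A)) p)"

primrec arithmetical :: "fm \<Rightarrow> bool" where
  "arithmetical (Eq s t) \<longleftrightarrow> True"
| "arithmetical (Less s t) \<longleftrightarrow> True"
| "arithmetical (Mem t X) \<longleftrightarrow> True"
| "arithmetical (Neg p) \<longleftrightarrow> arithmetical p"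
| "arithmetical (Conj p q) \<longleftrightarrow> arithmetical p \<and> arithmetical q"
| "arithmetical (Disj p q) \<longleftrightarrow> arithmetical p \<and> arithmetical q"
| "arithmetical (Imp p q) \<longleftrightarrow> arithmetical p \<and> arithmetical q"
| "arithmetical (Iff p q) \<longleftrightarrow> arithmetical p \<and> arithmetical q"
| "arithmetical (AllN x p) \<longleftrightarrow> arithmetical p"
| "arithmetical (ExN x p) \<longleftrightarrow> arithmetical p"
| "arithmetical (AllS X p) \<longleftrightarrow> False"
| "arithmetical (ExS X p) \<longleftrightarrow> False"

inductive bounded_fm :: "fm \<Rightarrow> bool" where
  "bounded_fm (Eq s t)"
| "bounded_fm (Less s t)"
| "bounded_fm (Mem t X)"
| "bounded_fm p \<Longrightarrow> bounded_fm (Neg p)"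
| "bounded_fm p \<Longrightarrow> bounded_fm q \<Longrightarrow> bounded_fm (Conj p q)"
| "bounded_fm p \<Longrightarrow> bounded_fm q \<Longrightarrow> bounded_fm (Disj p q)"
| "bounded_fm p \<Longrightarrow> bounded_fm q \<Longrightarrow> bounded_fm (Imp p q)"
| "bounded_fm p \<Longrightarrow> bounded_fm q \<Longrightarrow> bounded_fm (Iff p q)"
| "bounded_fm p \<Longrightarrow> x \<notin> tvars t \<Longrightarrow> bounded_fm (AllN x (Imp (Less (Var x) t) p))"
| "bounded_fm p \<Longrightarrow> x \<notin> tvars t \<Longrightarrow> bounded_fm (ExN x (Conj (Less (Var x) t) p))"

definition Sigma01 :: "fm \<Rightarrow> bool" where
  "Sigma01 p \<longleftrightarrow> (\<exists>x q. bounded_fm q \<and> p = ExN x q)"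

definition Pi01 :: "fm \<Rightarrow> bool" where
  "Pi01 p \<longleftrightarrow> (\<exists>x q. bounded_fm q \<and> p = AllN x q)"

section \<open>The axioms\<close>

context
  fixes M :: "'a l2_structure" (structure)
begin

definition basic_axioms :: bool where
  "basic_axioms \<longleftrightarrow>
     (\<forall>n. n \<oplus> \<one> \<noteq> \<zero>) \<and>
     (\<forall>m n. m \<oplus> \<one> = n \<oplus> \<one> \<longrightarrow> m = n) \<and>
     (\<forall>m. m \<oplus> \<zero> = m) \<and>
     (\<forall>m n. m \<oplus> (n \<oplus> \<one>) = (m \<oplus> n) \<oplus> \<one>) \<and>
     (\<forall>m. m \<otimes> \<zero> = \<zero>) \<and>
     (\<forall>m n. m \<otimes> (n \<oplus> \<one>) = (m \<otimes> n) \<oplus> m) \<and>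
     (\<forall>m. \<not> m \<prec> \<zero>) \<and>
     (\<forall>m n. m \<prec> n \<oplus> \<one> \<longleftrightarrow> m \<prec> n \<or> m = n)"

text \<open>
  In the schemes, the assignments \<open>e\<close> and \<open>E\<close> supply arbitrary number and set parameters.
\<close>

definition assignment :: "(nat \<Rightarrow> 'a set) \<Rightarrow> bool" where
  "assignment E \<longleftrightarrow> (\<forall>X. E X \<in> sets M)"

definition Sigma01_induction :: bool where
  "Sigma01_induction \<longleftrightarrow>
     (\<forall>p x e E. Sigma01 p \<longrightarrow> assignment E \<longrightarrow>
        sat M (e(x := \<zero>)) E p \<longrightarrow>
        (\<forall>n. sat M (e(x := n)) E p \<longrightarrow> sat M (e(x := n \<oplus> \<one>)) E p) \<longrightarrow>
        (\<forall>n. sat M (e(x := n)) E p))"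

definition Delta01_comprehension :: bool where
  "Delta01_comprehension \<longleftrightarrow>
     (\<forall>p q x e E. Sigma01 p \<longrightarrow> Pi01 q \<longrightarrow> assignment E \<longrightarrow>
        (\<forall>n. sat M (e(x := n)) E p \<longleftrightarrow> sat M (e(x := n)) E q) \<longrightarrow>
        (\<exists>A\<in>sets M. \<forall>n. n \<in> A \<longleftrightarrow> sat M (e(x := n)) E p))"

text \<open>
  Nonemptiness of the set domain has to be demanded separately: without it there would be no
  assignments, and the schemes would hold vacuously.
\<close>

definition RCA0_model :: bool where
  "RCA0_model \<longleftrightarrow>
     sets M \<noteq> {} \<and> basic_axioms \<and> Sigma01_induction \<and> Delta01_comprehension"

definition arithmetical_comprehension :: bool where
  "arithmetical_comprehension \<longleftrightarrow>
     (\<forall>p x e E. arithmetical p \<longrightarrow> assignment E \<longrightarrow>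
        (\<exists>A\<in>sets M. \<forall>n. n \<in> A \<longleftrightarrow> sat M (e(x := n)) E p))"

section \<open>Functions and primitive recursion inside a structure\<close>

text \<open>
  From here on all notions are internal to \<open>M\<close>: numbers are elements of \<open>'a\<close>, and every quantifier
  over sets or functions of numbers is restricted to \<open>sets M\<close>.  Functions are sets of pairs, with
  the pairing map \<open>(m, n) \<mapsto> (m + n)\<^sup>2 + m\<close>.
\<close>

definition leq :: "'a \<Rightarrow> 'a \<Rightarrow> bool"  (infix "\<preceq>" 50) where
  "m \<preceq> n \<longleftrightarrow> m \<prec> n \<or> m = n"

definition pair :: "'a \<Rightarrow> 'a \<Rightarrow> 'a" where
  "pair m n = (m \<oplus> n) \<otimes> (m \<oplus> n) \<oplus> m"

definition is_fun :: "'a set \<Rightarrow> 'a set \<Rightarrow> bool" where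
  "is_fun D F \<longleftrightarrow>
     F \<in> sets M \<and> (\<forall>z\<in>F. \<exists>x\<in>D. \<exists>y. z = pair x y) \<and> (\<forall>x\<in>D. \<exists>!y. pair x y \<in> F)"

definition app :: "'a set \<Rightarrow> 'a \<Rightarrow> 'a"  (infixl "\<bullet>" 90) where
  "F \<bullet> x = (THE y. pair x y \<in> F)"

text \<open>
  \<open>iter i a h j\<close> is the value \<open>v\<^sub>j\<close> of the recursion \<open>v\<^sub>i = a\<close>, \<open>v\<^sub>k\<^sub>+\<^sub>1 = h k v\<^sub>k\<close>.  The recursion is
  carried out inside \<open>M\<close>, along the possibly nonstandard interval from \<open>i\<close> to \<open>j\<close>.
\<close>

definition iter :: "'a \<Rightarrow> 'a \<Rightarrow> ('a \<Rightarrow> 'a \<Rightarrow> 'a) \<Rightarrow> 'a \<Rightarrow> 'a" where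
  "iter i a h j =
     (THE v. \<exists>H. is_fun UNIV H \<and> H \<bullet> i = a \<and>
        (\<forall>k. i \<preceq> k \<and> k \<prec> j \<longrightarrow> H \<bullet> (k \<oplus> \<one>) = h k (H \<bullet> k)) \<and> H \<bullet> j = v)"

definition exp2 :: "'a \<Rightarrow> 'a" where
  "exp2 n = iter \<zero> \<one> (\<lambda>_ v. (\<one> \<oplus> \<one>) \<otimes> v) n"

text \<open>The sum of \<open>2\<close> to the powers \<open>f 0\<close>, \dots, \<open>f k\<close>:\<close>

definition sum_exp2 :: "('a \<Rightarrow> 'a) \<Rightarrow> 'a \<Rightarrow> 'a" where
  "sum_exp2 f k = iter \<zero> (exp2 (f \<zero>)) (\<lambda>j v. v \<oplus> exp2 (f (j \<oplus> \<one>))) k"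

section \<open>Goodstein systems and Goodstein sequences\<close>

text \<open>
  A family \<open>c\<close> of functions \<open>c\<^sub>i\<close> is a single function that maps the pair \<open>(i, n)\<close> to \<open>c\<^sub>i(n)\<close>.
\<close>

definition fam :: "'a set \<Rightarrow> 'a \<Rightarrow> 'a \<Rightarrow> 'a" where
  "fam c i n = c \<bullet> pair i n"

definition fam_comp :: "'a set \<Rightarrow> 'a \<Rightarrow> 'a \<Rightarrow> 'a \<Rightarrow> 'a" where
  "fam_comp c i j n = iter i n (fam c) j"

definition goodstein_system :: "'a set \<Rightarrow> 'a set \<Rightarrow> bool" where
  "goodstein_system b c \<longleftrightarrow>
     is_fun UNIV b \<and>
     (\<forall>i j. i \<preceq> j \<longrightarrow> b \<bullet> i \<preceq> b \<bullet> j) \<and>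
     \<zero> \<prec> b \<bullet> \<zero> \<and>
     is_fun {pair i n | i n. n \<prec> b \<bullet> i} c \<and>
     (\<forall>i n. n \<prec> b \<bullet> i \<longrightarrow> fam c i n \<prec> b \<bullet> (i \<oplus> \<one>)) \<and>
     (\<forall>i n n'. n \<prec> n' \<and> n' \<prec> b \<bullet> i \<longrightarrow> fam c i n \<prec> fam c i n') \<and>
     (\<forall>d Y. is_fun UNIV d \<and> (\<forall>i. d \<bullet> i \<prec> b \<bullet> i) \<and>
        Y \<in> sets M \<and> (\<forall>m. \<exists>n\<in>Y. m \<prec> n) \<longrightarrow>
        (\<exists>i\<in>Y. \<exists>j\<in>Y. i \<prec> j \<and> fam_comp c i j (d \<bullet> i) \<preceq> d \<bullet> j))"

text \<open>
  The exponents \<open>n\<^sub>0 > \<dots> > n\<^sub>k\<close> are the first \<open>k + 1\<close> values of a function \<open>s\<close> of the structure.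
\<close>

definition goodstein_step :: "'a set \<Rightarrow> 'a set \<Rightarrow> 'a \<Rightarrow> 'a \<Rightarrow> 'a \<Rightarrow> bool" where
  "goodstein_step b c i g g' \<longleftrightarrow>
     (if g = \<zero> then g' = \<zero>
      else \<exists>s k. is_fun UNIV s \<and>
        s \<bullet> \<zero> \<prec> b \<bullet> i \<and>
        (\<forall>j j'. j \<prec> j' \<and> j' \<preceq> k \<longrightarrow> s \<bullet> j' \<prec> s \<bullet> j) \<and>
        g = sum_exp2 (\<lambda>j. s \<bullet> j) k \<and>
        g' \<oplus> \<one> = sum_exp2 (\<lambda>j. fam c i (s \<bullet> j)) k)"

definition goodstein_sequence :: "'a set \<Rightarrow> 'a set \<Rightarrow> 'a \<Rightarrow> 'a set \<Rightarrow> bool" where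
  "goodstein_sequence b c m G \<longleftrightarrow>
     is_fun UNIV G \<and> G \<bullet> \<zero> = m \<and> (\<forall>i. goodstein_step b c i (G \<bullet> i) (G \<bullet> (i \<oplus> \<one>)))"

definition extended_goodstein_theorem :: bool where
  "extended_goodstein_theorem \<longleftrightarrow>
     (\<forall>b c m. goodstein_system b c \<and> m \<prec> exp2 (b \<bullet> \<zero>) \<longrightarrow>
        (\<exists>G. goodstein_sequence b c m G \<and> (\<exists>i. G \<bullet> i = \<zero>)))"

end

end

theory Submission
  imports Defs
begin

text \<open>
  Both directions compare the Goodstein sequence of a system with the direct limit of the orders
  \<open>{0, \<dots>, b i - 1}\<close> along the functions \<open>c\<^sub>i\<close>.

  Suppose that arithmetical comprehension holds but a sequence \<open>G\<close> stays positive.  The leading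
  exponents of \<open>G\<close> weakly descend along \<open>c\<close>; if they descended strictly infinitely often, then the
  stages of strict descent would contradict the defining property of a Goodstein system.  So they
  stabilise, and the part of \<open>G\<close> below the stable exponent again is a Goodstein sequence that stays
  positive.  Thus below each exponent that has a positive part below it at all later stages there
  is another one.  By arithmetical comprehension we can pick the smallest such exponent at each
  stage, and these weakly descend, hence stabilise, a contradiction.

  Conversely, given an enumeration of a set \<open>J\<close>, we construct a system in which every descending
  sequence computes \<open>J\<close>, together with positive numbers that descend more quickly than the
  Goodstein sequence.  By the Goodstein theorem the construction does not yield a Goodstein
  system, so there is a descending sequence and \<open>J\<close> exists.
\<close>

text \<open>The model may be nonstandard and has only Sigma01 induction, so no external
  well-foundedness is available: each descent has to be turned into an unbounded set of stages that
  belongs to the model. Leading exponents and stages of strict descent are computable; what is not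
  is the condition that a part of \<open>G\<close> stays positive at all later stages. This Pi01
  condition is the single use of arithmetical comprehension. A stable exponent n cannot make up its
  part of \<open>G\<close> alone, because 2^n would be sent to 2^(c_i(n)) - 1, which no longer
  contains the exponent c_i(n). The reversal must keep its numbers positive while always making new
  guesses. Inserting two exponents turns 2^x into 2^(x+2), and 2^(x+2) - 1 still covers 2^(x+1) +
  2^x: one power for a new guess and one that pays for all that follow. This is why exponents come
  in pairs.\<close>

declare bounded_fm.intros [simp]

section \<open>The arithmetic of a model\<close>

locale rca0 =
  fixes M :: "'a l2_structure" (structure)
  assumes model: "RCA0_model M"
begin

lemma basic:
  "n \<oplus> \<one> \<noteq> \<zero>"
  "m \<oplus> \<one> = n \<oplus> \<one> \<longleftrightarrow> m = n"
  "m \<oplus> \<zero> = m"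
  "m \<oplus> (n \<oplus> \<one>) = (m \<oplus> n) \<oplus> \<one>"
  "m \<otimes> \<zero> = \<zero>"
  "m \<otimes> (n \<oplus> \<one>) = (m \<otimes> n) \<oplus> m"
  "\<not> m \<prec> \<zero>"
  "m \<prec> n \<oplus> \<one> \<longleftrightarrow> m \<prec> n \<or> m = n"
  using model unfolding RCA0_model_def basic_axioms_def by blast+

lemma assignment_exists: "\<exists>E. assignment M E"
proof -
  obtain A where "A \<in> sets M"
    using model unfolding RCA0_model_def by blast
  then show ?thesis
    unfolding assignment_def by (intro exI[of _ "\<lambda>_. A"]) simp
qed

lemma Sigma_induct:
  assumes "Sigma01 p" "assignment M E" "sat M (e(x := \<zero>)) E p"
    and "\<And>n. sat M (e(x := n)) E p \<Longrightarrow> sat M (e(x := n \<oplus> \<one>)) E p"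
  shows "sat M (e(x := n)) E p"
  using model assms unfolding RCA0_model_def Sigma01_induction_def by blast

text \<open>\<open>Sigma01\<close> asks for a literal leading existential quantifier, so the
  equation is put under a dummy quantifier over variable 9, which must not occur in the
  terms.\<close>

lemma eq_induct:
  assumes "tval M (e(0 := \<zero>)) s = tval M (e(0 := \<zero>)) t"
    and "\<And>n. tval M (e(0 := n)) s = tval M (e(0 := n)) t \<Longrightarrow>
      tval M (e(0 := n \<oplus> \<one>)) s = tval M (e(0 := n \<oplus> \<one>)) t"
    and "9 \<notin> tvars s" "9 \<notin> tvars t"
  shows "tval M (e(0 := n)) s = tval M (e(0 := n)) t"
proof -
  obtain E where E: "assignment M E"
    using assignment_exists by blast
  have upd: "tval M (e'(9 := a)) u = tval M e' u" if "9 \<notin> tvars u" for e' a u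
    using that by (induction u) auto
  have "sat M (e(0 := n)) E (ExN 9 (Eq s t))"
    by (rule Sigma_induct) (use assms E upd in \<open>auto simp: Sigma01_def\<close>)
  then show ?thesis
    using assms upd by auto
qed

section \<open>Semiring laws\<close>

lemma add_zero_left: "\<zero> \<oplus> n = n"
  using eq_induct[of "\<lambda>_. \<zero>" "Add Zero (Var 0)" "Var 0" n] by (simp add: basic)

lemma add_assoc: "(a \<oplus> b) \<oplus> n = a \<oplus> (b \<oplus> n)"
  using eq_induct[of "(\<lambda>_. \<zero>)(1 := a, 2 := b)" "Add (Add (Var 1) (Var 2)) (Var 0)"
      "Add (Var 1) (Add (Var 2) (Var 0))" n]
  by (simp add: basic)

lemma add_one_comm: "\<one> \<oplus> n = n \<oplus> \<one>"
  using eq_induct[of "\<lambda>_. \<zero>" "Add One (Var 0)" "Add (Var 0) One" n]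
  by (simp add: basic add_zero_left)

lemma succ_add: "(n \<oplus> \<one>) \<oplus> m = (n \<oplus> m) \<oplus> \<one>"
  by (metis add_assoc add_one_comm)

lemma add_comm: "a \<oplus> n = n \<oplus> a"
  using eq_induct[of "(\<lambda>_. \<zero>)(1 := a)" "Add (Var 1) (Var 0)" "Add (Var 0) (Var 1)" n]
  by (simp add: basic add_zero_left succ_add[of _ a])

text \<open>Induction on \<open>a\<close>. An implication between equations is still a bounded
  formula, so Sigma01 induction applies to the conditional statement.\<close>

lemma add_left_cancel:
  assumes "a \<oplus> b = a \<oplus> c"
  shows "b = c"
proof -
  obtain E where E: "assignment M E"
    using assignment_exists by blast
  have "sat M (((\<lambda>_. \<zero>)(1 := b, 2 := c))(0 := a)) E
    (ExN 9 (Imp (Eq (Add (Var 0) (Var 1)) (Add (Var 0) (Var 2))) (Eq (Var 1) (Var 2))))"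
  proof (rule Sigma_induct[OF _ E], goal_cases)
    case (3 n)
    then have "n \<oplus> b = n \<oplus> c \<longrightarrow> b = c"
      by simp
    moreover have "n \<oplus> b = n \<oplus> c" if "(n \<oplus> \<one>) \<oplus> b = (n \<oplus> \<one>) \<oplus> c"
      using that basic(2) by (simp only: succ_add)
    ultimately show ?case
      by simp
  qed (simp_all add: Sigma01_def add_zero_left)
  then show ?thesis
    using assms by simp
qed

lemma mul_zero_left: "\<zero> \<otimes> n = \<zero>"
  using eq_induct[of "\<lambda>_. \<zero>" "Mul Zero (Var 0)" "Zero" n] by (simp add: basic)

lemma add_left_comm: "a \<oplus> (b \<oplus> c) = b \<oplus> (a \<oplus> c)"
  by (metis add_assoc add_comm)

lemmas add_ac = add_assoc add_comm add_left_comm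

lemma mul_distrib_right: "(a \<oplus> b) \<otimes> n = a \<otimes> n \<oplus> b \<otimes> n"
  using eq_induct[of "(\<lambda>_. \<zero>)(1 := a, 2 := b)" "Mul (Add (Var 1) (Var 2)) (Var 0)"
      "Add (Mul (Var 1) (Var 0)) (Mul (Var 2) (Var 0))" n]
  by (simp add: basic(3,5,6)) (simp add: add_ac)

lemma mul_one_left: "\<one> \<otimes> n = n"
  using eq_induct[of "\<lambda>_. \<zero>" "Mul One (Var 0)" "Var 0" n] by (simp add: basic)

lemma mul_comm: "a \<otimes> n = n \<otimes> a"
  using eq_induct[of "(\<lambda>_. \<zero>)(1 := a)" "Mul (Var 1) (Var 0)" "Mul (Var 0) (Var 1)" n]
  by (simp add: basic mul_zero_left mul_distrib_right mul_one_left)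

lemma mul_distrib_left: "n \<otimes> (a \<oplus> b) = n \<otimes> a \<oplus> n \<otimes> b"
  by (metis mul_comm mul_distrib_right)

lemma mul_assoc: "(a \<otimes> b) \<otimes> n = a \<otimes> (b \<otimes> n)"
  using eq_induct[of "(\<lambda>_. \<zero>)(1 := a, 2 := b)" "Mul (Mul (Var 1) (Var 2)) (Var 0)"
      "Mul (Var 1) (Mul (Var 2) (Var 0))" n]
  by (simp add: basic(3,5,6) mul_distrib_left mul_comm[of _ \<one>] mul_one_left)

section \<open>The order\<close>

lemma zero_or_succ: "n = \<zero> \<or> (\<exists>m. n = m \<oplus> \<one>)"
proof -
  obtain E where E: "assignment M E"
    using assignment_exists by blast
  have "sat M ((\<lambda>_. \<zero>)(0 := n)) E (ExN 9 (Disj (Eq (Var 0) Zero) (Eq (Var 0) (Add (Var 9) One))))"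
    by (rule Sigma_induct[OF _ E]) (auto simp: Sigma01_def)
  then show ?thesis
    by auto
qed

text \<open>The axioms give only a recursion for \<prec> in its second argument. Expressing it
  through addition makes transitivity and the compatibility with both operations algebraic. One
  direction is an induction on \<open>n\<close>, the other on the difference
  \<open>k\<close>.\<close>

lemma less_iff: "m \<prec> n \<longleftrightarrow> (\<exists>k. n = m \<oplus> (k \<oplus> \<one>))"
proof
  obtain E where E: "assignment M E"
    using assignment_exists by blast
  have "sat M (((\<lambda>_. \<zero>)(1 := m))(0 := n)) E
    (ExN 9 (Imp (Less (Var 1) (Var 0)) (Eq (Var 0) (Add (Var 1) (Add (Var 9) One)))))"
  proof (rule Sigma_induct[OF _ E], goal_cases)
    case (3 n)
    then obtain k where k: "m \<prec> n \<longrightarrow> n = m \<oplus> (k \<oplus> \<one>)"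
      by auto
    show ?case
    proof (cases "m \<prec> n")
      case True
      then show ?thesis
        using k by (auto intro!: exI[of _ "k \<oplus> \<one>"] simp: add_assoc)
    next
      case False
      then show ?thesis
        by (auto simp: basic(8) add_zero_left intro!: exI[of _ \<zero>])
    qed
  qed (auto simp: Sigma01_def basic(7))
  then show "m \<prec> n \<Longrightarrow> \<exists>k. n = m \<oplus> (k \<oplus> \<one>)"
    by auto
next
  obtain E where E: "assignment M E"
    using assignment_exists by blast
  assume "\<exists>k. n = m \<oplus> (k \<oplus> \<one>)"
  then obtain k where n: "n = m \<oplus> (k \<oplus> \<one>)"
    by blast
  have "sat M (((\<lambda>_. \<zero>)(1 := m))(0 := k)) E (ExN 9 (Less (Var 1) (Add (Var 1) (Add (Var 0) One))))"
    by (rule Sigma_induct[OF _ E]) (auto simp: Sigma01_def basic(3,4,8))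
  then show "m \<prec> n"
    using n by simp
qed

lemma not_less_self: "\<not> m \<prec> m"
  by (metis less_iff add_left_cancel basic(1,3))

lemma less_trans: "a \<prec> b \<Longrightarrow> b \<prec> c \<Longrightarrow> a \<prec> c"
  by (metis less_iff add_assoc)

lemma less_linear: "m \<prec> n \<or> m = n \<or> n \<prec> m"
proof -
  obtain E where E: "assignment M E"
    using assignment_exists by blast
  have "sat M (((\<lambda>_. \<zero>)(1 := m))(0 := n)) E
    (ExN 9 (Disj (Less (Var 1) (Var 0)) (Disj (Eq (Var 1) (Var 0)) (Less (Var 0) (Var 1)))))"
  proof (rule Sigma_induct[OF _ E], goal_cases)
    case 2
    show ?case
      using zero_or_succ[of m] by (auto simp: less_iff add_zero_left)
  next
    case (3 n)
    then consider "m \<prec> n" | "m = n" | "n \<prec> m"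
      by auto
    then show ?case
    proof cases
      case 3
      then obtain k where "m = n \<oplus> (k \<oplus> \<one>)"
        by (auto simp: less_iff)
      then show ?thesis
        using zero_or_succ[of k] by (auto simp: less_iff basic(3) add_ac)
    qed (auto simp: basic(8))
  qed (auto simp: Sigma01_def)
  then show ?thesis
    by auto
qed

lemma less_add_mono: "a \<prec> b \<Longrightarrow> c \<oplus> a \<prec> c \<oplus> b"
  by (metis less_iff add_assoc)

lemma less_mul_mono:
  assumes "a \<prec> b" "\<zero> \<prec> c"
  shows "c \<otimes> a \<prec> c \<otimes> b"
proof -
  obtain k where k: "b = a \<oplus> (k \<oplus> \<one>)"
    using assms(1) by (auto simp: less_iff)
  obtain l where l: "c = l \<oplus> \<one>"
    using assms(2) by (auto simp: less_iff add_zero_left)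
  have "c \<otimes> b = c \<otimes> a \<oplus> ((c \<otimes> k \<oplus> l) \<oplus> \<one>)"
    unfolding k by (simp add: mul_distrib_left mul_comm[of _ \<one>] mul_one_left) (simp add: l add_ac)
  then show ?thesis
    unfolding less_iff by blast
qed

end

section \<open>Transport of structures along bijections\<close>

definition transport :: "('a \<Rightarrow> 'b) \<Rightarrow> 'a l2_structure \<Rightarrow> 'b l2_structure" where
  "transport \<phi> M = \<lparr>zero = \<phi> (zero M), one = \<phi> (one M),
     add = (\<lambda>x y. \<phi> (add M (inv \<phi> x) (inv \<phi> y))), mul = (\<lambda>x y. \<phi> (mul M (inv \<phi> x) (inv \<phi> y))),
     less = (\<lambda>x y. less M (inv \<phi> x) (inv \<phi> y)), sets = (`) \<phi> ` sets M\<rparr>"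

context
  fixes \<phi> :: "'a \<Rightarrow> 'b" and M :: "'a l2_structure"
  assumes bij: "bij \<phi>"
begin

lemma inv_transport: "inv \<phi> (\<phi> x) = x" "\<phi> (inv \<phi> y) = y"
  using bij by (auto simp: bij_is_inj bij_is_surj surj_f_inv_f)

lemma transport_all: "(\<forall>y. P y) \<longleftrightarrow> (\<forall>x. P (\<phi> x))"
  by (metis inv_transport(2))

lemma transport_ex: "(\<exists>y. P y) \<longleftrightarrow> (\<exists>x. P (\<phi> x))"
  by (metis inv_transport(2))

lemma transport_sel [simp]:
  "zero (transport \<phi> M) = \<phi> (zero M)"
  "one (transport \<phi> M) = \<phi> (one M)"
  "add (transport \<phi> M) (\<phi> x) (\<phi> y) = \<phi> (add M x y)"
  "mul (transport \<phi> M) (\<phi> x) (\<phi> y) = \<phi> (mul M x y)"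
  "less (transport \<phi> M) (\<phi> x) (\<phi> y) = less M x y"
  "sets (transport \<phi> M) = (`) \<phi> ` sets M"
  by (simp_all add: transport_def inv_transport)

lemma tval_transport: "tval (transport \<phi> M) (\<lambda>i. \<phi> (e i)) t = \<phi> (tval M e t)"
  by (induction t) auto

lemma sat_transport: "sat (transport \<phi> M) (\<lambda>i. \<phi> (e i)) (\<lambda>X. \<phi> ` E X) p \<longleftrightarrow> sat M e E p"
proof -
  have inj: "\<phi> x = \<phi> y \<longleftrightarrow> x = y" for x y
    using bij by (auto simp: bij_def inj_eq)
  have upd: "(\<lambda>i. \<phi> (e i))(x := \<phi> a) = (\<lambda>i. \<phi> ((e(x := a)) i))" for x a and e :: "nat \<Rightarrow> 'a"
    by auto
  have updS: "(\<lambda>i. \<phi> ` (E i))(x := \<phi> ` A) = (\<lambda>i. \<phi> ` ((E(x := A)) i))" for x A and E :: "nat \<Rightarrow> 'a set"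
    by (simp add: fun_eq_iff)
  show ?thesis
  proof (induction p arbitrary: e E)
    case (AllN x p)
    show ?case
      by (simp add: transport_all upd AllN del: fun_upd_apply)
  next
    case (ExN x p)
    show ?case
      by (simp add: transport_ex upd ExN del: fun_upd_apply)
  next
    case (AllS x p)
    show ?case
      by (simp add: updS AllS del: fun_upd_apply)
  next
    case (ExS x p)
    show ?case
      by (simp add: updS ExS del: fun_upd_apply)
  qed (auto simp: tval_transport inj)
qed

text \<open>The axiom schemes quantify over assignments of the transported structure, which are not
  given as images; pulling them back along \<open>inv \<phi>\<close> covers this case.\<close>

lemma sat_transport':
  "sat (transport \<phi> M) e E p \<longleftrightarrow> sat M (\<lambda>i. inv \<phi> (e i)) (\<lambda>X. inv \<phi> ` E X) p"
proof -
  have "(\<lambda>X. \<phi> ` inv \<phi> ` E X) = E"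
    by (simp add: image_image inv_transport)
  then show ?thesis
    using sat_transport[of "\<lambda>i. inv \<phi> (e i)" "\<lambda>X. inv \<phi> ` E X" p] by (simp add: inv_transport)
qed

lemma assignment_transport: "assignment (transport \<phi> M) E \<Longrightarrow> assignment M (\<lambda>X. inv \<phi> ` E X)"
  unfolding assignment_def
proof
  fix X
  assume "\<forall>X. E X \<in> sets (transport \<phi> M)"
  then obtain A where "A \<in> sets M" "E X = \<phi> ` A"
    by (auto dest!: spec[of _ X])
  then show "inv \<phi> ` E X \<in> sets M"
    by (simp add: image_image inv_transport)
qed

lemma inv_upd: "(\<lambda>i. inv \<phi> ((e(x := a)) i)) = (\<lambda>i. inv \<phi> (e i))(x := inv \<phi> a)"
  by auto

lemma RCA0_transport:
  assumes M: "RCA0_model M"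
  shows "RCA0_model (transport \<phi> M)"
  unfolding RCA0_model_def
proof (intro conjI)
  show "sets (transport \<phi> M) \<noteq> {}"
    using M by (simp add: RCA0_model_def)
  have inj: "\<phi> x = \<phi> y \<longleftrightarrow> x = y" for x y
    using bij by (auto simp: bij_def inj_eq)
  show "basic_axioms (transport \<phi> M)"
    using M by (simp add: RCA0_model_def basic_axioms_def transport_all inj)
  show "Sigma01_induction (transport \<phi> M)"
    unfolding Sigma01_induction_def
  proof (intro allI impI)
    fix p x n and e :: "nat \<Rightarrow> 'b" and E :: "nat \<Rightarrow> 'b set"
    let ?e = "\<lambda>i. inv \<phi> (e i)" and ?E = "\<lambda>X. inv \<phi> ` E X"
    assume p: "Sigma01 p" "assignment (transport \<phi> M) E"
      "sat (transport \<phi> M) (e(x := zero (transport \<phi> M))) E p"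
      "\<forall>n. sat (transport \<phi> M) (e(x := n)) E p \<longrightarrow>
         sat (transport \<phi> M) (e(x := add (transport \<phi> M) n (one (transport \<phi> M)))) E p"
    have "sat M (?e(x := n)) ?E p" for n
    proof (rule rca0.Sigma_induct)
      show "assignment M ?E"
        by (rule assignment_transport[OF p(2)])
      show "sat M (?e(x := zero M)) ?E p"
        using p(3) by (simp only: sat_transport' inv_upd transport_sel inv_transport)
      show "sat M (?e(x := add M n (one M))) ?E p" if "sat M (?e(x := n)) ?E p" for n
        using p(4)[rule_format, of "\<phi> n"] that
        by (simp only: sat_transport' inv_upd transport_sel inv_transport)
    qed (use M p(1) in \<open>simp_all add: rca0_def\<close>)
    then show "sat (transport \<phi> M) (e(x := n)) E p"
      by (simp only: sat_transport' inv_upd)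
  qed
  show "Delta01_comprehension (transport \<phi> M)"
    unfolding Delta01_comprehension_def
  proof (intro allI impI)
    fix p q x and e :: "nat \<Rightarrow> 'b" and E :: "nat \<Rightarrow> 'b set"
    let ?e = "\<lambda>i. inv \<phi> (e i)" and ?E = "\<lambda>X. inv \<phi> ` E X"
    assume p: "Sigma01 p" "Pi01 q" "assignment (transport \<phi> M) E"
      "\<forall>n. sat (transport \<phi> M) (e(x := n)) E p \<longleftrightarrow> sat (transport \<phi> M) (e(x := n)) E q"
    have "sat M (?e(x := n)) ?E p \<longleftrightarrow> sat M (?e(x := n)) ?E q" for n
      using p(4)[rule_format, of "\<phi> n"] by (simp only: sat_transport' inv_upd inv_transport)
    then obtain A where A: "A \<in> sets M" "\<And>n. n \<in> A \<longleftrightarrow> sat M (?e(x := n)) ?E p"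
      using M p(1,2) assignment_transport[OF p(3)]
      unfolding RCA0_model_def Delta01_comprehension_def by blast
    have "\<phi> n \<in> \<phi> ` A \<longleftrightarrow> sat (transport \<phi> M) (e(x := \<phi> n)) E p" for n
      by (simp only: inj_image_mem_iff[OF bij_is_inj[OF bij]] A(2) sat_transport' inv_upd inv_transport)
    then show "\<exists>A\<in>sets (transport \<phi> M). \<forall>n. n \<in> A \<longleftrightarrow> sat (transport \<phi> M) (e(x := n)) E p"
      using A(1) by (intro bexI[of _ "\<phi> ` A"]) (simp_all only: transport_all transport_sel imageI simp_thms)
  qed
qed

end

definition standard_model :: "nat l2_structure" where
  "standard_model = \<lparr>zero = 0, one = 1, add = (+), mul = (*), less = (<), sets = UNIV\<rparr>"

lemma RCA0_standard_model: "RCA0_model standard_model"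
proof -
  have "sat standard_model (e(x := n)) E p"
    if "sat standard_model (e(x := 0)) E p"
      "\<And>n. sat standard_model (e(x := n)) E p \<Longrightarrow> sat standard_model (e(x := Suc n)) E p"
    for p x e E n
    using that by (induction n) auto
  then have "Sigma01_induction standard_model"
    unfolding Sigma01_induction_def by (simp add: standard_model_def)
  moreover have "Delta01_comprehension standard_model"
    unfolding Delta01_comprehension_def
  proof (intro allI impI)
    fix p x e E
    show "\<exists>A\<in>sets standard_model. \<forall>n. n \<in> A \<longleftrightarrow> sat standard_model (e(x := n)) E p"
      by (intro bexI[of _ "{n. sat standard_model (e(x := n)) E p}"]) (simp_all add: standard_model_def)
  qed
  moreover have "basic_axioms standard_model"
    unfolding basic_axioms_def standard_model_def by auto
  ultimately show ?thesis
    unfolding RCA0_model_def by (simp add: standard_model_def)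
qed

section \<open>A type of numbers\<close>

text \<open>
  The model is a term, so it cannot carry type class instances.  A counterexample to the theorem,
  however, can be selected by a closed term depending on the type \<open>'a\<close> only.  The type \<open>'a mnum\<close> is
  a copy of the number domain of that counterexample, or of \<open>nat\<close> if there is no counterexample;
  in both cases it is the number domain of a model of \<open>RCA\<^sub>0\<close>, hence a discretely ordered semiring.
\<close>

definition counterexample :: "'a l2_structure \<Rightarrow> bool" where
  "counterexample M \<longleftrightarrow>
     RCA0_model M \<and> \<not> (arithmetical_comprehension M \<longleftrightarrow> extended_goodstein_theorem M)"

typedef 'a mnum = "{x :: 'a + nat. isl x \<longleftrightarrow> (\<exists>M :: 'a l2_structure. counterexample M)}"
proof (cases "\<exists>M :: 'a l2_structure. counterexample M")
  case True
  then show ?thesis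
    by (intro exI[of _ "Inl undefined"]) simp
next
  case False
  then show ?thesis
    by (intro exI[of _ "Inr 0"]) simp
qed

definition of_elem :: "'a \<Rightarrow> 'a mnum" where
  "of_elem x = Abs_mnum (Inl x)"

definition num_model :: "'a mnum l2_structure" where
  "num_model =
     (if \<exists>M :: 'a l2_structure. counterexample M then transport of_elem (SOME M. counterexample M)
      else transport (\<lambda>n. Abs_mnum (Inr n)) standard_model)"

lemma bij_of_elem:
  assumes "counterexample (M :: 'a l2_structure)"
  shows "bij (of_elem :: 'a \<Rightarrow> 'a mnum)"
proof (rule bijI)
  have ex: "\<exists>M :: 'a l2_structure. counterexample M"
    using assms by blast
  show "inj (of_elem :: 'a \<Rightarrow> 'a mnum)"
    using ex by (auto simp: of_elem_def inj_def Abs_mnum_inject)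
  show "surj (of_elem :: 'a \<Rightarrow> 'a mnum)"
    unfolding surj_def
  proof
    fix y :: "'a mnum"
    obtain z where z: "y = Abs_mnum z" "isl z"
      using ex by (cases y) auto
    then show "\<exists>x. y = of_elem x"
      by (cases z) (auto simp: of_elem_def)
  qed
qed

lemma RCA0_num_model: "RCA0_model (num_model :: 'a mnum l2_structure)"
proof (cases "\<exists>M :: 'a l2_structure. counterexample M")
  case True
  then have "counterexample (SOME M :: 'a l2_structure. counterexample M)"
    by (rule someI_ex)
  then have "RCA0_model (transport of_elem (SOME M :: 'a l2_structure. counterexample M))"
    using bij_of_elem counterexample_def by (blast intro: RCA0_transport)
  then show ?thesis
    using True by (simp add: num_model_def)
next
  case False
  have "bij (\<lambda>n. Abs_mnum (Inr n) :: 'a mnum)"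
  proof (rule bijI)
    show "inj (\<lambda>n. Abs_mnum (Inr n) :: 'a mnum)"
      using False by (auto simp: inj_def Abs_mnum_inject)
    show "surj (\<lambda>n. Abs_mnum (Inr n) :: 'a mnum)"
      unfolding surj_def
    proof
      fix y :: "'a mnum"
      obtain z where z: "y = Abs_mnum z" "\<not> isl z"
        using False by (cases y) auto
      then show "\<exists>n. y = Abs_mnum (Inr n)"
        by (cases z) auto
    qed
  qed
  then show ?thesis
    using False by (simp add: num_model_def RCA0_transport RCA0_standard_model)
qed

interpretation num: rca0 num_model
  by standard (rule RCA0_num_model)

instantiation mnum :: (type) comm_semiring_1
begin

definition zero_mnum :: "'a mnum" where "zero_mnum = zero num_model"
definition one_mnum :: "'a mnum" where "one_mnum = one num_model"
definition plus_mnum :: "'a mnum \<Rightarrow> 'a mnum \<Rightarrow> 'a mnum" where "plus_mnum = add num_model"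
definition times_mnum :: "'a mnum \<Rightarrow> 'a mnum \<Rightarrow> 'a mnum" where "times_mnum = mul num_model"

instance
proof
  fix a b c :: "'a mnum"
  show "a + b + c = a + (b + c)" "a + b = b + a" "0 + a = a"
    by (simp_all add: plus_mnum_def zero_mnum_def num.add_ac num.add_zero_left num.basic(3))
  show "a * b * c = a * (b * c)"
    by (simp add: times_mnum_def num.mul_assoc)
  show "a * b = b * a"
    unfolding times_mnum_def by (rule num.mul_comm)
  show "1 * a = a" "0 * a = 0" "a * 0 = 0" "(a + b) * c = a * c + b * c"
    by (simp_all add: times_mnum_def one_mnum_def zero_mnum_def plus_mnum_def num.mul_one_left
        num.mul_zero_left num.mul_distrib_right num.basic(5))
  show "(0 :: 'a mnum) \<noteq> 1"
    using num.basic(1)[of "zero num_model"] by (simp add: one_mnum_def zero_mnum_def num.add_zero_left eq_commute)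
qed

end

instantiation mnum :: (type) linorder
begin

definition less_mnum :: "'a mnum \<Rightarrow> 'a mnum \<Rightarrow> bool" where "less_mnum = less num_model"
definition less_eq_mnum :: "'a mnum \<Rightarrow> 'a mnum \<Rightarrow> bool" where "less_eq_mnum x y \<longleftrightarrow> x < y \<or> x = y"

instance
proof
  fix x y z :: "'a mnum"
  show "x < y \<longleftrightarrow> x \<le> y \<and> \<not> y \<le> x"
    unfolding less_mnum_def less_eq_mnum_def using num.less_trans num.not_less_self by blast
  show "x \<le> x"
    by (simp add: less_eq_mnum_def)
  show "x \<le> y \<Longrightarrow> y \<le> z \<Longrightarrow> x \<le> z"
    unfolding less_mnum_def less_eq_mnum_def using num.less_trans by blast
  show "x \<le> y \<Longrightarrow> y \<le> x \<Longrightarrow> x = y"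
    unfolding less_mnum_def less_eq_mnum_def using num.less_trans num.not_less_self by blast
  show "x \<le> y \<or> y \<le> x"
    unfolding less_mnum_def less_eq_mnum_def using num.less_linear by blast
qed

end

lemma mnum_less_iff: "m < n \<longleftrightarrow> (\<exists>k. n = m + (k + 1))" for m n :: "'a mnum"
  unfolding less_mnum_def plus_mnum_def one_mnum_def by (rule num.less_iff)

lemma mnum_le_iff: "m \<le> n \<longleftrightarrow> (\<exists>k. n = m + k)" for m n :: "'a mnum"
proof -
  have "(\<exists>k. n = m + k) \<longleftrightarrow> n = m \<or> (\<exists>k. n = m + (k + 1))"
    using num.zero_or_succ[folded plus_mnum_def one_mnum_def zero_mnum_def]
    by (metis add.right_neutral)
  then show ?thesis
    by (auto simp: less_eq_mnum_def mnum_less_iff)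
qed

lemma mnum_add_left_cancel: "a + b = a + c \<Longrightarrow> b = c" for a b c :: "'a mnum"
  unfolding plus_mnum_def by (rule num.add_left_cancel)

instantiation mnum :: (type) discrete_linordered_semidom
begin

definition minus_mnum :: "'a mnum \<Rightarrow> 'a mnum \<Rightarrow> 'a mnum" where
  "minus_mnum x y = (if y \<le> x then THE z. x = y + z else 0)"

lemma mnum_add_minus: "(y + z) - y = z" for y z :: "'a mnum"
  unfolding minus_mnum_def by (auto simp: mnum_le_iff dest: mnum_add_left_cancel intro!: the_equality)

lemma mnum_minus_less: "x < y \<Longrightarrow> x - y = 0" for x y :: "'a mnum"
  by (auto simp: minus_mnum_def)

lemma mnum_minus_cases:
  fixes x y :: "'a mnum"
  obtains "x < y" "x - y = 0" | "x = y + (x - y)"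
  by (metis mnum_le_iff mnum_minus_less mnum_add_minus not_le)

lemma mnum_add_less_mono: "c + a < c + b \<longleftrightarrow> a < b" for a b c :: "'a mnum"
proof -
  have "a < b \<Longrightarrow> c + a < c + b" for a b
    unfolding less_mnum_def plus_mnum_def by (rule num.less_add_mono)
  then show ?thesis
    by (metis less_asym linorder_neqE order_less_irrefl)
qed

lemma mnum_le_add: "a \<le> a + c" for a c :: "'a mnum"
  by (auto simp: mnum_le_iff)

lemma mnum_mult_less_mono: "a < b \<Longrightarrow> 0 < c \<Longrightarrow> c * a < c * b" for a b c :: "'a mnum"
  unfolding less_mnum_def times_mnum_def zero_mnum_def by (rule num.less_mul_mono)

lemma mnum_zero_le: "0 \<le> a" for a :: "'a mnum"
  by (auto simp: mnum_le_iff)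

instance
proof
  fix a b c :: "'a mnum"
  show "a + b - a = b"
    by (rule mnum_add_minus)
  show diff_add: "a - b - c = a - (b + c)" for a b c :: "'a mnum"
  proof (cases a b rule: mnum_minus_cases)
    case 1
    moreover have "0 - c = 0"
      using mnum_zero_le[of c] mnum_minus_less[of 0 c] mnum_add_minus[of 0 0]
      by (cases "c = 0") (auto simp: less_le)
    moreover have "a < b + c"
      using 1(1) mnum_le_add[of b c] by (rule less_le_trans)
    ultimately show ?thesis
      by (simp add: mnum_minus_less)
  next
    case 2
    show ?thesis
    proof (cases "a - b" c rule: mnum_minus_cases)
      case 1
      then have "a < b + c"
        using 2 by (metis mnum_add_less_mono)
      then show ?thesis
        using 1 by (simp add: mnum_minus_less)
    next
      case 3: 2
      have "a = (b + c) + (a - b - c)"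
        using 2 3 by (metis add.assoc)
      then show ?thesis
        by (metis mnum_add_minus)
    qed
  qed
  show "a * (b - c) = a * b - a * c"
  proof (cases b c rule: mnum_minus_cases)
    case 1
    have "a = 0 \<or> a * b < a * c"
      using mnum_mult_less_mono[OF 1(1), of a] mnum_zero_le[of a] by (auto simp: less_le)
    then show ?thesis
      using 1 mnum_add_minus[of 0 0] by (auto simp: mnum_minus_less)
  next
    case 2
    have "a * b = a * c + a * (b - c)"
      by (subst 2) (simp add: distrib_left)
    then show ?thesis
      by (metis mnum_add_minus)
  qed
  show "a \<le> b \<Longrightarrow> c + a \<le> c + b"
    by (auto simp: mnum_le_iff add.assoc)
  show "a < b \<Longrightarrow> 0 < c \<Longrightarrow> c * a < c * b"
    by (rule mnum_mult_less_mono)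
  show "a \<noteq> 0 \<Longrightarrow> b \<noteq> 0 \<Longrightarrow> a * b \<noteq> 0"
    using mnum_mult_less_mono[of 0 b a] mnum_zero_le[of a] mnum_zero_le[of b]
    by (auto simp: less_le)
  show "(0 :: 'a mnum) < 1"
    using mnum_zero_le[of 1] by (auto simp: less_le)
  show "b \<le> a \<Longrightarrow> a - b + b = a"
    by (metis mnum_le_iff mnum_add_minus add.commute)
  show "a < b \<longleftrightarrow> a + 1 \<le> b"
    by (auto simp: mnum_less_iff mnum_le_iff ac_simps)
qed

end

lemma mnum_minus_eq_zero: "x \<le> y \<Longrightarrow> x - y = 0" for x y :: "'a mnum"
  by (metis mnum_minus_less less_le diff_self cancel_comm_monoid_add_class.diff_cancel)

lemma mnum_zero_or_succ:
  fixes n :: "'a mnum"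
  obtains "n = 0" | m where "n = m + 1"
  using num.zero_or_succ[of n] by (auto simp: plus_mnum_def one_mnum_def zero_mnum_def)

declare mnum_zero_le [simp]

lemma mnum_neq_zero: "n \<noteq> 0 \<longleftrightarrow> 0 < n" "\<not> n < 0" "n \<le> 0 \<longleftrightarrow> n = 0" for n :: "'a mnum"
  using mnum_zero_le[of n] by (auto simp: less_le intro: antisym)

section \<open>The ring of differences\<close>

text \<open>Linear arithmetic over an ordered semiring is delegated to this ordered ring.\<close>

definition diffrel :: "'a::linordered_semidom \<times> 'a \<Rightarrow> 'a \<times> 'a \<Rightarrow> bool" where
  "diffrel = (\<lambda>(x, y) (u, v). x + v = u + y)"

quotient_type (overloaded) 'a diffring = "'a::linordered_semidom \<times> 'a" / diffrel
  morphisms rep_diffring pair_diffring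
proof (rule equivpI)
  show "reflp (diffrel :: 'a \<times> 'a \<Rightarrow> _)" "symp (diffrel :: 'a \<times> 'a \<Rightarrow> _)"
    by (auto simp: diffrel_def reflp_def symp_def)
  show "transp (diffrel :: 'a \<times> 'a \<Rightarrow> _)"
  proof (clarsimp simp: diffrel_def transp_def)
    fix a b c d e f :: 'a
    assume "a + d = c + b" "c + f = e + d"
    then have "(a + f) + (c + d) = (e + b) + (c + d)"
      by (metis (no_types, opaque_lifting) add.assoc add.commute)
    then show "a + f = e + b"
      by simp
  qed
qed

instantiation diffring :: (linordered_semidom) comm_ring_1
begin

lift_definition zero_diffring :: "'a diffring" is "(0, 0)" .
lift_definition one_diffring :: "'a diffring" is "(1, 0)" .
lift_definition plus_diffring :: "'a diffring \<Rightarrow> 'a diffring \<Rightarrow> 'a diffring"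
  is "\<lambda>(x, y) (u, v). (x + u, y + v)"
  by (clarsimp simp: diffrel_def) (metis add.assoc add.left_commute)
lift_definition uminus_diffring :: "'a diffring \<Rightarrow> 'a diffring"
  is "\<lambda>(x, y). (y, x)"
  by (clarsimp simp: diffrel_def) (metis add.commute)
lift_definition minus_diffring :: "'a diffring \<Rightarrow> 'a diffring \<Rightarrow> 'a diffring"
  is "\<lambda>(x, y) (u, v). (x + v, y + u)"
  by (clarsimp simp: diffrel_def) (metis add.assoc add.left_commute add.commute)
lift_definition times_diffring :: "'a diffring \<Rightarrow> 'a diffring \<Rightarrow> 'a diffring"
  is "\<lambda>(x, y) (u, v). (x * u + y * v, x * v + y * u)"
proof (unfold diffrel_def, clarify)
  fix a b c d e f g h :: 'a
  assume 1: "a + d = c + b" and 2: "e + h = g + f"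
  \<comment> \<open>The same summand is added on both sides so that the two hypotheses can be
    applied one after the other without subtraction.\<close>
  have "(a * e + b * f + (c * h + d * g)) + (d * e + c * f) =
     (a + d) * e + (c + b) * f + (c * h + d * g)"
    by (simp add: algebra_simps)
  also have "\<dots> = (c + b) * e + (a + d) * f + (c * h + d * g)"
    by (simp add: 1)
  also have "\<dots> = c * (e + h) + d * (g + f) + b * e + a * f"
    by (simp add: algebra_simps)
  also have "\<dots> = c * (g + f) + d * (e + h) + b * e + a * f"
    by (simp add: 2)
  also have "\<dots> = (c * g + d * h + (a * f + b * e)) + (d * e + c * f)"
    by (simp add: algebra_simps)
  finally show "a * e + b * f + (c * h + d * g) = c * g + d * h + (a * f + b * e)"
    by simp
qed

instance
  by standard (transfer; clarsimp simp: diffrel_def algebra_simps)+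

end

instantiation diffring :: (linordered_semidom) linordered_idom
begin

lift_definition less_eq_diffring :: "'a diffring \<Rightarrow> 'a diffring \<Rightarrow> bool"
  is "\<lambda>(x, y) (u, v). x + v \<le> u + y"
proof (unfold diffrel_def, clarify)
  fix a b c d e f g h :: 'a
  assume 1: "a + d = c + b" and 2: "e + h = g + f"
  have "a + f \<le> e + b \<longleftrightarrow> (a + f) + (d + h) \<le> (e + b) + (d + h)"
    by simp
  also have "\<dots> \<longleftrightarrow> (a + d) + (f + h) \<le> (e + h) + (b + d)"
    by (simp add: ac_simps)
  also have "\<dots> \<longleftrightarrow> (c + h) + (b + f) \<le> (g + d) + (b + f)"
    unfolding 1 2 by (simp add: ac_simps)
  finally show "a + f \<le> e + b \<longleftrightarrow> c + h \<le> g + d"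
    by simp
qed

definition less_diffring :: "'a diffring \<Rightarrow> 'a diffring \<Rightarrow> bool" where
  "less_diffring x y \<longleftrightarrow> x \<le> y \<and> x \<noteq> y"
definition abs_diffring :: "'a diffring \<Rightarrow> 'a diffring" where
  "abs_diffring i = (if i < 0 then - i else i)"
definition sgn_diffring :: "'a diffring \<Rightarrow> 'a diffring" where
  "sgn_diffring i = (if i = 0 then 0 else if 0 < i then 1 else - 1)"

instance
proof
  fix i j k :: "'a diffring"
  show anti: "i \<le> j \<Longrightarrow> j \<le> i \<Longrightarrow> i = j" for i j :: "'a diffring"
    by transfer (auto simp: diffrel_def)
  show "i < j \<longleftrightarrow> i \<le> j \<and> \<not> j \<le> i"
    unfolding less_diffring_def using anti by auto
  show "i \<le> i"
    by transfer auto
  show "i \<le> j \<or> j \<le> i"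
    by transfer auto
  show "i \<le> j \<Longrightarrow> j \<le> k \<Longrightarrow> i \<le> k"
  proof (transfer, clarsimp)
    fix a b c d e f :: 'a
    assume "a + d \<le> c + b" "c + f \<le> e + d"
    then have "(a + d) + (c + f) \<le> (c + b) + (e + d)"
      by (rule add_mono)
    then have "(a + f) + (c + d) \<le> (e + b) + (c + d)"
      by (simp add: ac_simps)
    then show "a + f \<le> e + b"
      by simp
  qed
  show "i \<le> j \<Longrightarrow> k + i \<le> k + j"
  proof (transfer, clarsimp)
    fix a b c d e f :: 'a
    assume "a + d \<le> c + b"
    then have "(a + d) + (e + f) \<le> (c + b) + (e + f)"
      by simp
    then show "e + a + (f + d) \<le> e + c + (f + b)"
      by (simp add: ac_simps)
  qed
  show "i < j \<Longrightarrow> 0 < k \<Longrightarrow> k * i < k * j"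
    unfolding less_diffring_def
  proof (transfer, clarsimp simp: diffrel_def)
    fix a b c d e f :: 'a
    assume le: "a + d \<le> c + b" "f \<le> e" and ne: "a + d \<noteq> c + b" "f \<noteq> e"
    then obtain u where u: "e = f + u" "0 < u"
      by (metis add_le_cancel_left add.right_neutral le_add_diff_inverse less_le)
    have "u * (a + d) < u * (c + b)"
      using le ne u by (intro mult_strict_left_mono) auto
    moreover have "e * a + f * b + (e * d + f * c) = f * (a + b + c + d) + u * (a + d)"
      "e * c + f * d + (e * b + f * a) = f * (a + b + c + d) + u * (c + b)"
      unfolding u by (simp_all add: algebra_simps)
    ultimately show "e * a + f * b + (e * d + f * c) \<le> e * c + f * d + (e * b + f * a) \<and>
        e * a + f * b + (e * d + f * c) \<noteq> e * c + f * d + (e * b + f * a)"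
      by (simp add: less_le)
  qed
qed (simp_all add: abs_diffring_def sgn_diffring_def)

end

lift_definition emb :: "'a::linordered_semidom \<Rightarrow> 'a diffring" is "\<lambda>x. (x, 0)" .

lemma emb_0: "emb 0 = 0" and emb_1: "emb 1 = 1" and emb_add: "emb (x + y) = emb x + emb y"
  and emb_mult: "emb (x * y) = emb x * emb y"
  by (transfer; simp add: diffrel_def)+

lemma emb_numeral: "emb (numeral w) = numeral w"
  by (induction w rule: num.induct) (simp_all only: numeral.simps emb_1 emb_add)

text \<open>Restricted to \<open>'a mnum\<close> so that rewriting with these equivalences terminates.\<close>

lemma emb_eq: "x = y \<longleftrightarrow> emb x = emb y" and emb_le: "x \<le> y \<longleftrightarrow> emb x \<le> emb y"
  for x y :: "'a mnum"
  by (transfer; simp add: diffrel_def)+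

lemma emb_less: "x < y \<longleftrightarrow> emb x < emb y" for x y :: "'a mnum"
  unfolding less_le[of x] less_le[of "emb x"] emb_le[of x y] emb_eq[of x y] ..

lemma emb_pos: "0 \<le> emb x" for x :: "'a mnum"
  using emb_le[of 0 x] by (simp add: emb_0)

lemma emb_diff: "y \<le> x \<Longrightarrow> emb (x - y) = emb x - emb y" for x y :: "'a mnum"
  using emb_add[of "x - y" y] by simp

lemmas emb_arith = emb_0 emb_1 emb_add emb_mult emb_eq emb_le emb_less emb_numeral

section \<open>Recursive predicates and functions\<close>

definition pr :: "'a mnum \<Rightarrow> 'a mnum \<Rightarrow> 'a mnum" where
  "pr x y = (x + y) * (x + y) + x"

lemma pr_ge: "x \<le> pr x y" "y \<le> pr x y"
proof -
  show "x \<le> pr x y"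
    unfolding pr_def by simp
  have "x + y \<le> (x + y) * (x + y)"
  proof (cases "x + y" rule: mnum_zero_or_succ)
    case (2 m)
    then show ?thesis
      by (simp add: distrib_right)
  qed simp
  then show "y \<le> pr x y"
    unfolding pr_def by (meson add_increasing2 mnum_zero_le le_add_same_cancel2 order_trans)
qed

text \<open>A pair lies between the square of \<open>x + y\<close> and the next square, so its value
  determines \<open>x + y\<close>, and then \<open>x\<close>.\<close>

lemma pr_inject [simp]: "pr x y = pr u v \<longleftrightarrow> x = u \<and> y = v"
proof
  have less: "pr x y < pr u v" if "x + y < u + v" for x y u v :: "'a mnum"
  proof -
    have "x + y + 1 \<le> u + v"
      using that by (simp add: less_iff_succ_less_eq)
    then have "(x + y + 1) * (x + y + 1) \<le> (u + v) * (u + v)"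
      by (intro mult_mono) auto
    moreover have "(x + y) * (x + y) + x < (x + y + 1) * (x + y + 1)"
      using emb_pos[of x] emb_pos[of y] by (simp only: emb_arith) (simp add: algebra_simps)
    ultimately show ?thesis
      unfolding pr_def by (metis add_increasing2 less_le_trans mnum_zero_le)
  qed
  assume eq: "pr x y = pr u v"
  then have "x + y = u + v"
    using less[of x y u v] less[of u v x y] by (metis less_irrefl linorder_neqE)
  then show "x = u \<and> y = v"
    using eq unfolding pr_def by auto
qed simp

definition p1 :: "'a mnum \<Rightarrow> 'a mnum" where
  "p1 z = (if \<exists>x y. z = pr x y then THE x. \<exists>y. z = pr x y else 0)"
definition p2 :: "'a mnum \<Rightarrow> 'a mnum" where
  "p2 z = (if \<exists>x y. z = pr x y then THE y. \<exists>x. z = pr x y else 0)"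

lemma p_pr [simp]: "p1 (pr x y) = x" "p2 (pr x y) = y"
  by (auto simp: p1_def p2_def)

lemma pair_cases:
  obtains x y where "z = pr x y" | "\<nexists>x y. z = pr x y" "p1 z = 0" "p2 z = 0"
  unfolding p1_def p2_def by (cases "\<exists>x y. z = pr x y") auto

lemma p_le: "p1 z \<le> z" "p2 z \<le> z"
  by (cases z rule: pair_cases; simp add: pr_ge)+

abbreviation SS :: "'a mnum set set" where
  "SS \<equiv> sets num_model"

text \<open>
  Predicates and functions of several arguments are expressed by unary ones via pairing: a
  predicate of \<open>x\<close> and \<open>y\<close> is a predicate of \<open>w\<close> with \<open>x = p1 w\<close> and \<open>y = p2 w\<close>.  In this way
  comprehension and induction never refer to formulas once the following closure properties are
  established.  On numbers that are not pairs, \<open>p1\<close> and \<open>p2\<close> are \<open>0\<close>.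
\<close>

definition rec :: "('a mnum \<Rightarrow> bool) \<Rightarrow> bool" where
  "rec P \<longleftrightarrow> Collect P \<in> SS"

text \<open>Totality is part of the definition. Therefore a reference to \<open>f x\<close> inside a
  formula can be resolved by an existential or by a universal quantifier over the graph.\<close>

definition recf :: "('a mnum \<Rightarrow> 'a mnum) \<Rightarrow> bool" where
  "recf f \<longleftrightarrow> rec (\<lambda>w. \<exists>x. w = pr x (f x))"

lemma num_model_sel [simp]:
  "zero num_model = 0" "one num_model = 1" "add num_model = (+)" "mul num_model = (*)"
  "less num_model = (<)"
  by (simp_all add: zero_mnum_def one_mnum_def plus_mnum_def times_mnum_def less_mnum_def)

lemma assignment_num_model: "assignment num_model E \<longleftrightarrow> (\<forall>X. E X \<in> SS)"
  by (simp add: assignment_def)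

text \<open>Naming convention for the formulas below: number variable 0 is the argument, 9 is the
  unbounded quantifier, 1 to 4 are bounded quantifiers.\<close>

lemma rec_delta:
  assumes p: "bounded_fm p" "bounded_fm q" "\<And>X. E X \<in> SS"
    and P: "\<And>n. P n \<longleftrightarrow> (\<exists>a. sat num_model (e(0 := n, 9 := a)) E p)"
    "\<And>n. P n \<longleftrightarrow> (\<forall>a. sat num_model (e(0 := n, 9 := a)) E q)"
  shows "rec P"
proof -
  have "Sigma01 (ExN 9 p)" "Pi01 (AllN 9 q)"
    using p unfolding Sigma01_def Pi01_def by blast+
  moreover have "sat num_model (e(0 := n)) E (ExN 9 p) \<longleftrightarrow> sat num_model (e(0 := n)) E (AllN 9 q)" for n
    using P by auto
  moreover have "Delta01_comprehension (num_model :: 'a mnum l2_structure)"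
    using RCA0_num_model unfolding RCA0_model_def by blast
  ultimately obtain A where A: "A \<in> SS" "\<forall>n. n \<in> A \<longleftrightarrow> sat num_model (e(0 := n)) E (ExN 9 p)"
    unfolding Delta01_comprehension_def using p(3) by (metis assignment_num_model)
  then have "A = Collect P"
    using P(1) by auto
  then show ?thesis
    using A unfolding rec_def by simp
qed

text \<open>Under a dummy quantifier over variable 9, a bounded formula is Sigma01 and Pi01 at
  once.\<close>

lemma rec_bounded:
  assumes "bounded_fm p" "\<And>X. E X \<in> SS"
    and "\<And>n a. sat num_model (e(0 := n, 9 := a)) E p \<longleftrightarrow> P n"
  shows "rec P"
  using assms by (intro rec_delta[of p p E P e]) auto

lemma SS_nonempty: "\<exists>A. A \<in> (SS :: 'a mnum set set)"
  using RCA0_num_model unfolding RCA0_model_def by blast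

definition pairt :: "tm \<Rightarrow> tm \<Rightarrow> tm" where
  "pairt s t = Add (Mul (Add s t) (Add s t)) s"

abbreviation bEx :: "nat \<Rightarrow> tm \<Rightarrow> fm \<Rightarrow> fm" where
  "bEx x t p \<equiv> ExN x (Conj (Less (Var x) t) p)"

lemma pairt_simps [simp]:
  "tval num_model e (pairt s t) = pr (tval num_model e s) (tval num_model e t)"
  "tvars (pairt s t) = tvars s \<union> tvars t"
  by (auto simp: pr_def pairt_def)

lemma less_pr [simp]: "x < pr x y + 1" "y < pr x y + 1" "x < pr u (pr x y) + 1" "y < pr u (pr x y) + 1"
  "x < pr (pr x y) u + 1" "y < pr (pr x y) u + 1"
  by (simp_all add: pr_ge order_trans[OF pr_ge(1) pr_ge(1)] order_trans[OF pr_ge(1) pr_ge(2)]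
      order_trans[OF pr_ge(2) pr_ge(1)] order_trans[OF pr_ge(2) pr_ge(2)] flip: less_eq_iff_succ_less)

section \<open>Closure properties of recursive predicates and functions\<close>

lemma rec_not: "rec P \<Longrightarrow> rec (\<lambda>z. \<not> P z)"
  by (rule rec_bounded[of "Neg (Mem (Var 0) 0)" "\<lambda>_. Collect P"]) (auto simp: rec_def)

lemma rec_conj: "rec P \<Longrightarrow> rec Q \<Longrightarrow> rec (\<lambda>z. P z \<and> Q z)"
  by (rule rec_bounded[of "Conj (Mem (Var 0) 0) (Mem (Var 0) 1)" "\<lambda>X. if X = 0 then Collect P else Collect Q"])
    (auto simp: rec_def)

lemma rec_disj: "rec P \<Longrightarrow> rec Q \<Longrightarrow> rec (\<lambda>z. P z \<or> Q z)"
  using rec_not[OF rec_conj[OF rec_not[of P] rec_not[of Q]]] by simp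

lemma rec_imp: "rec P \<Longrightarrow> rec Q \<Longrightarrow> rec (\<lambda>z. P z \<longrightarrow> Q z)"
  unfolding imp_conv_disj by (intro rec_disj rec_not)

lemma rec_iff: "rec P \<Longrightarrow> rec Q \<Longrightarrow> rec (\<lambda>z. P z \<longleftrightarrow> Q z)"
  unfolding iff_conv_conj_imp by (intro rec_conj rec_imp)

text \<open>Since \<open>f\<close> has exactly one value at \<open>z\<close>, some value of
  \<open>f\<close> at \<open>z\<close> satisfies \<open>P\<close> if and only if all do. These are
  the Sigma01 and the Pi01 form.\<close>

lemma rec_comp: "rec P \<Longrightarrow> recf f \<Longrightarrow> rec (\<lambda>z. P (f z))"
  by (rule rec_delta[of "Conj (Mem (pairt (Var 0) (Var 9)) 1) (Mem (Var 9) 0)"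
        "Imp (Mem (pairt (Var 0) (Var 9)) 1) (Mem (Var 9) 0)"
        "\<lambda>X. if X = 0 then Collect P else {w. \<exists>x. w = pr x (f x)}"])
    (auto simp: rec_def recf_def)

lemma recf_comp:
  assumes "recf f" "recf g"
  shows "recf (\<lambda>z. f (g z))"
  unfolding recf_def
  by (rule rec_delta[of "bEx 1 (Add (Var 0) One) (bEx 2 (Add (Var 0) One)
        (Conj (Eq (Var 0) (pairt (Var 1) (Var 2)))
          (Conj (Mem (pairt (Var 1) (Var 9)) 1) (Mem (pairt (Var 9) (Var 2)) 0))))"
        "bEx 1 (Add (Var 0) One) (bEx 2 (Add (Var 0) One)
        (Conj (Eq (Var 0) (pairt (Var 1) (Var 2)))
          (Imp (Mem (pairt (Var 1) (Var 9)) 1) (Mem (pairt (Var 9) (Var 2)) 0))))"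
        "\<lambda>X. if X = 0 then {w. \<exists>x. w = pr x (f x)} else {w. \<exists>x. w = pr x (g x)}"])
    (use assms in \<open>auto simp: rec_def recf_def\<close>, metis p_pr(1))

lemma recf_pr:
  assumes "recf f" "recf g"
  shows "recf (\<lambda>z. pr (f z) (g z))"
  unfolding recf_def
  by (rule rec_bounded[of "bEx 1 (Add (Var 0) One) (bEx 2 (Add (Var 0) One)
        (Conj (Eq (Var 0) (pairt (Var 1) (Var 2))) (bEx 3 (Add (Var 0) One) (bEx 4 (Add (Var 0) One)
          (Conj (Eq (Var 2) (pairt (Var 3) (Var 4)))
            (Conj (Mem (pairt (Var 1) (Var 3)) 0) (Mem (pairt (Var 1) (Var 4)) 1)))))))"
        "\<lambda>X. if X = 0 then {w. \<exists>x. w = pr x (f x)} else {w. \<exists>x. w = pr x (g x)}"])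
    (use assms in \<open>auto simp: rec_def recf_def\<close>)

lemma recf_id: "recf (\<lambda>z. z)"
proof -
  obtain A :: "'a mnum set" where "A \<in> SS"
    using SS_nonempty by blast
  then show ?thesis
    unfolding recf_def
    by (intro rec_bounded[of "bEx 1 (Add (Var 0) One) (Eq (Var 0) (pairt (Var 1) (Var 1)))" "\<lambda>_. A"]) auto
qed

lemma recf_const: "recf (\<lambda>z. c)"
proof -
  obtain A :: "'a mnum set" where "A \<in> SS"
    using SS_nonempty by blast
  then show ?thesis
    unfolding recf_def
    by (intro rec_bounded[of "bEx 1 (Add (Var 0) One) (Eq (Var 0) (pairt (Var 1) (Var 2)))" "\<lambda>_. A"
          "(\<lambda>_. c)"]) auto
qed

lemma rec_ispair: "rec (\<lambda>z. \<exists>x y. z = pr x y)"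
proof -
  obtain A :: "'a mnum set" where "A \<in> SS"
    using SS_nonempty by blast
  then show ?thesis
    by (intro rec_bounded[of "bEx 1 (Add (Var 0) One) (bEx 2 (Add (Var 0) One)
      (Eq (Var 0) (pairt (Var 1) (Var 2))))" "\<lambda>_. A"]) auto
qed

text \<open>Variables 3 and 4 stand for the two projections. On a number that is no pair both are 0,
  so the formula must be able to say that its argument is no pair; the set of pairs is supplied as a
  set parameter for this purpose.\<close>

lemma recf_tm:
  assumes "tvars t \<subseteq> {3, 4}" "\<And>z. f z = tval num_model ((\<lambda>_. 0)(3 := p1 z, 4 := p2 z)) t"
  shows "recf f"
proof -
  have t: "tval num_model e t = tval num_model ((\<lambda>_. 0)(3 := e 3, 4 := e 4)) t" for e
    using assms(1) by (induction t) auto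
  have f: "y = f x \<longleftrightarrow> (\<exists>u\<le>x. \<exists>v\<le>x. y = tval num_model ((\<lambda>_. 0)(3 := u, 4 := v)) t \<and>
      (x = pr u v \<or> u = 0 \<and> v = 0 \<and> (\<nexists>u v. x = pr u v)))" for x y
    by (cases x rule: pair_cases) (auto simp: assms(2) pr_ge)
  let ?p = "bEx 1 (Add (Var 0) One) (bEx 2 (Add (Var 0) One)
        (Conj (Eq (Var 0) (pairt (Var 1) (Var 2))) (bEx 3 (Add (Var 1) One) (bEx 4 (Add (Var 1) One)
          (Conj (Eq (Var 2) t) (Disj (Eq (Var 1) (pairt (Var 3) (Var 4)))
            (Conj (Eq (Var 3) Zero) (Conj (Eq (Var 4) Zero) (Neg (Mem (Var 1) 0))))))))))"
  let ?E = "\<lambda>_ :: nat. {z. \<exists>x y. z = pr x y}"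
  have eq: "sat num_model e ?E (Eq s t) \<longleftrightarrow>
    tval num_model e s = tval num_model ((\<lambda>_. 0)(3 := e 3, 4 := e 4)) t" for e s
    using t[of e] by simp
  have 1: "sat num_model (e(0 := n, 9 := a)) ?E ?p \<longleftrightarrow> (\<exists>x\<le>n. \<exists>y\<le>n. n = pr x y \<and> y = f x)" for n a e
    unfolding f sat.simps(5,6,10) eq by (simp flip: less_eq_iff_succ_less)
  have 2: "(\<exists>x\<le>n. \<exists>y\<le>n. n = pr x y \<and> y = f x) \<longleftrightarrow> (\<exists>x. n = pr x (f x))" for n
    by (auto simp: pr_ge)
  have sat: "sat num_model (e(0 := n, 9 := a)) ?E ?p \<longleftrightarrow> (\<exists>x. n = pr x (f x))" for n a e
    by (simp only: 1 2)
  show ?thesis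
    unfolding recf_def
  proof (rule rec_bounded)
    show "bounded_fm ?p"
      by simp
    show "?E X \<in> SS" for X
      using rec_ispair by (simp add: rec_def)
  qed (rule sat)
qed

lemma recf_p1: "recf p1"
  by (rule recf_tm[of "Var 3"]) auto
lemma recf_p2: "recf p2"
  by (rule recf_tm[of "Var 4"]) auto

lemma recf_add: "recf f \<Longrightarrow> recf g \<Longrightarrow> recf (\<lambda>z. f z + g z)"
  using recf_comp[OF recf_tm[of "Add (Var 3) (Var 4)"] recf_pr, of "\<lambda>z. p1 z + p2 z" f g] by simp
lemma recf_mult: "recf f \<Longrightarrow> recf g \<Longrightarrow> recf (\<lambda>z. f z * g z)"
  using recf_comp[OF recf_tm[of "Mul (Var 3) (Var 4)"] recf_pr, of "\<lambda>z. p1 z * p2 z" f g] by simp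

lemma ex_pair: "(\<exists>x<z + 1. \<exists>y<z + 1. z = pr x y \<and> P x y) \<longleftrightarrow> (\<exists>x y. z = pr x y) \<and> P (p1 z) (p2 z)"
  by (cases z rule: pair_cases) auto

lemma rec_less:
  assumes "recf f" "recf g"
  shows "rec (\<lambda>z. f z < g z)"
proof -
  obtain A :: "'a mnum set" where A: "A \<in> SS"
    using SS_nonempty by blast
  have "(\<exists>x y. z = pr x y) \<and> p1 z < p2 z \<longleftrightarrow> p1 z < p2 z" for z :: "'a mnum"
    by (cases z rule: pair_cases) auto
  then have "rec (\<lambda>z :: 'a mnum. p1 z < p2 z)"
    using A ex_pair[of _ "(<)"] by (intro rec_bounded[of "bEx 1 (Add (Var 0) One) (bEx 2 (Add (Var 0) One)
        (Conj (Eq (Var 0) (pairt (Var 1) (Var 2))) (Less (Var 1) (Var 2))))" "\<lambda>_. A"]) auto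
  then show ?thesis
    using rec_comp[OF _ recf_pr[OF assms], of "\<lambda>z. p1 z < p2 z"] by simp
qed

lemma rec_le: "recf f \<Longrightarrow> recf g \<Longrightarrow> rec (\<lambda>z. f z \<le> g z)"
  using rec_not[OF rec_less, of g f] by (simp add: not_less)

lemma rec_eq: "recf f \<Longrightarrow> recf g \<Longrightarrow> rec (\<lambda>z. f z = g z)"
  using rec_conj[OF rec_le rec_le, of f g g f] by (simp add: order_eq_iff)

lemma rec_mem: "A \<in> SS \<Longrightarrow> recf f \<Longrightarrow> rec (\<lambda>z. f z \<in> A)"
  by (rule rec_comp) (simp_all add: rec_def)

lemma rec_ball_less:
  assumes P: "rec (\<lambda>w. P (p1 w) (p2 w))" and t: "recf t"
  shows "rec (\<lambda>z. \<forall>y<t z. P y z)"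
proof -
  \<comment> \<open>On numbers that are no pairs the default \<open>p1 z = 0\<close> makes the
    bounded quantifier empty, so both sides hold.\<close>
  have eq: "\<not> ((\<exists>x y. z = pr x y) \<and> (\<exists>y<p1 z. \<not> P y (p2 z))) \<longleftrightarrow> (\<forall>y<p1 z. P y (p2 z))" for z :: "'a mnum"
    by (cases z rule: pair_cases) (auto simp: mnum_neq_zero)
  have "rec (\<lambda>z. \<forall>y<p1 z. P y (p2 z))"
    unfolding eq[symmetric] ex_pair[symmetric]
    using P by (intro rec_bounded[of "Neg (bEx 1 (Add (Var 0) One) (bEx 2 (Add (Var 0) One)
        (Conj (Eq (Var 0) (pairt (Var 1) (Var 2))) (bEx 3 (Var 1) (Neg (Mem (pairt (Var 3) (Var 2)) 0))))))"
          "\<lambda>_. {w. P (p1 w) (p2 w)}"]) (auto simp: rec_def)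
  then show ?thesis
    using rec_comp[OF _ recf_pr[OF t recf_id], of "\<lambda>z. \<forall>y<p1 z. P y (p2 z)"] by simp
qed

lemma rec_bex_less:
  assumes P: "rec (\<lambda>w. P (p1 w) (p2 w))" and t: "recf t"
  shows "rec (\<lambda>z. \<exists>y<t z. P y z)"
  using rec_not[OF rec_ball_less[OF rec_not[OF P] t]] by simp

lemma rec_ball_le:
  assumes P: "rec (\<lambda>w. P (p1 w) (p2 w))" and t: "recf t"
  shows "rec (\<lambda>z. \<forall>y\<le>t z. P y z)"
  using rec_ball_less[OF P recf_add[OF t recf_const[of 1]]] by (simp add: less_eq_iff_succ_less)

lemma rec_bex_le:
  assumes P: "rec (\<lambda>w. P (p1 w) (p2 w))" and t: "recf t"
  shows "rec (\<lambda>z. \<exists>y\<le>t z. P y z)"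
  using rec_bex_less[OF P recf_add[OF t recf_const[of 1]]] by (simp add: less_eq_iff_succ_less)

text \<open>Delta01 comprehension without formulas: an unbounded search remains recursive if its
  outcome also has a universal description.\<close>

lemma rec_delta_ex:
  assumes P: "rec (\<lambda>w. P (p1 w) (p2 w))" and Q: "rec (\<lambda>w. Q (p1 w) (p2 w))"
    and eq: "\<And>z. (\<exists>y. P y z) \<longleftrightarrow> (\<forall>y. Q y z)"
  shows "rec (\<lambda>z. \<exists>y. P y z)"
  by (rule rec_delta[of "Mem (pairt (Var 9) (Var 0)) 0" "Mem (pairt (Var 9) (Var 0)) 1"
        "\<lambda>X. if X = 0 then {w. P (p1 w) (p2 w)} else {w. Q (p1 w) (p2 w)}"])
    (use P Q eq in \<open>auto simp: rec_def\<close>)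

text \<open>Sigma01 induction without formulas; the witness may change from each number to the
  next.\<close>

lemma rec_induct_ex:
  assumes P: "rec (\<lambda>w. P (p1 w) (p2 w))" and "\<exists>y. P y 0"
    and "\<And>n y. P y n \<Longrightarrow> \<exists>y. P y (n + 1)"
  shows "\<exists>y. P y n"
proof -
  have "sat num_model ((\<lambda>_. 0)(0 := n)) (\<lambda>_. {w. P (p1 w) (p2 w)}) (ExN 9 (Mem (pairt (Var 9) (Var 0)) 0))"
    by (rule num.Sigma_induct)
      (use assms in \<open>auto simp: Sigma01_def rec_def assignment_num_model\<close>)
  then show ?thesis
    by simp
qed

lemma rec_induct:
  assumes "rec P" "P 0" and "\<And>n. P n \<Longrightarrow> P (n + 1)"
  shows "P n"
  using rec_induct_ex[OF rec_comp[OF assms(1) recf_p2]] assms(2,3) by blast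

lemma recfI:
  assumes "rec (\<lambda>w. R (p1 w) (p2 w))" and "\<And>x y. R x y \<longleftrightarrow> y = f x"
  shows "recf f"
proof -
  have "(\<exists>x. w = pr x (f x)) \<longleftrightarrow> w = pr (p1 w) (p2 w) \<and> R (p1 w) (p2 w)" for w
    by (cases w rule: pair_cases) (auto simp: assms(2))
  then show ?thesis
    unfolding recf_def by (simp add: rec_conj rec_eq recf_id recf_pr recf_p1 recf_p2 assms(1))
qed

lemma recf_p1_comp: "recf f \<Longrightarrow> recf (\<lambda>z. p1 (f z))"
  by (rule recf_comp[OF recf_p1])
lemma recf_p2_comp: "recf f \<Longrightarrow> recf (\<lambda>z. p2 (f z))"
  by (rule recf_comp[OF recf_p2])

lemma recf_if:
  assumes "rec P" "recf f" "recf g"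
  shows "recf (\<lambda>z. if P z then f z else g z)"
  by (rule recfI[of "\<lambda>x y. P x \<and> y = f x \<or> \<not> P x \<and> y = g x"])
    (auto intro!: rec_disj rec_conj rec_not rec_eq rec_comp[OF assms(1)] recf_comp[OF assms(2)]
      recf_comp[OF assms(3)] recf_p1 recf_p2)

lemma recf_diff:
  assumes "recf f" "recf g"
  shows "recf (\<lambda>z. f z - g z)"
proof (rule recfI[of "\<lambda>x y. if f x \<le> g x then y = 0 else f x = g x + y"])
  show "(if f x \<le> g x then y = 0 else f x = g x + y) \<longleftrightarrow> y = f x - g x" for x y
    by (auto simp: mnum_minus_eq_zero)
qed (auto simp: if_bool_eq_conj intro!: rec_imp rec_conj rec_not rec_eq rec_le recf_add recf_const
      recf_comp[OF assms(1)] recf_comp[OF assms(2)] recf_p1 recf_p2)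

text \<open>The order of the model may fail to be well-founded from outside, so minima exist only
  for predicates that the model knows. If there were none, induction would show that
  \<open>P\<close> is empty below every \<open>n\<close>.\<close>

lemma rec_least:
  assumes "rec P" "P a"
  obtains m where "P m" "\<And>k. k < m \<Longrightarrow> \<not> P k"
proof -
  have "\<exists>m. P m \<and> (\<forall>k<m. \<not> P k)"
  proof (rule ccontr)
    assume none: "\<not> ?thesis"
    have "\<forall>k<n. \<not> P k" for n
    proof (rule rec_induct[of "\<lambda>n. \<forall>k<n. \<not> P k"])
      show "rec (\<lambda>n. \<forall>k<n. \<not> P k)"
        by (intro rec_ball_less rec_not rec_comp[OF assms(1)] recf_p1 recf_id)
      show "\<forall>k<n + 1. \<not> P k" if "\<forall>k<n. \<not> P k" for n
        using that none by (metis less_eq_iff_succ_less order_le_less)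
    qed (simp add: mnum_neq_zero)
    then show False
      using assms(2) less_add_one by blast
  qed
  then show ?thesis
    using that by blast
qed

lemma Least_rec:
  assumes "rec P" "P a"
  shows "P (LEAST y. P y)" "\<And>k. k < (LEAST y. P y) \<Longrightarrow> \<not> P k"
proof -
  obtain m where m: "P m" "\<And>k. k < m \<Longrightarrow> \<not> P k"
    using rec_least[OF assms] by blast
  then have "(LEAST y. P y) = m"
    by (intro Least_equality) (auto simp: not_less[symmetric])
  then show "P (LEAST y. P y)" "\<And>k. k < (LEAST y. P y) \<Longrightarrow> \<not> P k"
    using m by auto
qed

lemma rec_section: "rec (\<lambda>w. P (p1 w) (p2 w)) \<Longrightarrow> rec (\<lambda>y. P y z)"
  using rec_comp[OF _ recf_pr[OF recf_id recf_const[of z]], of "\<lambda>w. P (p1 w) (p2 w)"] by simp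

lemma recf_Least:
  assumes P: "rec (\<lambda>w. P (p1 w) (p2 w))" and ex: "\<And>z. \<exists>y. P y z"
  shows "recf (\<lambda>z. LEAST y. P y z)"
proof (rule recfI[of "\<lambda>z y. P y z \<and> (\<forall>k<y. \<not> P k z)"])
  have swap: "rec (\<lambda>w. P (p1 (f w)) (p2 (f w)))" if "recf f" for f
    using rec_comp[OF P that] .
  show "rec (\<lambda>w. P (p2 w) (p1 w) \<and> (\<forall>k<p2 w. \<not> P k (p1 w)))"
    using swap[of "\<lambda>w. pr (p2 w) (p1 w)"] swap[of "\<lambda>w. pr (p1 w) (p1 (p2 w))"]
    by (intro rec_conj rec_ball_less rec_not) (simp_all add: recf_pr recf_p1 recf_p2 recf_p1_comp)
  show "P y z \<and> (\<forall>k<y. \<not> P k z) \<longleftrightarrow> y = (LEAST y. P y z)" for y z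
    using Least_rec[OF rec_section[OF P]] ex by (metis linorder_neqE)
qed

named_theorems rec_intro

lemmas [rec_intro] = rec_not rec_conj rec_disj rec_imp rec_iff rec_less rec_le rec_eq rec_mem
  rec_ball_less rec_bex_less rec_ball_le rec_bex_le recf_id recf_const recf_add recf_mult recf_diff
  recf_if recf_pr recf_p1_comp recf_p2_comp

section \<open>Coding of finite sets and primitive recursion\<close>

declare mnum_neq_zero(2,3) [simp]

lemma mnum_succ_neq_zero [simp]: "k + 1 \<noteq> 0" "0 \<noteq> k + 1" for k :: "'a mnum"
  by (simp_all add: mnum_neq_zero add_nonneg_pos)

lemma mnum_dvd_le: "a dvd b \<Longrightarrow> 0 < b \<Longrightarrow> a \<le> b" for a b :: "'a mnum"
proof (elim dvdE)
  fix k assume b: "0 < b" "b = a * k"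
  then show "a \<le> b"
    by (cases k rule: mnum_zero_or_succ) (auto simp: distrib_left)
qed

lemma rec_dvd [rec_intro]:
  assumes "recf f" "recf g"
  shows "rec (\<lambda>z. f z dvd g z)"
proof -
  have "a dvd b \<longleftrightarrow> (\<exists>k\<le>b. b = a * k)" for a b :: "'a mnum"
  proof (cases "b = 0")
    case False
    then show ?thesis
      using mnum_dvd_le[of _ b] by (auto simp: mnum_neq_zero dvd_def) (metis dvd_def mult.commute)
  qed auto
  then show ?thesis
    by (simp only:) (intro rec_intro recf_comp[OF assms(1)] recf_comp[OF assms(2)] assms)
qed

text \<open>Coprimality of two moduli without greatest common divisors. The divisor also divides
  \<open>c * (k * d)\<close>, where \<open>k\<close> is the distance of \<open>x\<close> and
  \<open>y\<close>, and \<open>k\<close> divides \<open>d\<close>. Modulo the divisor,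
  \<open>(y + 1) * d\<close> is -1, so its square is 1 and can be cancelled.\<close>

lemma dvd_cancel_modulus:
  fixes c d x y :: "'a mnum"
  assumes dvd: "1 + (y + 1) * d dvd c * (1 + (x + 1) * d)" and neq: "x \<noteq> y" and "0 < d"
    and d: "\<And>k. 0 < k \<Longrightarrow> k \<le> x + y \<Longrightarrow> k dvd d"
  shows "1 + (y + 1) * d dvd c"
proof -
  let ?v = "1 + (y + 1) * d"
  obtain k where k: "0 < k" "k \<le> x + y" "?v dvd c * (k * d)"
  proof (cases "y < x")
    case True
    then obtain k where x: "x = y + k" "0 < k"
      by (metis add.right_neutral less_le mnum_le_iff mnum_neq_zero(1))
    have "c * (1 + (x + 1) * d) = c * ?v + c * (k * d)"
      unfolding x by (simp add: algebra_simps)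
    with dvd have "?v dvd c * (k * d)"
      by (simp only: dvd_add_right_iff[OF dvd_triv_right])
    then show ?thesis
      using x that by (simp add: add.commute add_increasing)
  next
    case False
    then obtain k where y: "y = x + k" "0 < k"
      using neq by (metis add.right_neutral less_le mnum_le_iff mnum_neq_zero(1) not_less)
    have "c * ?v = c * (1 + (x + 1) * d) + c * (k * d)"
      unfolding y by (simp add: algebra_simps)
    moreover have "?v dvd c * ?v"
      by simp
    ultimately have "?v dvd c * (k * d)"
      using dvd by (metis dvd_add_right_iff)
    then show ?thesis
      using y that by (simp add: add_increasing)
  qed
  obtain e where e: "d = k * e"
    using d k by blast
  obtain w where w: "(y + 1) * d = w + 1"
    using assms(3) by (cases "(y + 1) * d" rule: mnum_zero_or_succ) (auto simp: mnum_neq_zero add_pos_pos)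
  \<comment> \<open>Because of \<open>d = k * e\<close>, this factor completes \<open>k * d\<close>
    to the square of \<open>(y + 1) * d\<close>. With \<open>w + 1\<close> for this product the
    divisor is \<open>w + 2\<close>, and the square is \<open>w * (w + 2) + 1\<close>.\<close>
  have "?v dvd c * (k * d) * (e * (y + 1) * (y + 1))"
    using k(3) by simp
  also have "c * (k * d) * (e * (y + 1) * (y + 1)) = c * ((k * e) * d * (y + 1) * (y + 1))"
    by (simp add: ac_simps)
  also have "\<dots> = c * (((y + 1) * d) * ((y + 1) * d))"
    unfolding e[symmetric] by (simp add: ac_simps)
  also have "\<dots> = c * w * ?v + c"
    unfolding w by (simp add: algebra_simps)
  finally show ?thesis
    by (simp only: dvd_add_right_iff[OF dvd_triv_right])
qed

text \<open>A code has the form \<open>pr (pr c d) B\<close>, with \<open>B\<close> a bound for the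
  members. The moduli \<open>1 + (x + 1) * d\<close> are those of Goedel's beta function, but
  membership is recorded as divisibility of the one number \<open>c\<close>.\<close>

definition mem :: "'a mnum \<Rightarrow> 'a mnum \<Rightarrow> bool" where
  "mem x s \<longleftrightarrow> x < p2 s \<and> 1 + (x + 1) * p2 (p1 s) dvd p1 (p1 s)"

lemma rec_mem_code [rec_intro]: "recf f \<Longrightarrow> recf g \<Longrightarrow> rec (\<lambda>z. mem (f z) (g z))"
  unfolding mem_def by (intro rec_intro)

lemma mem_less: "mem x s \<Longrightarrow> x < s"
  unfolding mem_def using p_le(2) less_le_trans by blast

text \<open>Stands in for the factorial, which is not at hand before primitive recursion; its mere
  existence is a Sigma01 statement.\<close>

lemma common_multiple: "\<exists>d > 0. \<forall>k\<le>n. 0 < k \<longrightarrow> k dvd d" for n :: "'a mnum"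
proof (rule rec_induct_ex[of "\<lambda>d n. 0 < d \<and> (\<forall>k\<le>n. 0 < k \<longrightarrow> k dvd d)"])
  show "rec (\<lambda>w :: 'a mnum. 0 < p1 w \<and> (\<forall>k\<le>p2 w. 0 < k \<longrightarrow> k dvd p1 w))"
    by (intro rec_intro)
  show "\<exists>d :: 'a mnum. 0 < d \<and> (\<forall>k\<le>0. 0 < k \<longrightarrow> k dvd d)"
    by (intro exI[of _ 1]) (auto simp: mnum_neq_zero)
  fix n d :: "'a mnum"
  assume "0 < d \<and> (\<forall>k\<le>n. 0 < k \<longrightarrow> k dvd d)"
  moreover have "k \<le> n \<or> k = n + 1" if "k \<le> n + 1" for k
    using that by (metis less_eq_iff_succ_less order_le_less)
  ultimately show "\<exists>d. 0 < d \<and> (\<forall>k\<le>n + 1. 0 < k \<longrightarrow> k dvd d)"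
    by (intro exI[of _ "d * (n + 1)"]) (auto simp: add_nonneg_pos, metis dvd_mult2 dvd_triv_right)
qed

text \<open>The number \<open>c\<close> is built as the product of the moduli of all members below
  \<open>n\<close>, by Sigma01 induction on \<open>n\<close>.\<close>

lemma code_exists:
  assumes S: "rec S" and B: "\<And>x. S x \<Longrightarrow> x < B"
  shows "\<exists>s. \<forall>x. mem x s \<longleftrightarrow> S x"
proof -
  \<comment> \<open>For \<open>x\<close> and \<open>y\<close> below \<open>B\<close>, the distances
    that have to divide \<open>d\<close> are bounded by \<open>x + y\<close>, hence by
    \<open>B + B\<close>.\<close>
  obtain d where d: "0 < d" "\<And>k. 0 < k \<Longrightarrow> k \<le> B + B \<Longrightarrow> k dvd d"
    using common_multiple[of "B + B"] by blast
  define P where "P c n \<longleftrightarrow> 0 < c \<and> (\<forall>x<B. 1 + (x + 1) * d dvd c \<longleftrightarrow> S x \<and> x < n)" for c n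
  have "\<exists>c. P c n" for n
  proof (rule rec_induct_ex[where n = n])
    show "rec (\<lambda>w. P (p1 w) (p2 w))"
      unfolding P_def by (intro rec_intro rec_comp[OF S])
    have "\<not> 1 + (x + 1) * d dvd 1" for x
      using mnum_dvd_le[of "1 + (x + 1) * d" 1] d(1)
      by (auto simp: not_le add_nonneg_pos)
    then show "\<exists>c. P c 0"
      unfolding P_def by (intro exI[of _ 1]) (auto simp: mnum_neq_zero)
    fix n c
    assume c: "P c n"
    show "\<exists>c. P c (n + 1)"
    proof (cases "S n")
      case True
      have "P (c * (1 + (n + 1) * d)) (n + 1)"
        unfolding P_def
      proof (intro conjI allI impI)
        show "0 < c * (1 + (n + 1) * d)"
          using c unfolding P_def by (simp add: add_pos_nonneg)
        fix x assume x: "x < B"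
        have "1 + (x + 1) * d dvd c * (1 + (n + 1) * d) \<longleftrightarrow> 1 + (x + 1) * d dvd c" if "x \<noteq> n"
        proof
          assume "1 + (x + 1) * d dvd c * (1 + (n + 1) * d)"
          then show "1 + (x + 1) * d dvd c"
            using that d B[OF True] x
            by (elim dvd_cancel_modulus) (auto intro!: d(2) elim: order_trans[OF _ add_mono])
        qed auto
        then show "1 + (x + 1) * d dvd c * (1 + (n + 1) * d) \<longleftrightarrow> S x \<and> x < n + 1"
          using c x True unfolding P_def
          by (cases "x = n") (auto simp flip: less_eq_iff_succ_less simp: order_le_less)
      qed
      then show ?thesis
        by blast
    next
      case False
      then have "P c (n + 1)"
        using c unfolding P_def by (auto simp flip: less_eq_iff_succ_less simp: order_le_less)
      then show ?thesis
        by blast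
    qed
  qed
  then obtain c where "P c B"
    by blast
  then have "mem x (pr (pr c d) B) \<longleftrightarrow> S x" for x
    using B unfolding P_def mem_def by auto
  then show ?thesis
    by blast
qed

section \<open>Primitive recursion by coded histories\<close>

abbreviation recf2 :: "('a mnum \<Rightarrow> 'a mnum \<Rightarrow> 'a mnum) \<Rightarrow> bool" where
  "recf2 f \<equiv> recf (\<lambda>w. f (p1 w) (p2 w))"

abbreviation recf3 :: "('a mnum \<Rightarrow> 'a mnum \<Rightarrow> 'a mnum \<Rightarrow> 'a mnum) \<Rightarrow> bool" where
  "recf3 f \<equiv> recf (\<lambda>w. f (p1 w) (p1 (p2 w)) (p2 (p2 w)))"

lemma recf2_comp: "recf2 f \<Longrightarrow> recf g \<Longrightarrow> recf h \<Longrightarrow> recf (\<lambda>z. f (g z) (h z))"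
  using recf_comp[OF _ recf_pr, of "\<lambda>w. f (p1 w) (p2 w)" g h] by simp

lemma recf3_comp: "recf3 f \<Longrightarrow> recf g \<Longrightarrow> recf h \<Longrightarrow> recf k \<Longrightarrow> recf (\<lambda>z. f (g z) (h z) (k z))"
  using recf_comp[OF _ recf_pr[OF _ recf_pr], of "\<lambda>w. f (p1 w) (p1 (p2 w)) (p2 (p2 w))" g h k] by simp

text \<open>\<open>s\<close> codes a finite set of pairs \<open>(k, H p k)\<close> that is closed under predecessors.\<close>

definition history :: "('a mnum \<Rightarrow> 'a mnum) \<Rightarrow> ('a mnum \<Rightarrow> 'a mnum \<Rightarrow> 'a mnum \<Rightarrow> 'a mnum) \<Rightarrow>
    'a mnum \<Rightarrow> 'a mnum \<Rightarrow> bool" where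
  "history a h p s \<longleftrightarrow> (\<forall>x\<le>s. mem x s \<longrightarrow>
     x = pr 0 (a p) \<or> (\<exists>k\<le>s. \<exists>u\<le>s. x = pr (k + 1) (h p k u) \<and> mem (pr k u) s))"

text \<open>Members of a code are smaller than the code. Hence the bounds in the definition, which
  keep \<open>history\<close> recursive, lose nothing.\<close>

lemma history_iff:
  "history a h p s \<longleftrightarrow> (\<forall>x. mem x s \<longrightarrow>
     x = pr 0 (a p) \<or> (\<exists>k u. x = pr (k + 1) (h p k u) \<and> mem (pr k u) s))"
proof -
  have "k \<le> s \<and> u \<le> s" if "mem (pr k u) s" for k u
    using mem_less[OF that] pr_ge[of k u] pr_ge(2)[of u k] by (meson less_imp_le order_trans)
  moreover have "x \<le> s" if "mem x s" for x
    using mem_less[OF that] by simp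
  ultimately show ?thesis
    unfolding history_def by meson
qed

lemma history_zero: "history a h p s \<Longrightarrow> mem (pr 0 v) s \<Longrightarrow> v = a p"
  unfolding history_iff by fastforce

lemma history_succ: "history a h p s \<Longrightarrow> mem (pr (k + 1) v) s \<Longrightarrow> \<exists>u. v = h p k u \<and> mem (pr k u) s"
  unfolding history_iff by fastforce

lemma history_unique:
  assumes "history a h p s" "history a h p s'" "mem (pr n v) s" "mem (pr n v') s'"
  shows "v = v'"
proof -
  have bound: "u \<le> s" if "mem (pr k u) s" for k u s :: "'a mnum"
    using mem_less[OF that] pr_ge(2)[of u k] by (meson less_imp_le order_trans)
  have "\<forall>u\<le>s. \<forall>u'\<le>s'. mem (pr n u) s \<longrightarrow> mem (pr n u') s' \<longrightarrow> u = u'"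
  proof (rule rec_induct[where n = n])
    show "rec (\<lambda>n. \<forall>u\<le>s. \<forall>u'\<le>s'. mem (pr n u) s \<longrightarrow> mem (pr n u') s' \<longrightarrow> u = u')"
      by (intro rec_intro)
    show "\<forall>u\<le>s. \<forall>u'\<le>s'. mem (pr 0 u) s \<longrightarrow> mem (pr 0 u') s' \<longrightarrow> u = u'"
      using history_zero assms by metis
    show "\<forall>u\<le>s. \<forall>u'\<le>s'. mem (pr (n + 1) u) s \<longrightarrow> mem (pr (n + 1) u') s' \<longrightarrow> u = u'"
      if "\<forall>u\<le>s. \<forall>u'\<le>s'. mem (pr n u) s \<longrightarrow> mem (pr n u') s' \<longrightarrow> u = u'" for n
      using history_succ[OF assms(1)] history_succ[OF assms(2)] bound that by metis
  qed
  then show ?thesis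
    using assms bound by blast
qed

text \<open>Some history reaches \<open>n\<close> by Sigma01 induction, and all histories agree, so
  a search for one defines a recursive function. The parameter \<open>p\<close> makes the result
  uniform; solutions found separately for each \<open>p\<close> would not be known to be jointly
  recursive.\<close>

theorem primitive_recursion:
  assumes a: "recf a" and h: "recf3 h"
  obtains H where "recf2 H" "\<And>p. H p 0 = a p" "\<And>p n. H p (n + 1) = h p n (H p n)"
proof -
  define P where "P y p n \<longleftrightarrow> history a h p (p1 y) \<and> mem (pr n (p2 y)) (p1 y)" for y p n
  have P_rec: "rec (\<lambda>z. P (f z) (g z) (k z))" if "recf f" "recf g" "recf k" for f g k
    unfolding P_def history_def
    by (intro rec_intro recf_comp[OF a] recf3_comp[OF h] that recf_comp[OF that(1)] recf_comp[OF that(2)])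
  have ex: "\<exists>y. P y p n" for p n
  proof (rule rec_induct_ex[where n = n])
    show "rec (\<lambda>w. P (p1 w) p (p2 w))"
      by (intro P_rec rec_intro)
    have "rec (\<lambda>x. x = pr 0 (a p))"
      by (intro rec_intro)
    then obtain s where "\<forall>x. mem x s \<longleftrightarrow> x = pr 0 (a p)"
      using code_exists[of "\<lambda>x. x = pr 0 (a p)" "pr 0 (a p) + 1"] by auto
    then have "P (pr s (a p)) p 0"
      unfolding P_def history_iff by simp
    then show "\<exists>y. P y p 0"
      by blast
    fix n y
    assume y: "P y p n"
    define x where "x = pr (n + 1) (h p n (p2 y))"
    have "rec (\<lambda>z. mem z (p1 y) \<or> z = x)"
      by (intro rec_intro)
    moreover have "z < p1 y + x + 1" if "mem z (p1 y) \<or> z = x" for z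
      using that mem_less[of z "p1 y"] by (auto simp flip: less_eq_iff_succ_less intro: add_increasing add_increasing2)
    ultimately obtain s where s: "\<forall>z. mem z s \<longleftrightarrow> mem z (p1 y) \<or> z = x"
      using code_exists by blast
    then have "P (pr s (h p n (p2 y))) p (n + 1)"
      using y unfolding P_def history_iff x_def by (auto 0 4)
    then show "\<exists>y. P y p (n + 1)"
      by blast
  qed
  define H where "H p n = p2 (LEAST y. P y p n)" for p n
  have "recf (\<lambda>w. LEAST y. P y (p1 w) (p2 w))"
    by (rule recf_Least) (intro P_rec rec_intro ex)+
  then have "recf2 H"
    unfolding H_def by (intro recf_p2_comp)
  have H: "\<exists>s. history a h p s \<and> mem (pr n (H p n)) s" for p n
  proof -
    have "rec (\<lambda>y. P y p n)"
      by (intro P_rec rec_intro)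
    then have "P (LEAST y. P y p n) p n"
      using Least_rec(1) ex by blast
    then show ?thesis
      unfolding P_def H_def by blast
  qed
  moreover have "H p 0 = a p" for p
    using H history_zero by blast
  moreover have "H p (n + 1) = h p n (H p n)" for p n
  proof -
    obtain s s' where s: "history a h p s" "mem (pr (n + 1) (H p (n + 1))) s"
      "history a h p s'" "mem (pr n (H p n)) s'"
      using H by blast
    obtain u where u: "H p (n + 1) = h p n u" "mem (pr n u) s"
      using history_succ[OF s(1,2)] by blast
    have "u = H p n"
      by (rule history_unique[OF s(1,3) u(2) s(4)])
    then show ?thesis
      using u by simp
  qed
  ultimately show ?thesis
    using that \<open>recf2 H\<close> by blast
qed

section \<open>Binary representations\<close>

lemma recursion:
  assumes "recf2 h"
  obtains H where "recf H" "H 0 = a" "\<And>n. H (n + 1) = h n (H n)"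
proof -
  obtain H where H: "recf2 H" "\<And>p. H p 0 = a" "\<And>p n. H p (n + 1) = h n (H p n)"
    using primitive_recursion[of "\<lambda>_. a" "\<lambda>_. h"] recf_const[of a] recf_comp[OF assms recf_p2]
    by blast
  have "recf (H 0)"
    using recf2_comp[OF H(1) recf_const[of 0] recf_id] .
  then show ?thesis
    using that H by blast
qed

section \<open>Powers of two\<close>

definition pw :: "'a mnum \<Rightarrow> 'a mnum" where
  "pw = (SOME f. recf f \<and> f 0 = 1 \<and> (\<forall>n. f (n + 1) = 2 * f n))"

lemma pw_spec:
  "recf (pw :: 'a mnum \<Rightarrow> _) \<and> pw (0 :: 'a mnum) = 1 \<and> (\<forall>n :: 'a mnum. pw (n + 1) = 2 * pw n)"
proof -
  have "recf2 (\<lambda>n v :: 'a mnum. 2 * v)"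
    by (intro rec_intro)
  then have "\<exists>f :: 'a mnum \<Rightarrow> _. recf f \<and> f 0 = 1 \<and> (\<forall>n. f (n + 1) = 2 * f n)"
    by (elim recursion[where a = 1]) blast
  from someI_ex[OF this] show ?thesis
    unfolding pw_def .
qed

lemma pw_0 [simp]: "pw 0 = 1" and pw_Suc: "pw (n + 1) = 2 * pw n"
  using pw_spec by blast+

lemma pw_1 [simp]: "pw 1 = 2"
  using pw_Suc[of 0] by simp

lemma recf_pw [rec_intro]: "recf f \<Longrightarrow> recf (\<lambda>z. pw (f z))"
  by (rule recf_comp[OF pw_spec[THEN conjunct1]])

lemma pw_pos [simp]: "0 < pw n"
  by (rule rec_induct[where n = n]) (auto intro!: rec_intro simp: pw_Suc)

lemma pw_neq_0 [simp]: "pw n \<noteq> 0"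
  by (metis pw_pos less_irrefl)

lemma pw_add: "pw (m + n) = pw m * pw n"
  by (rule rec_induct[where n = n]) (auto intro!: rec_intro simp: pw_Suc add.assoc[symmetric] mult.left_commute)

lemma one_le_pw: "1 \<le> pw n"
  using pw_pos[of n] less_iff_succ_less_eq[of 0 "pw n"] by simp

lemma pw_mono: "m \<le> n \<Longrightarrow> pw m \<le> pw n"
  using mult_left_mono[OF one_le_pw, of "pw m"] by (auto simp: mnum_le_iff[of m n] pw_add)

lemma pw_strict_mono: "m < n \<Longrightarrow> pw m < pw n"
proof -
  assume "m < n"
  then have "2 * pw m \<le> pw n"
    using pw_mono[of "m + 1" n] by (simp add: pw_Suc less_iff_succ_less_eq)
  then show "pw m < pw n"
    using pw_pos[of m] unfolding emb_arith by linarith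
qed

lemma pw_less_iff [simp]: "pw m < pw n \<longleftrightarrow> m < n"
  by (metis pw_strict_mono pw_mono not_less)

lemma pw_le_iff [simp]: "pw m \<le> pw n \<longleftrightarrow> m \<le> n"
  by (metis pw_strict_mono pw_mono not_less)

lemma less_pw: "n < pw n"
proof (rule rec_induct[where n = n])
  show "n + 1 < pw (n + 1)" if "n < pw n" for n :: "'a mnum"
    using that one_le_pw[of n] unfolding pw_Suc less_iff_succ_less_eq emb_arith by linarith
qed (auto intro!: rec_intro)

lemma pw_dvd: "m \<le> n \<Longrightarrow> pw m dvd pw n"
  by (auto simp: mnum_le_iff pw_add)

section \<open>Division with remainder\<close>

definition qt :: "'a mnum \<Rightarrow> 'a mnum \<Rightarrow> 'a mnum" where
  "qt a b = (LEAST q. a < (q + 1) * b \<or> b = 0)"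

definition rm :: "'a mnum \<Rightarrow> 'a mnum \<Rightarrow> 'a mnum" where
  "rm a b = a - qt a b * b"

text \<open>The disjunct \<open>b = 0\<close> makes the search total, so that \<open>qt\<close> is
  recursive without a side condition.\<close>

lemma qt_ex: "\<exists>q. a < (q + 1) * b \<or> b = 0" for a b :: "'a mnum"
proof (cases b rule: mnum_zero_or_succ)
  case (2 c)
  then have "a < (a + 1) * b"
    using mult_left_mono[of 1 b "a + 1"] by (simp add: less_iff_succ_less_eq)
  then show ?thesis
    by blast
qed auto

lemma recf_qt [rec_intro]:
  assumes "recf f" "recf g"
  shows "recf (\<lambda>z. qt (f z) (g z))"
proof -
  have "recf2 (\<lambda>a b. qt a b)"
    unfolding qt_def by (rule recf_Least) (intro rec_intro qt_ex)+
  then show ?thesis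
    using assms by (rule recf2_comp)
qed

lemma recf_rm [rec_intro]: "recf f \<Longrightarrow> recf g \<Longrightarrow> recf (\<lambda>z. rm (f z) (g z))"
  unfolding rm_def by (intro rec_intro)

lemma qt_rm:
  assumes "0 < b"
  shows "a = qt a b * b + rm a b" "rm a b < b"
proof -
  have "rec (\<lambda>q. a < (q + 1) * b \<or> b = 0)"
    by (intro rec_intro)
  then have q: "a < (qt a b + 1) * b \<or> b = 0" "\<And>k. k < qt a b \<Longrightarrow> \<not> (a < (k + 1) * b \<or> b = 0)"
    unfolding qt_def using Least_rec qt_ex by blast+
  have le: "qt a b * b \<le> a"
  proof (cases "qt a b" rule: mnum_zero_or_succ)
    case (2 k)
    then show ?thesis
      using q(2)[of k] by (simp add: not_less)
  qed simp
  then show a: "a = qt a b * b + rm a b"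
    unfolding rm_def by simp
  have "a < qt a b * b + b"
    using q(1) assms by (auto simp: distrib_right)
  then show "rm a b < b"
    using a by (metis add_less_cancel_left)
qed

lemma qt_rm_unique:
  assumes "a = q * b + r" "r < b"
  shows "qt a b = q" "rm a b = r"
proof -
  have b: "0 < b"
    using assms(2) by (metis mnum_zero_le le_less_trans)
  have less: "False" if "q * b + r = q' * b + r'" "q < q'" "r < b" for q q' r r' :: "'a mnum"
  proof -
    have "(q + 1) * b \<le> q' * b"
      using that(2) by (intro mult_right_mono) (auto simp: less_iff_succ_less_eq)
    also have "\<dots> \<le> q' * b + r'"
      by simp
    finally have "q * b + b \<le> q * b + r"
      unfolding that(1)[symmetric] by (simp add: distrib_right)
    then show False
      using that(3) by simp
  qed
  have "q * b + r = qt a b * b + rm a b"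
    using qt_rm(1)[OF b, of a] assms by simp
  then show "qt a b = q"
    using less[of q r "qt a b" "rm a b"] less[of "qt a b" "rm a b" q r] assms(2) qt_rm(2)[OF b, of a]
    by (metis linorder_neqE)
  then show "rm a b = r"
    using \<open>q * b + r = _\<close> by simp
qed

lemma qt_small: "a < b \<Longrightarrow> qt a b = 0" "a < b \<Longrightarrow> rm a b = a"
  using qt_rm_unique[of a 0 b a] by simp_all

lemma qt_mult:
  assumes "r < b" "0 < c"
  shows "qt (k * b + r) (b * c) = qt k c"
proof (rule qt_rm_unique)
  have "k * b + r = (qt k c * c + rm k c) * b + r"
    using qt_rm(1)[OF assms(2), of k] by simp
  then show "k * b + r = qt k c * (b * c) + (rm k c * b + r)"
    by (simp add: algebra_simps)
  have "rm k c + 1 \<le> c"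
    using qt_rm(2)[OF assms(2)] by (simp add: less_iff_succ_less_eq)
  then have "(rm k c + 1) * b \<le> c * b"
    by (rule mult_right_mono) simp
  then show "rm k c * b + r < b * c"
    using assms(1) unfolding emb_arith by (simp add: algebra_simps)
qed

lemma parity:
  fixes q :: "'a mnum"
  obtains k where "q = 2 * k" | k where "q = 2 * k + 1"
proof -
  have q: "q = qt q 2 * 2 + rm q 2" "rm q 2 < 1 + 1"
    using qt_rm[of 2 q] by simp_all
  then have "rm q 2 = 0 \<or> rm q 2 = 1"
    unfolding less_eq_iff_succ_less[symmetric] by (cases "rm q 2" rule: mnum_zero_or_succ) auto
  then show ?thesis
    using q(1) that by (metis add.right_neutral mult.commute)
qed

lemma even_neq_odd: "2 * k \<noteq> 2 * l + 1" for k l :: "'a mnum"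
proof
  assume eq: "2 * k = 2 * l + 1"
  have "rm (2 * k) 2 = 0"
    by (rule qt_rm_unique(2)[of _ k]) (simp_all add: mult.commute)
  moreover have "rm (2 * l + 1) 2 = 1"
    by (rule qt_rm_unique(2)[of _ l]) (simp_all add: mult.commute)
  ultimately show False
    using eq by simp
qed

section \<open>Binary digits\<close>

definition hasbit :: "'a mnum \<Rightarrow> 'a mnum \<Rightarrow> bool" where
  "hasbit x g \<longleftrightarrow> (\<exists>k\<le>g. qt g (pw x) = 2 * k + 1)"

lemma rec_hasbit [rec_intro]:
  assumes "recf f" "recf g"
  shows "rec (\<lambda>z. hasbit (f z) (g z))"
proof -
  have "rec (\<lambda>w. hasbit (p1 w) (p2 w))"
    unfolding hasbit_def by (intro rec_intro)
  then show ?thesis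
    using rec_comp[OF _ recf_pr[OF assms], of "\<lambda>w. hasbit (p1 w) (p2 w)"] by simp
qed

text \<open>A witness for oddness is at most the quotient, hence at most \<open>g\<close>; the bound
  in the definition only secures recursiveness.\<close>

lemma hasbit_iff: "hasbit x g \<longleftrightarrow> (\<exists>k. qt g (pw x) = 2 * k + 1)"
proof -
  have "k \<le> g" if "qt g (pw x) = 2 * k + 1" for k
  proof -
    have "k \<le> qt g (pw x)"
      using emb_pos[of k] unfolding that emb_arith by linarith
    also have "\<dots> \<le> qt g (pw x) * pw x"
      using mult_left_mono[OF one_le_pw, of "qt g (pw x)"] by simp
    also have "\<dots> \<le> g"
      by (subst (2) qt_rm(1)[OF pw_pos, of g x]) simp
    finally show ?thesis .
  qed
  then show ?thesis
    unfolding hasbit_def by blast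
qed

lemma rm_pw_Suc: "rm g (pw (x + 1)) = rm g (pw x) + (if hasbit x g then pw x else 0)"
proof (cases "qt g (pw x)" rule: parity)
  case (1 k)
  then have "\<not> hasbit x g"
    unfolding hasbit_iff using even_neq_odd by metis
  moreover have "g = k * pw (x + 1) + rm g (pw x)"
    using qt_rm(1)[OF pw_pos, of g x] 1 by (simp add: pw_add ac_simps)
  moreover have "rm g (pw x) < pw (x + 1)"
    using qt_rm(2)[OF pw_pos, of g x] by (rule less_trans) simp
  ultimately show ?thesis
    using qt_rm_unique(2) by simp
next
  case (2 k)
  then have "hasbit x g"
    unfolding hasbit_iff by blast
  moreover have "g = k * pw (x + 1) + (rm g (pw x) + pw x)"
    using qt_rm(1)[OF pw_pos, of g x] 2 by (simp add: pw_add algebra_simps)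
  moreover have "rm g (pw x) + pw x < pw (x + 1)"
    using qt_rm(2)[OF pw_pos, of g x] by (simp add: pw_Suc mult_2)
  ultimately show ?thesis
    using qt_rm_unique(2) by simp
qed

lemma hasbit_high: "g < pw x \<Longrightarrow> \<not> hasbit x g"
  unfolding hasbit_iff by (simp add: qt_small)

text \<open>The quotient by \<open>pw x\<close> changes by an even number, since
  \<open>pw (x + 1)\<close> divides \<open>A\<close>.\<close>

lemma hasbit_add_low:
  assumes "pw t dvd A" "x < t"
  shows "hasbit x (A + B) \<longleftrightarrow> hasbit x B"
proof -
  obtain j where t: "t = x + 1 + j"
    using assms(2) by (auto simp: mnum_less_iff ac_simps)
  obtain k where A: "A = k * pw t"
    using assms(1) by (auto simp: ac_simps)
  have "A + B = (2 * (k * pw j) + qt B (pw x)) * pw x + rm B (pw x)"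
    by (subst qt_rm(1)[OF pw_pos, of B x]) (simp add: A t pw_add algebra_simps)
  then have q: "qt (A + B) (pw x) = 2 * (k * pw j) + qt B (pw x)"
    by (rule qt_rm_unique) (rule qt_rm(2)[OF pw_pos])
  show ?thesis
  proof (cases "qt B (pw x)" rule: parity)
    case (1 l)
    then have "qt (A + B) (pw x) = 2 * (k * pw j + l)"
      unfolding q by (simp add: distrib_left)
    then show ?thesis
      unfolding hasbit_iff using 1 even_neq_odd by metis
  next
    case (2 l)
    then have "qt (A + B) (pw x) = 2 * (k * pw j + l) + 1"
      unfolding q by (simp add: distrib_left add.assoc)
    then show ?thesis
      unfolding hasbit_iff using 2 by metis
  qed
qed

lemma hasbit_0 [simp]: "\<not> hasbit x 0"
  by (rule hasbit_high) simp

lemma hasbit_low: "pw t dvd A \<Longrightarrow> x < t \<Longrightarrow> \<not> hasbit x A"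
  using hasbit_add_low[of t A x 0] by simp

lemma hasbit_add_high:
  assumes "pw t dvd A" "B < pw t" "t \<le> x"
  shows "hasbit x (A + B) \<longleftrightarrow> hasbit x A"
proof -
  obtain j where x: "x = t + j"
    using assms(3) by (auto simp: mnum_le_iff)
  obtain k where A: "A = k * pw t"
    using assms(1) by (auto simp: ac_simps)
  show ?thesis
    unfolding hasbit_iff A x pw_add
    using qt_mult[OF assms(2), of "pw j" k] qt_mult[of 0 "pw t" "pw j" k] by simp
qed

lemma hasbit_pw: "hasbit x (pw n) \<longleftrightarrow> x = n"
proof (cases x n rule: linorder_cases)
  case less
  then show ?thesis
    using hasbit_low[of n "pw n" x] by simp
next
  case equal
  have "qt (pw n) (pw n) = 2 * 0 + 1"
    using qt_rm_unique[of "pw n" 1 "pw n" 0] by simp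
  then show ?thesis
    unfolding hasbit_iff using equal by blast
next
  case greater
  then show ?thesis
    using hasbit_high[of "pw n" x] by simp
qed

section \<open>The leading exponent\<close>

definition topbit :: "'a mnum \<Rightarrow> 'a mnum" where
  "topbit g = (LEAST n. g < pw (n + 1))"

lemma topbit_ex: "\<exists>n. g < pw (n + 1)" for g :: "'a mnum"
  using less_pw[of g] pw_strict_mono[of g "g + 1"] less_trans by (blast intro: less_add_one)

lemma recf_topbit [rec_intro]:
  assumes "recf f"
  shows "recf (\<lambda>z. topbit (f z))"
proof -
  have "recf (\<lambda>g :: 'a mnum. topbit g)"
    unfolding topbit_def by (rule recf_Least) (intro rec_intro topbit_ex)+
  then show ?thesis
    using assms by (rule recf_comp)
qed

lemma topbit_less: "g < pw (topbit g + 1)"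
proof -
  have "rec (\<lambda>n. g < pw (n + 1))"
    by (intro rec_intro)
  then show ?thesis
    unfolding topbit_def using Least_rec(1) topbit_ex by blast
qed

lemma pw_topbit_le:
  assumes "0 < g"
  shows "pw (topbit g) \<le> g"
proof (cases "topbit g" rule: mnum_zero_or_succ)
  case 1
  then show ?thesis
    using assms less_iff_succ_less_eq[of 0 g] by simp
next
  case (2 m)
  have "rec (\<lambda>n. g < pw (n + 1))"
    by (intro rec_intro)
  then show ?thesis
    using Least_rec(2)[of "\<lambda>n. g < pw (n + 1)" _ m] topbit_ex 2 unfolding topbit_def
    by (metis less_add_one not_less)
qed

lemma topbit_split:
  assumes "0 < g"
  shows "g = pw (topbit g) + (g - pw (topbit g))" "g - pw (topbit g) < pw (topbit g)"
proof -
  show "g = pw (topbit g) + (g - pw (topbit g))"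
    using pw_topbit_le[OF assms] by (simp add: add.commute)
  then show "g - pw (topbit g) < pw (topbit g)"
    using topbit_less[of g] unfolding pw_Suc by (metis add_less_cancel_left mult_2)
qed

lemma topbit_less_iff: "0 < g \<Longrightarrow> topbit g < n \<longleftrightarrow> g < pw n"
  using pw_topbit_le[of g] topbit_less[of g]
  by (metis le_less_trans less_le_trans less_iff_succ_less_eq pw_le_iff pw_less_iff)

text \<open>If \<open>g\<close> is a positive member of a Goodstein sequence, then \<open>shift (c i) g (b i) - 1\<close> is the next one.\<close>

definition shift :: "('a mnum \<Rightarrow> 'a mnum) \<Rightarrow> 'a mnum \<Rightarrow> 'a mnum \<Rightarrow> 'a mnum" where
  "shift f g = (SOME H. recf H \<and> H 0 = 0 \<and> (\<forall>n. H (n + 1) = H n + (if hasbit n g then pw (f n) else 0)))"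

context
  fixes f :: "'a mnum \<Rightarrow> 'a mnum"
  assumes f: "recf f"
begin

lemma shift_spec: "recf (shift f g) \<and> shift f g 0 = 0 \<and>
    (\<forall>n. shift f g (n + 1) = shift f g n + (if hasbit n g then pw (f n) else 0))"
proof -
  have "recf2 (\<lambda>n v. v + (if hasbit n g then pw (f n) else 0))"
    by (intro rec_intro recf_comp[OF f])
  then have "\<exists>H. recf H \<and> H 0 = 0 \<and> (\<forall>n. H (n + 1) = H n + (if hasbit n g then pw (f n) else 0))"
    by (elim recursion[where a = 0]) blast
  from someI_ex[OF this] show ?thesis
    unfolding shift_def .
qed

lemma shift_0 [simp]: "shift f g 0 = 0"
  and shift_Suc: "shift f g (n + 1) = shift f g n + (if hasbit n g then pw (f n) else 0)"
  by (rule shift_spec[THEN conjunct2, THEN conjunct1])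
    (rule shift_spec[THEN conjunct2, THEN conjunct2, rule_format])

lemma recf_shift: "recf h \<Longrightarrow> recf (\<lambda>z. shift f g (h z))"
  by (rule recf_comp[OF shift_spec[THEN conjunct1]])

text \<open>\<open>A\<close> has digits only from \<open>t\<close> on and \<open>B\<close> only
  below \<open>t\<close>, so each step of the recursion adds a power for at most one of
  them.\<close>

lemma shift_add:
  assumes "pw t dvd A" "B < pw t"
  shows "shift f (A + B) n = shift f A n + shift f B n"
proof (rule rec_induct[where n = n])
  show "rec (\<lambda>n. shift f (A + B) n = shift f A n + shift f B n)"
    by (intro rec_intro recf_shift)
  fix n
  assume IH: "shift f (A + B) n = shift f A n + shift f B n"
  show "shift f (A + B) (n + 1) = shift f A (n + 1) + shift f B (n + 1)"
  proof (cases "n < t")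
    case True
    then show ?thesis
      unfolding shift_Suc using IH hasbit_add_low[OF assms(1) True, of B] hasbit_low[OF assms(1) True]
      by (simp add: ac_simps)
  next
    case False
    then have "\<not> hasbit n B"
      using assms(2) by (intro hasbit_high) (auto elim: less_le_trans)
    then show ?thesis
      unfolding shift_Suc using IH hasbit_add_high[OF assms, of n] False
      by (simp add: ac_simps not_less)
  qed
qed simp

lemma shift_pw: "shift f (pw m) n = (if m < n then pw (f m) else 0)"
proof (rule rec_induct[where n = n])
  show "rec (\<lambda>n. shift f (pw m) n = (if m < n then pw (f m) else 0))"
    by (intro rec_intro recf_shift)
  show "shift f (pw m) (n + 1) = (if m < n + 1 then pw (f m) else 0)"
    if "shift f (pw m) n = (if m < n then pw (f m) else 0)" for n
    using that by (auto simp: shift_Suc hasbit_pw simp flip: less_eq_iff_succ_less)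
qed simp

lemma shift_ge: "0 < g \<Longrightarrow> topbit g < n \<Longrightarrow> pw (f (topbit g)) \<le> shift f g n"
  using topbit_split[of g] shift_add[of "topbit g" "pw (topbit g)" "g - pw (topbit g)" n] shift_pw[of "topbit g" n]
  by auto

text \<open>Strictness of \<open>f\<close> gives \<open>f n + 1 \<le> f (n + 1)\<close>, so the sum
  collected so far always lies below the next power, and there are no carries.\<close>

lemma shift_less:
  assumes strict: "\<And>x y. x < y \<Longrightarrow> y < b \<Longrightarrow> f x < f y" and "n < b"
  shows "shift f g (n + 1) < pw (f n + 1)"
proof -
  have step: "shift f g (n + 1) < pw (f n + 1)" if "shift f g n < pw (f n)" for n
    using that unfolding shift_Suc pw_Suc by (simp add: mult_2 add_less_le_mono)
  have "n < b \<longrightarrow> shift f g (n + 1) < pw (f n + 1)"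
  proof (rule rec_induct[where n = n])
    show "rec (\<lambda>n. n < b \<longrightarrow> shift f g (n + 1) < pw (f n + 1))"
      by (intro rec_intro recf_shift f)
    show "0 < b \<longrightarrow> shift f g (0 + 1) < pw (f 0 + 1)"
      using step[of 0] by simp
    show "n + 1 < b \<longrightarrow> shift f g (n + 1 + 1) < pw (f (n + 1) + 1)"
      if IH: "n < b \<longrightarrow> shift f g (n + 1) < pw (f n + 1)" for n
    proof
      assume "n + 1 < b"
      moreover from this have "n < b"
        by (metis less_add_one less_trans)
      ultimately have "shift f g (n + 1) < pw (f n + 1)" "f n + 1 \<le> f (n + 1)"
        using IH strict[of n "n + 1"] by (auto simp: less_iff_succ_less_eq)
      then show "shift f g (n + 1 + 1) < pw (f (n + 1) + 1)"
        by (intro step) (meson less_le_trans pw_le_iff)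
    qed
  qed
  then show ?thesis
    using assms(2) by blast
qed

lemma shift_bound:
  assumes strict: "\<And>x y. x < y \<Longrightarrow> y < b \<Longrightarrow> f x < f y" and "T \<le> b"
    and "\<And>x. x < T \<Longrightarrow> f x < T'"
  shows "shift f g T < pw T'"
proof (cases T rule: mnum_zero_or_succ)
  case (2 n)
  then have "n < T"
    by simp
  then have "shift f g T < pw (f n + 1)"
    using shift_less[OF strict, of b n g] assms(2) 2 by (simp add: less_iff_succ_less_eq)
  also have "\<dots> \<le> pw T'"
    using assms(3)[OF \<open>n < T\<close>] by (simp add: less_iff_succ_less_eq)
  finally show ?thesis .
qed simp

lemma shift_stable:
  assumes "g < pw m" "m \<le> n"
  shows "shift f g n = shift f g m"
proof -
  have "shift f g (m + k) = shift f g m" for k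
  proof (rule rec_induct[where n = k])
    show "rec (\<lambda>k. shift f g (m + k) = shift f g m)"
      by (intro rec_intro recf_shift)
    show "shift f g (m + (k + 1)) = shift f g m" if "shift f g (m + k) = shift f g m" for k
      using that hasbit_high[of g "m + k"] less_le_trans[OF assms(1), of "pw (m + k)"]
      by (simp add: shift_Suc add.assoc[symmetric])
  qed simp
  then show ?thesis
    using assms(2) by (auto simp: mnum_le_iff)
qed

lemma pw_dvd_shift:
  assumes "\<And>x. x < n \<Longrightarrow> hasbit x g \<Longrightarrow> t \<le> f x"
  shows "pw t dvd shift f g n"
proof -
  have "k \<le> n \<longrightarrow> pw t dvd shift f g k" for k
  proof (rule rec_induct[where n = k])
    show "rec (\<lambda>k. k \<le> n \<longrightarrow> pw t dvd shift f g k)"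
      by (intro rec_intro recf_shift)
    show "k + 1 \<le> n \<longrightarrow> pw t dvd shift f g (k + 1)" if "k \<le> n \<longrightarrow> pw t dvd shift f g k" for k
      using that assms[of k] pw_dvd[of t "f k"] less_imp_le[of k n]
      by (auto simp: shift_Suc less_iff_succ_less_eq[of k n, symmetric])
  qed simp
  then show ?thesis
    by blast
qed

end

text \<open>Each \<open>shift (c i) g\<close> is chosen separately, so its recursiveness in
  \<open>i\<close> and \<open>g\<close> is not automatic. A single recursion with parameter
  \<open>pr i g\<close> agrees with all of them by induction.\<close>

lemma recf_shift_uniform:
  assumes c: "recf2 c" and i: "recf i" and g: "recf g" and n: "recf n"
  shows "recf (\<lambda>z. shift (c (i z)) (g z) (n z))"
proof -
  have ci: "recf (c i)" for i
    using recf2_comp[OF c recf_const[of i] recf_id] .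
  have "recf3 (\<lambda>p n v. v + (if hasbit n (p2 p) then pw (c (p1 p) n) else 0))"
    by (intro rec_intro recf2_comp[OF c])
  then obtain H where H: "recf2 H" "\<And>p. H p 0 = 0"
    "\<And>p n. H p (n + 1) = H p n + (if hasbit n (p2 p) then pw (c (p1 p) n) else 0)"
    using primitive_recursion[where a = "\<lambda>_. 0" and
        h = "\<lambda>p n v. v + (if hasbit n (p2 p) then pw (c (p1 p) n) else 0)"] recf_const[of 0] by blast
  have "H p n = shift (c (p1 p)) (p2 p) n" for p n
  proof (rule rec_induct[where n = n])
    show "rec (\<lambda>n. H p n = shift (c (p1 p)) (p2 p) n)"
      by (intro rec_intro recf2_comp[OF H(1)] recf_shift ci)
  qed (simp_all add: H shift_0 shift_Suc ci)
  then have "shift (c (i z)) (g z) (n z) = H (pr (i z) (g z)) (n z)" for z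
    by simp
  then show ?thesis
    by (simp only:) (intro recf2_comp[OF H(1)] rec_intro i g n)
qed

section \<open>Iteration of a family of functions\<close>

lemma interval_induct:
  assumes P: "rec P" and "i \<le> k" "P i" and "\<And>k. i \<le> k \<Longrightarrow> P k \<Longrightarrow> P (k + 1)"
  shows "P k"
proof -
  have "P (i + m)" for m
  proof (rule rec_induct[where n = m])
    show "rec (\<lambda>m. P (i + m))"
      by (intro rec_comp[OF P] rec_intro)
  qed (use assms in \<open>simp_all add: add.assoc[symmetric]\<close>)
  then show ?thesis
    using assms(2) by (auto simp: mnum_le_iff)
qed

text \<open>In the notation of the paper, \<open>iterate c i n k\<close> is \<open>c\<^sub>i\<^sub>k(n)\<close>; below \<open>i\<close> its value is \<open>n\<close>.\<close>

definition iterate :: "('a mnum \<Rightarrow> 'a mnum \<Rightarrow> 'a mnum) \<Rightarrow> 'a mnum \<Rightarrow> 'a mnum \<Rightarrow> 'a mnum \<Rightarrow> 'a mnum" where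
  "iterate c i n = (SOME H. recf H \<and> H 0 = n \<and> (\<forall>k. H (k + 1) = (if k < i then n else c k (H k))))"

context
  fixes c :: "'a mnum \<Rightarrow> 'a mnum \<Rightarrow> 'a mnum"
  assumes c: "recf2 c"
begin

lemma iterate_spec: "recf (iterate c i n) \<and> iterate c i n 0 = n \<and>
    (\<forall>k. iterate c i n (k + 1) = (if k < i then n else c k (iterate c i n k)))"
proof -
  have "recf2 (\<lambda>k v. if k < i then n else c k v)"
    by (intro rec_intro c)
  then have "\<exists>H. recf H \<and> H 0 = n \<and> (\<forall>k. H (k + 1) = (if k < i then n else c k (H k)))"
    by (elim recursion[where a = n]) blast
  from someI_ex[OF this] show ?thesis
    unfolding iterate_def .
qed

lemma recf_iterate: "recf h \<Longrightarrow> recf (\<lambda>z. iterate c i n (h z))"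
  by (rule recf_comp[OF iterate_spec[THEN conjunct1]])

lemma iterate_self [simp]: "iterate c i n i = n"
  using iterate_spec[of i n] by (cases i rule: mnum_zero_or_succ) auto

lemma iterate_Suc: "i \<le> k \<Longrightarrow> iterate c i n (k + 1) = c k (iterate c i n k)"
  using iterate_spec[of i n] by auto

text \<open>As for \<open>shift\<close>, one recursion with the parameter \<open>pr i n\<close>
  replaces separately chosen solutions. The uniformity in \<open>i\<close> and \<open>n\<close> is
  needed where the jump decides a condition on exponents at all stages.\<close>

lemma recf_iterate_uniform:
  assumes i: "recf i" and n: "recf n" and k: "recf k"
  shows "recf (\<lambda>z. iterate c (i z) (n z) (k z))"
proof -
  have "recf3 (\<lambda>p k v. if k < p1 p then p2 p else c k v)"
    by (intro rec_intro recf2_comp[OF c])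
  then obtain H where H: "recf2 H" "\<And>p. H p 0 = p2 p"
    "\<And>p k. H p (k + 1) = (if k < p1 p then p2 p else c k (H p k))"
    using primitive_recursion[where a = "\<lambda>p. p2 p" and
        h = "\<lambda>p k v. if k < p1 p then p2 p else c k v"] recf_p2 by blast
  have "H p k = iterate c (p1 p) (p2 p) k" for p k
  proof (rule rec_induct[where n = k])
    show "rec (\<lambda>k. H p k = iterate c (p1 p) (p2 p) k)"
      by (intro rec_intro recf2_comp[OF H(1)] recf_iterate)
  qed (simp_all add: H iterate_spec)
  then have "iterate c (i z) (n z) (k z) = H (pr (i z) (n z)) (k z)" for z
    by simp
  then show ?thesis
    by (simp only:) (intro recf2_comp[OF H(1)] rec_intro i n k)
qed

lemma iterate_iterate:
  assumes "i \<le> j" "j \<le> k"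
  shows "iterate c j (iterate c i n j) k = iterate c i n k"
  by (rule interval_induct[OF _ assms(2)])
    (use assms in \<open>auto intro!: rec_intro recf_iterate simp: iterate_Suc order_trans[of i j]\<close>)

end

section \<open>Goodstein systems over the type of numbers\<close>

text \<open>Closure under one unbounded quantifier. Iterating it yields all arithmetical sets, so
  this is arithmetical comprehension without formulas.\<close>

definition jump_closed :: "'a itself \<Rightarrow> bool" where
  "jump_closed _ \<longleftrightarrow> (\<forall>A\<in>SS :: 'a mnum set set. rec (\<lambda>x. \<exists>y. pr y x \<in> A))"

lemma rec_ex_jump:
  fixes P :: "'a mnum \<Rightarrow> 'a mnum \<Rightarrow> bool"
  assumes "jump_closed TYPE('a)" "rec (\<lambda>w. P (p1 w) (p2 w))"
  shows "rec (\<lambda>z. \<exists>y. P y z)"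
proof -
  have "{w. P (p1 w) (p2 w)} \<in> SS"
    using assms(2) by (simp add: rec_def)
  then have "rec (\<lambda>x. \<exists>y. pr y x \<in> {w. P (p1 w) (p2 w)})"
    using assms(1) unfolding jump_closed_def by blast
  then show ?thesis
    by simp
qed

text \<open>The family is a total binary function that is constrained only for
  \<open>n < b i\<close>; this spares functions with restricted domains in the combinatorial
  part.\<close>

definition gsystem :: "('a mnum \<Rightarrow> 'a mnum) \<Rightarrow> ('a mnum \<Rightarrow> 'a mnum \<Rightarrow> 'a mnum) \<Rightarrow> bool" where
  "gsystem b c \<longleftrightarrow> recf b \<and> recf2 c \<and> (\<forall>i j. i \<le> j \<longrightarrow> b i \<le> b j) \<and> 0 < b 0 \<and>
     (\<forall>i n. n < b i \<longrightarrow> c i n < b (i + 1)) \<and>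
     (\<forall>i n n'. n < n' \<and> n' < b i \<longrightarrow> c i n < c i n') \<and>
     (\<forall>d Y. recf d \<and> (\<forall>i. d i < b i) \<and> Y \<in> SS \<and> (\<forall>m. \<exists>n\<in>Y. m < n) \<longrightarrow>
       (\<exists>i\<in>Y. \<exists>j\<in>Y. i < j \<and> iterate c i (d i) j \<le> d j))"

definition gsequence :: "('a mnum \<Rightarrow> 'a mnum) \<Rightarrow> ('a mnum \<Rightarrow> 'a mnum \<Rightarrow> 'a mnum) \<Rightarrow> 'a mnum \<Rightarrow>
    ('a mnum \<Rightarrow> 'a mnum) \<Rightarrow> bool" where
  "gsequence b c m G \<longleftrightarrow> recf G \<and> G 0 = m \<and>
     (\<forall>i. if G i = 0 then G (i + 1) = 0 else G (i + 1) + 1 = shift (c i) (G i) (b i))"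

definition goodstein_terminates :: "'a itself \<Rightarrow> bool" where
  "goodstein_terminates _ \<longleftrightarrow> (\<forall>b c (m :: 'a mnum). gsystem b c \<and> m < pw (b 0) \<longrightarrow>
     (\<exists>G. gsequence b c m G \<and> (\<exists>i. G i = 0)))"

context
  fixes b :: "'a mnum \<Rightarrow> 'a mnum" and c :: "'a mnum \<Rightarrow> 'a mnum \<Rightarrow> 'a mnum"
  assumes system: "gsystem b c"
begin

lemma b_rec: "recf b" and c_rec: "recf2 c" and b_mono: "i \<le> j \<Longrightarrow> b i \<le> b j"
  and b_zero: "0 < b 0" and c_less: "n < b i \<Longrightarrow> c i n < b (i + 1)"
  and c_strict: "n < n' \<Longrightarrow> n' < b i \<Longrightarrow> c i n < c i n'"
  using system unfolding gsystem_def by blast+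

lemma b_pos: "0 < b i"
  using b_zero b_mono[of 0 i] by (auto elim: less_le_trans)

lemma ci_rec: "recf (c i)"
  using recf2_comp[OF c_rec recf_const[of i] recf_id] .

lemma c_mono: "n \<le> n' \<Longrightarrow> n' < b i \<Longrightarrow> c i n \<le> c i n'"
  using c_strict[of n n' i] by (auto simp: order_le_less)

lemma system_inevitable:
  assumes "recf d" "\<And>i. d i < b i" "Y \<in> SS" "\<And>m. \<exists>n\<in>Y. m < n"
  obtains i j where "i \<in> Y" "j \<in> Y" "i < j" "iterate c i (d i) j \<le> d j"
  using system assms unfolding gsystem_def by blast

lemma iterate_less:
  assumes "n < b i" "i \<le> k"
  shows "iterate c i n k < b k"
  by (rule interval_induct[OF _ assms(2)])
    (use assms in \<open>auto intro!: rec_intro recf_iterate c_rec b_rec recf_comp[OF b_rec] simp: iterate_Suc[OF c_rec] c_less iterate_self[OF c_rec]\<close>)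

lemma shift_pos:
  assumes "0 < g" "g < pw (b i)"
  shows "0 < shift (c i) g (b i)"
proof -
  have "topbit g < b i"
    using topbit_less_iff assms by blast
  then show ?thesis
    using shift_ge[OF ci_rec assms(1)] pw_pos less_le_trans by blast
qed

lemma shift_less_pw: "shift (c i) g (b i) < pw (b (i + 1))"
  by (rule shift_bound[OF ci_rec c_strict]) (auto intro: c_less)

lemma gsequence_less:
  assumes G: "gsequence b c m G" and m: "m < pw (b 0)"
  shows "G i < pw (b i)"
proof (rule rec_induct[where n = i])
  have G_rec: "recf G" and step: "\<And>i. if G i = 0 then G (i + 1) = 0 else G (i + 1) + 1 = shift (c i) (G i) (b i)"
    using G unfolding gsequence_def by auto
  show "rec (\<lambda>i. G i < pw (b i))"
    by (intro rec_intro recf_comp[OF b_rec] G_rec b_rec)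
  show "G 0 < pw (b 0)"
    using G m unfolding gsequence_def by simp
  show "G (i + 1) < pw (b (i + 1))" for i
  proof (cases "G i = 0")
    case False
    then have "G (i + 1) + 1 < pw (b (i + 1))"
      using step[of i] shift_less_pw[of i "G i"] by simp
    then show ?thesis
      using less_add_one less_trans by blast
  qed (use step[of i] in simp)
qed

text \<open>The recursion uses truncated subtraction. Nothing is truncated, because
  \<open>G i < pw (b i)\<close> puts the leading exponent of a positive \<open>G i\<close> below
  \<open>b i\<close>, where \<open>shift\<close> adds a positive power for it.\<close>

lemma gsequence_exists:
  assumes m: "m < pw (b 0)"
  obtains G where "gsequence b c m G"
proof -
  have "recf2 (\<lambda>i g. if g = 0 then 0 else shift (c i) g (b i) - 1)"
    by (intro rec_intro recf_shift_uniform[OF c_rec] recf_comp[OF b_rec])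
  then obtain G where G: "recf G" "G 0 = m"
    "\<And>i. G (i + 1) = (if G i = 0 then 0 else shift (c i) (G i) (b i) - 1)"
    using recursion[where a = m and h = "\<lambda>i g. if g = 0 then 0 else shift (c i) g (b i) - 1"] by blast
  have less: "G i < pw (b i)" for i
  proof (rule rec_induct[where n = i])
    show "rec (\<lambda>i. G i < pw (b i))"
      by (intro rec_intro recf_comp[OF b_rec] G b_rec)
    show "G (i + 1) < pw (b (i + 1))" for i
    proof -
      have "shift (c i) (G i) (b i) - 1 \<le> shift (c i) (G i) (b i)"
        by (metis le_add_diff_inverse2 less_iff_succ_less_eq less_imp_le mnum_minus_eq_zero mnum_zero_le
            not_le order_refl add_increasing2)
      then show ?thesis
        using shift_less_pw[of i "G i"] unfolding G(3) by (auto elim: le_less_trans)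
    qed
  qed (simp add: G m)
  have "G (i + 1) + 1 = shift (c i) (G i) (b i)" if "G i \<noteq> 0" for i
  proof -
    have "1 \<le> shift (c i) (G i) (b i)"
      using shift_pos[OF _ less, of i] that by (simp add: mnum_neq_zero(1) less_iff_succ_less_eq)
    then show ?thesis
      using that by (simp add: G(3))
  qed
  then have "gsequence b c m G"
    unfolding gsequence_def using G by auto
  then show ?thesis
    using that by blast
qed

lemma descent:
  assumes d: "recf d" "\<And>j. i0 \<le> j \<Longrightarrow> d j < b j" "\<And>j. i0 \<le> j \<Longrightarrow> d (j + 1) \<le> c j (d j)"
  obtains i1 where "i0 \<le> i1" "\<And>j. i1 \<le> j \<Longrightarrow> d (j + 1) = c j (d j)"
proof -
  have "\<exists>i1\<ge>i0. \<forall>j\<ge>i1. d (j + 1) = c j (d j)"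
  proof (rule ccontr)
    assume none: "\<not> ?thesis"
    \<comment> \<open>Stages just after a strict descent. For \<open>i < j\<close> in
      \<open>Y\<close> the drop that leads to \<open>j\<close> happens at some \<open>k\<close> with
      \<open>i \<le> k\<close>, hence \<open>d j\<close> is strictly less than the iterate of
      \<open>d i\<close>. The bound \<open>j < y\<close> keeps \<open>Y\<close> recursive.\<close>
    define Y where "Y = {y. \<exists>j<y. y = j + 1 \<and> i0 \<le> j \<and> d y < c j (d j)}"
    have "rec (\<lambda>y. \<exists>j<y. y = j + 1 \<and> i0 \<le> j \<and> d y < c j (d j))"
      by (intro rec_intro recf2_comp[OF c_rec] recf_comp[OF d(1)])
    then have Y: "Y \<in> SS"
      unfolding Y_def rec_def .
    have unbounded: "\<exists>n\<in>Y. m < n" for m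
    proof -
      obtain j where j: "max i0 m \<le> j" "d (j + 1) \<noteq> c j (d j)"
        using none by (metis max.cobounded1)
      have "i0 \<le> j" "m \<le> j"
        using j(1) by auto
      then have "j + 1 \<in> Y"
        using d(3)[of j] j(2) unfolding Y_def by auto
      then show ?thesis
        using \<open>m \<le> j\<close> by (intro bexI[of _ "j + 1"]) (auto simp flip: less_eq_iff_succ_less)
    qed
    \<comment> \<open>The property of a system speaks of functions that are bounded by
      \<open>b\<close> everywhere; below \<open>i0\<close> the value 0 is safe, and \<open>Y\<close>
      contains no such stage.\<close>
    have d': "recf (\<lambda>j. if i0 \<le> j then d j else 0)"
      by (intro rec_intro d)
    have "(if i0 \<le> j then d j else 0) < b j" for j
      using d(2) b_pos by simp
    then obtain i j where ij: "i \<in> Y" "j \<in> Y" "i < j"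
      and le: "iterate c i (if i0 \<le> i then d i else 0) j \<le> (if i0 \<le> j then d j else 0)"
      using system_inevitable[OF d' _ Y unbounded] by blast
    have i: "i0 \<le> i" and j: "i0 \<le> j"
      using ij unfolding Y_def by (auto simp: order_le_less elim: less_trans)
    obtain k where k: "j = k + 1" "d j < c k (d k)"
      using ij unfolding Y_def by blast
    have ik: "i \<le> k"
      using ij(3) unfolding k less_eq_iff_succ_less .
    have "d k \<le> iterate c i (d i) k"
    proof (rule interval_induct[OF _ ik])
      show "rec (\<lambda>k. d k \<le> iterate c i (d i) k)"
        by (intro rec_intro recf_iterate c_rec d)
      show "d i \<le> iterate c i (d i) i"
        by (simp add: iterate_self[OF c_rec])
      fix k assume k: "i \<le> k" "d k \<le> iterate c i (d i) k"
      have "d (k + 1) \<le> c k (d k)"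
        using d(3)[of k] i k by simp
      also have "\<dots> \<le> c k (iterate c i (d i) k)"
        by (rule c_mono[OF k(2) iterate_less[OF d(2)[OF i] k(1)]])
      finally show "d (k + 1) \<le> iterate c i (d i) (k + 1)"
        by (simp add: iterate_Suc[OF c_rec k(1)])
    qed
    then have "c k (d k) \<le> c k (iterate c i (d i) k)"
      by (rule c_mono[OF _ iterate_less[OF d(2)[OF i] ik]])
    also have "\<dots> = iterate c i (d i) j"
      unfolding k by (simp add: iterate_Suc[OF c_rec ik])
    also have "\<dots> \<le> d j"
      using le i j by simp
    finally show False
      using k(2) by simp
  qed
  then show ?thesis
    using that by blast
qed

section \<open>A Goodstein sequence that stays positive\<close>

context
  fixes G :: "'a mnum \<Rightarrow> 'a mnum" and m :: "'a mnum"
  assumes G: "gsequence b c m G" and m: "m < pw (b 0)" and G_pos: "\<And>i. 0 < G i"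
begin

lemma G_rec: "recf G"
  using G unfolding gsequence_def by blast

lemma G_step: "G (i + 1) + 1 = shift (c i) (G i) (b i)"
  using G G_pos[of i] unfolding gsequence_def by (metis less_irrefl)

text \<open>
  The part of \<open>G\<close> below a threshold \<open>T\<close> that is respected by the system behaves like a Goodstein
  sequence itself.  Its leading exponent stabilises, and must not be its only exponent.
\<close>

lemma lower_threshold:
  assumes T: "recf T" "\<And>j. i0 \<le> j \<Longrightarrow> T j \<le> b j"
    "\<And>j n. i0 \<le> j \<Longrightarrow> n < T j \<Longrightarrow> c j n < T (j + 1)"
    "\<And>j n. i0 \<le> j \<Longrightarrow> T j \<le> n \<Longrightarrow> n < b j \<Longrightarrow> T (j + 1) \<le> c j n"
    and pos: "\<And>j. i0 \<le> j \<Longrightarrow> 0 < rm (G j) (pw (T j))"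
  obtains i1 n where "i0 \<le> i1" "n < T i1" "\<And>j. i1 \<le> j \<Longrightarrow> 0 < rm (G j) (pw (iterate c i1 n j))"
proof -
  define R where "R j = rm (G j) (pw (T j))" for j
  define A where "A j = qt (G j) (pw (T j)) * pw (T j)" for j
  define t where "t j = topbit (R j)" for j
  have split: "G j = A j + R j" and R_less: "R j < pw (T j)" and dvd: "pw (T j) dvd A j" for j
    using qt_rm[OF pw_pos, of "G j" "T j"] unfolding A_def R_def by auto
  have R_pos: "0 < R j" if "i0 \<le> j" for j
    using pos that unfolding R_def by blast
  have t_less: "t j < T j" "t j < b j" if "i0 \<le> j" for j
    using topbit_less_iff[OF R_pos[OF that]] R_less T(2)[OF that] less_le_trans unfolding t_def by blast+
  \<comment> \<open>Digits from \<open>T j\<close> on go to a multiple of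
    \<open>pw (T (j + 1))\<close>, digits below to a positive number less than that power. So the
    subtraction of one takes place entirely in the lower part.\<close>
  have R_step: "R (j + 1) + 1 = shift (c j) (R j) (b j)" if j: "i0 \<le> j" for j
  proof -
    have "shift (c j) (R j) (b j) = shift (c j) (R j) (T j)"
      by (rule shift_stable[OF ci_rec R_less T(2)[OF j]])
    also have "\<dots> < pw (T (j + 1))"
      by (rule shift_bound[OF ci_rec c_strict T(2)[OF j] T(3)[OF j]])
    finally have less: "shift (c j) (R j) (b j) < pw (T (j + 1))" .
    have "0 < shift (c j) (R j) (b j)"
      using shift_pos[OF R_pos[OF j], of j] R_less[of j] T(2)[OF j] by (meson less_le_trans pw_le_iff)
    then obtain r where r: "shift (c j) (R j) (b j) = r + 1"
      by (cases "shift (c j) (R j) (b j)" rule: mnum_zero_or_succ) auto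
    have "pw (T (j + 1)) dvd shift (c j) (A j) (b j)"
      using hasbit_low[OF dvd] by (intro pw_dvd_shift[OF ci_rec] T(4)[OF j]) (auto simp: not_less[symmetric])
    then obtain k where k: "shift (c j) (A j) (b j) = k * pw (T (j + 1))"
      by (metis dvd_def mult.commute)
    have "G (j + 1) + 1 = k * pw (T (j + 1)) + r + 1"
      using G_step[of j] shift_add[OF ci_rec dvd R_less, of j j "b j"] k r
      by (simp add: split[symmetric] add.assoc)
    then have "G (j + 1) = k * pw (T (j + 1)) + r"
      by simp
    moreover have "r < pw (T (j + 1))"
      using less unfolding r by (metis less_add_one less_trans)
    ultimately show ?thesis
      unfolding R_def[of "j + 1"] using r qt_rm_unique(2) by metis
  qed
  have descend: "t (j + 1) \<le> c j (t j)" if j: "i0 \<le> j" for j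
  proof -
    have "shift (c j) (R j) (b j) = shift (c j) (R j) (t j + 1)"
      using topbit_less[of "R j"] t_less(2)[OF j]
      by (intro shift_stable[OF ci_rec]) (auto simp: t_def less_iff_succ_less_eq)
    also have "\<dots> < pw (c j (t j) + 1)"
      by (rule shift_less[OF ci_rec c_strict t_less(2)[OF j]])
    finally have "R (j + 1) < pw (c j (t j) + 1)"
      using R_step[OF j] by (metis less_add_one less_trans)
    then show ?thesis
      using topbit_less_iff[OF R_pos[of "j + 1"]] add_increasing2[of 1, OF _ j]
      unfolding t_def less_eq_iff_succ_less[of _ "c j _"] by simp
  qed
  have "recf t"
    unfolding t_def R_def by (intro rec_intro recf_comp[OF T(1)] G_rec T(1))
  then obtain i1 where i1: "i0 \<le> i1" "\<And>j. i1 \<le> j \<Longrightarrow> t (j + 1) = c j (t j)"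
    using descent[of t i0] t_less(2) descend by blast
  have iter: "iterate c i1 (t i1) j = t j" if j: "i1 \<le> j" for j
    by (rule interval_induct[OF _ j])
      (use i1 in \<open>auto intro!: rec_intro recf_iterate c_rec \<open>recf t\<close> simp: iterate_Suc[OF c_rec] iterate_self[OF c_rec]\<close>)
  have "0 < rm (G j) (pw (iterate c i1 (t i1) j))" if j1: "i1 \<le> j" for j
  proof -
    have j: "i0 \<le> j"
      using i1 j1 by simp
    obtain k where k: "A j = k * pw (t j)"
      using dvd_trans[OF pw_dvd dvd, of "t j" j] t_less(1)[OF j] by (metis dvd_def mult.commute less_imp_le)
    define r where "r = R j - pw (t j)"
    have r: "R j = pw (t j) + r" "r < pw (t j)"
      using topbit_split[OF R_pos[OF j]] unfolding t_def r_def by auto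
    have "G j = (k + 1) * pw (t j) + r"
      using split[of j] k r by (simp add: algebra_simps)
    then have rm: "rm (G j) (pw (t j)) = r"
      using r(2) by (rule qt_rm_unique(2))
    \<comment> \<open>If the leading power were all of \<open>R j\<close>, then
      \<open>R (j + 1)\<close> would be \<open>pw (t (j + 1)) - 1\<close>, although
      \<open>t (j + 1)\<close> is its leading exponent.\<close>
    have "r \<noteq> 0"
    proof
      assume "r = 0"
      then have "R (j + 1) + 1 = pw (t (j + 1))"
        using R_step[OF j] r shift_pw[OF ci_rec, of j "t j" "b j"] t_less(2)[OF j] i1(2)[OF j1] by simp
      moreover have "pw (t (j + 1)) \<le> R (j + 1)"
        using pw_topbit_le[OF R_pos[of "j + 1"]] j unfolding t_def by (simp add: add_increasing2)
      ultimately show False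
        by (metis less_add_one not_less)
    qed
    then show ?thesis
      unfolding iter[OF j1] rm by (simp add: mnum_neq_zero)
  qed
  then show ?thesis
    using that[of i1 "t i1"] i1(1) t_less(1)[OF i1(1)] by blast
qed

lemma no_positive_gsequence:
  assumes jump: "jump_closed TYPE('a)"
  shows False
proof -
  \<comment> \<open>\<open>P\<close> contains an unbounded quantifier over the later stages
    \<open>j\<close>; the jump makes it recursive, jointly in \<open>i\<close> and
    \<open>n\<close>.\<close>
  define P where "P i n \<longleftrightarrow> n < b i \<and> (\<forall>j\<ge>i. 0 < rm (G j) (pw (iterate c i n j)))" for i n
  have "rec (\<lambda>z. \<exists>j. p1 z \<le> j \<and> \<not> 0 < rm (G j) (pw (iterate c (p1 z) (p2 z) j)))"
    by (intro rec_ex_jump[OF jump] rec_intro recf_iterate_uniform[OF c_rec] recf_comp[OF G_rec])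
  from rec_not[OF this] have "rec (\<lambda>z. \<forall>j\<ge>p1 z. 0 < rm (G j) (pw (iterate c (p1 z) (p2 z) j)))"
    by simp
  then have P2: "rec (\<lambda>z. P (p1 z) (p2 z))"
    unfolding P_def by (intro rec_conj rec_intro recf_comp[OF b_rec])
  have P_rec: "rec (\<lambda>z. P (f z) (g z))" if "recf f" "recf g" for f g
    using rec_comp[OF P2 recf_pr[OF that]] by simp
  have rm: "rm (G j) (pw (b j)) = G j" for j
    by (rule qt_small(2)[OF gsequence_less[OF G m]])
  \<comment> \<open>The threshold \<open>b\<close> cuts off nothing: every \<open>G j\<close> is its
    own remainder, and positive by assumption.\<close>
  obtain i1 n1 where start: "P i1 n1"
  proof (rule lower_threshold[of b 0])
    show "recf b"
      by (rule b_rec)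
  qed (auto simp: rm G_pos c_less P_def not_less[symmetric] intro: that)
  have P_iterate: "P j (iterate c i n j)" if "P i n" "i \<le> j" for i j n
    using that iterate_less iterate_iterate[OF c_rec] unfolding P_def by (metis order_trans)
  \<comment> \<open>The disjunct \<open>j < i1\<close> makes the search total; from
    \<open>i1\<close> on, \<open>d j\<close> is the least exponent with \<open>P j\<close>.\<close>
  define d where "d j = (LEAST n. P j n \<or> j < i1)" for j
  have ex: "\<exists>n. P j n \<or> j < i1" for j
    using P_iterate[OF start, of j] not_less by blast
  have d_rec: "recf d"
    unfolding d_def by (rule recf_Least) (intro rec_intro P_rec ex)+
  have rec: "rec (\<lambda>n. P j n \<or> j < i1)" for j
    by (intro rec_intro P_rec)
  have dP: "P j (d j)" if "i1 \<le> j" for j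
    using Least_rec(1)[OF rec, of j] ex[of j] that unfolding d_def by (auto simp: not_less[symmetric])
  have d_min: "d j \<le> n" if "P j n" for j n
    using Least_rec(2)[OF rec, of j _ n] ex[of j] that unfolding d_def by (auto simp: not_less[symmetric])
  have "d (j + 1) \<le> c j (d j)" if "i1 \<le> j" for j
    using d_min[OF P_iterate[OF dP[OF that], of "j + 1"]] by (simp add: iterate_Suc[OF c_rec] iterate_self[OF c_rec])
  moreover have "d j < b j" if "i1 \<le> j" for j
    using dP[OF that] unfolding P_def by blast
  ultimately obtain i2 where i2: "i1 \<le> i2" "\<And>j. i2 \<le> j \<Longrightarrow> d (j + 1) = c j (d j)"
    using descent[OF d_rec] by blast
  define T where "T j = iterate c i2 (d i2) j" for j
  have T_Suc: "T (j + 1) = c j (T j)" if "i2 \<le> j" for j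
    unfolding T_def by (rule iterate_Suc[OF c_rec that])
  have T_less: "T j < b j" if "i2 \<le> j" for j
    unfolding T_def using iterate_less dP[OF i2(1)] that unfolding P_def by blast
  have Td: "T j = d j" if "i2 \<le> j" for j
    unfolding T_def by (rule interval_induct[OF _ that])
      (use i2 in \<open>auto intro!: rec_intro recf_iterate c_rec d_rec simp: iterate_Suc[OF c_rec] iterate_self[OF c_rec]\<close>)
  \<comment> \<open>From \<open>i2\<close> on the threshold consists of the minimal exponents
    themselves. An exponent below it that satisfies \<open>P\<close> contradicts minimality.\<close>
  obtain i3 n3 where i3: "i2 \<le> i3" "n3 < T i3" "\<And>j. i3 \<le> j \<Longrightarrow> 0 < rm (G j) (pw (iterate c i3 n3 j))"
  proof (rule lower_threshold[of T i2])
    show "recf T"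
      unfolding T_def by (intro recf_iterate c_rec rec_intro)
    show "T j \<le> b j" if "i2 \<le> j" for j
      using T_less[OF that] by simp
    show "c j n < T (j + 1)" if "i2 \<le> j" "n < T j" for j n
      using c_strict[OF that(2) T_less[OF that(1)]] by (simp add: T_Suc[OF that(1)])
    show "T (j + 1) \<le> c j n" if "i2 \<le> j" "T j \<le> n" "n < b j" for j n
      using c_mono[OF that(2,3)] by (simp add: T_Suc[OF that(1)])
    show "0 < rm (G j) (pw (T j))" if "i2 \<le> j" for j
      using dP[OF i2(1)] that unfolding P_def T_def by blast
  qed (rule that)
  then have "P i3 n3"
    using T_less[OF i3(1)] unfolding P_def by (auto elim: less_trans)
  then show False
    using d_min i3 Td[OF i3(1)] by (metis not_less)
qed

end

end

theorem jump_imp_goodstein: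
  assumes "jump_closed TYPE('a)"
  shows "goodstein_terminates TYPE('a)"
  unfolding goodstein_terminates_def
proof (intro allI impI, elim conjE)
  fix b c and m :: "'a mnum"
  assume system: "gsystem b c" and m: "m < pw (b 0)"
  obtain G where G: "gsequence b c m G"
    using gsequence_exists[OF system m] .
  then show "\<exists>G. gsequence b c m G \<and> (\<exists>i. G i = 0)"
    using no_positive_gsequence[OF system G m _ assms] by (metis mnum_neq_zero(1))
qed

section \<open>The reversal\<close>

text \<open>
  We decide a set \<open>J\<close> that is enumerated by \<open>A\<close>.  At stage \<open>t\<close> there is a guess which numbers below
  \<open>K t\<close> belong to \<open>J\<close>: those whose exponent \<open>2(t - y)\<close> has been removed from \<open>a t\<close>.  If \<open>y < K t\<close> is
  found to belong to \<open>J\<close>, then its exponent is removed, the guesses above \<open>y\<close> are discarded, and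
  \<open>K\<close> drops to \<open>y + 1\<close>; otherwise \<open>K\<close> grows by one.  The exponent \<open>2(t - K t) + 1\<close> pays for all
  exponents that are added later.  The system inserts two new exponents at each stage, just above
  all those that belong to discarded guesses.  An infinite descending sequence in the system can
  only consist of guesses that are never discarded, hence it computes \<open>J\<close>.
\<close>

definition enters :: "'a mnum set \<Rightarrow> 'a mnum \<Rightarrow> 'a mnum \<Rightarrow> bool" where
  "enters A t z \<longleftrightarrow> p1 t < p1 z \<and> (\<exists>w\<le>p2 t. pr w (p1 t) \<in> A) \<and> hasbit (2 * (t - p1 t)) (p2 z)"

definition cut :: "'a mnum set \<Rightarrow> 'a mnum \<Rightarrow> 'a mnum \<Rightarrow> 'a mnum" where
  "cut A t z = (if enters A t z then p1 t else p1 z)"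

definition pos :: "'a mnum set \<Rightarrow> 'a mnum \<Rightarrow> 'a mnum \<Rightarrow> 'a mnum" where
  "pos A t z = 2 * (t - cut A t z)"

text \<open>With p for \<open>pos A t z\<close>, the summands are the surviving exponents moved up
  by two, the exponent p + 2 of the latest guess (missing on an entry), and the payment p + 1.
  Division by \<open>pw (p + 2)\<close> discards the old payment or, on an entry, the entering
  exponent and all below it.\<close>

definition next_state :: "'a mnum set \<Rightarrow> 'a mnum \<Rightarrow> 'a mnum \<Rightarrow> 'a mnum" where
  "next_state A t z = pr (cut A t z + 1)
     (qt (p2 z) (pw (pos A t z + 2)) * pw (pos A t z + 4) + (if enters A t z then 0 else pw (pos A t z + 2)) +
      pw (pos A t z + 1))"

lemma next_state_exists:
  assumes A: "A \<in> SS"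
  obtains K a where "recf K" "recf a" "K 0 = 0" "a 0 = 2"
    "\<And>t. pr (K (t + 1)) (a (t + 1)) = next_state A t (pr (K t) (a t))"
proof -
  have "recf2 (next_state A)"
    unfolding next_state_def pos_def cut_def enters_def by (intro rec_intro A)
  then obtain H where H: "recf H" "H 0 = pr 0 2" "\<And>t. H (t + 1) = next_state A t (H t)"
    using recursion[where a = "pr 0 2"] by blast
  have pair: "pr (p1 (H t)) (p2 (H t)) = H t" for t
    by (cases t rule: mnum_zero_or_succ) (simp_all add: H next_state_def)
  show ?thesis
  proof (rule that)
    show "pr (p1 (H (t + 1))) (p2 (H (t + 1))) = next_state A t (pr (p1 (H t)) (p2 (H t)))" for t
      unfolding pair by (rule H(3))
  qed (auto intro!: rec_intro simp: H)
qed

lemma pw_2: "pw 2 = 4"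
  using pw_add[of 1 1] by simp

lemma pw_4: "pw 4 = 16"
  using pw_add[of 2 2] by (simp add: pw_2)

lemmas four_eq = pw_2 pw_4

abbreviation insert_at :: "'a mnum \<Rightarrow> 'a mnum \<Rightarrow> 'a mnum" where
  "insert_at q x \<equiv> (if x < q then x else x + 2)"

text \<open>Moving the digits from \<open>q\<close> on up by two places multiplies the quotient by 4
  and keeps the remainder.\<close>

lemma shift_insert_at:
  assumes "g < pw n" "q \<le> n"
  shows "shift (insert_at q) g n = 4 * qt g (pw q) * pw q + rm g (pw q)"
proof -
  have f: "recf (insert_at q)"
    by (intro rec_intro)
  have low: "k \<le> q \<longrightarrow> shift (insert_at q) g k = rm g (pw k)" for k
  proof (rule rec_induct[where n = k])
    show "rec (\<lambda>k. k \<le> q \<longrightarrow> shift (insert_at q) g k = rm g (pw k))"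
      by (intro rec_intro recf_shift f)
    show "0 \<le> q \<longrightarrow> shift (insert_at q) g 0 = rm g (pw 0)"
      using qt_rm_unique(2)[of g g 1 0] by (simp add: shift_0[OF f])
    show "k + 1 \<le> q \<longrightarrow> shift (insert_at q) g (k + 1) = rm g (pw (k + 1))"
      if "k \<le> q \<longrightarrow> shift (insert_at q) g k = rm g (pw k)" for k
      using that by (auto simp: shift_Suc[OF f] rm_pw_Suc less_iff_succ_less_eq[symmetric])
  qed
  \<comment> \<open>The claim 4 times the high part plus the low part is rearranged so that no
    subtraction occurs; in this form it passes to \<open>k + 1\<close> by adding four times the next
    digit.\<close>
  have "shift (insert_at q) g n + 3 * rm g (pw q) = 4 * rm g (pw n)"
  proof (rule interval_induct[OF _ assms(2)])
    show "rec (\<lambda>n. shift (insert_at q) g n + 3 * rm g (pw q) = 4 * rm g (pw n))"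
      by (intro rec_intro recf_shift f)
    show "shift (insert_at q) g q + 3 * rm g (pw q) = 4 * rm g (pw q)"
      using low[of q] unfolding emb_arith by simp
    show "shift (insert_at q) g (k + 1) + 3 * rm g (pw q) = 4 * rm g (pw (k + 1))"
      if "q \<le> k" "shift (insert_at q) g k + 3 * rm g (pw q) = 4 * rm g (pw k)" for k
    proof -
      have "shift (insert_at q) g (k + 1) = shift (insert_at q) g k + (if hasbit k g then 4 * pw k else 0)"
        using leD[OF that(1)] by (simp add: shift_Suc[OF f] pw_add four_eq mult.commute)
      then show ?thesis
        using that(2) unfolding rm_pw_Suc emb_arith by (auto simp: emb_arith)
    qed
  qed
  moreover have "rm g (pw n) = g"
    by (rule qt_small(2)[OF assms(1)])
  ultimately have "shift (insert_at q) g n + 3 * rm g (pw q) = 4 * (qt g (pw q) * pw q + rm g (pw q))"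
    using qt_rm(1)[OF pw_pos, of g q] by simp
  then show ?thesis
    unfolding emb_arith by simp
qed

text \<open>Numbers compare lexicographically by quotient and remainder modulo \<open>pw q\<close>,
  and multiplying the quotient by 4 respects this.\<close>

lemma shift_insert_at_mono:
  assumes "g \<le> g'" "g' < pw n" "q \<le> n"
  shows "shift (insert_at q) g n \<le> shift (insert_at q) g' n"
proof -
  define Q Q' r r' P where "Q = qt g (pw q)" and "Q' = qt g' (pw q)" and "r = rm g (pw q)"
    and "r' = rm g' (pw q)" and "P = pw q"
  have g: "g = Q * P + r" "r < P" and g': "g' = Q' * P + r'" "r' < P"
    unfolding Q_def Q'_def r_def r'_def P_def by (rule qt_rm[OF pw_pos])+
  have "4 * Q * P + r \<le> 4 * Q' * P + r'"
  proof (cases Q Q' rule: linorder_cases)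
    case less
    then have "(Q + 1) * P \<le> Q' * P"
      by (intro mult_right_mono) (auto simp: less_iff_succ_less_eq)
    then show ?thesis
      using g(2) emb_pos[of r'] emb_pos[of P] unfolding emb_arith by (simp add: algebra_simps)
  next
    case equal
    then show ?thesis
      using g g' assms(1) by simp
  next
    case greater
    then have "(Q' + 1) * P \<le> Q * P"
      by (intro mult_right_mono) (auto simp: less_iff_succ_less_eq)
    then have "g' < g"
      using g'(2) emb_pos[of r] unfolding g g' emb_arith by (simp add: algebra_simps)
    then show ?thesis
      using assms(1) by simp
  qed
  then show ?thesis
    using assms by (simp add: shift_insert_at Q_def Q'_def r_def r'_def P_def)
qed

text \<open>Two exponents are added per stage, and the initial size 2 has room for the first payment
  exponent 1, that is, for \<open>a 0 = 2\<close>.\<close>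

definition base :: "'a mnum \<Rightarrow> 'a mnum" where
  "base t = 2 * t + 2"

lemma base_rec: "recf base"
  unfolding base_def by (intro rec_intro)

section \<open>The guessing construction\<close>

context
  fixes A :: "'a mnum set" and K a :: "'a mnum \<Rightarrow> 'a mnum"
  assumes A: "A \<in> SS" and K_rec: "recf K" and a_rec: "recf a"
    and start: "K 0 = 0" "a 0 = 2"
    and step: "\<And>t. pr (K (t + 1)) (a (t + 1)) = next_state A t (pr (K t) (a t))"
begin

definition entry :: "'a mnum \<Rightarrow> bool" where
  "entry t \<longleftrightarrow> enters A t (pr (K t) (a t))"

definition kap :: "'a mnum \<Rightarrow> 'a mnum" where
  "kap t = cut A t (pr (K t) (a t))"

text \<open>Exponents below \<open>D t\<close> belong to discarded guesses; the guesses sit at even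
  exponents from \<open>D t + 2\<close> on, the payment at \<open>D t + 1\<close>.\<close>

definition D :: "'a mnum \<Rightarrow> 'a mnum" where
  "D t = 2 * (t - K t)"

definition embed :: "'a mnum \<Rightarrow> 'a mnum \<Rightarrow> 'a mnum" where
  "embed t = insert_at (D (t + 1))"

lemma embed_apply: "embed t x = insert_at (D (t + 1)) x"
  unfolding embed_def ..

text \<open>A stage is read as a pair: \<open>p1 t\<close> is the number under examination,
  \<open>p2 t\<close> bounds the search for a witness in \<open>A\<close>. Each number is thus
  examined at arbitrarily late stages and with arbitrarily large bounds.\<close>

lemma entry_iff: "entry t \<longleftrightarrow> p1 t < K t \<and> (\<exists>w\<le>p2 t. pr w (p1 t) \<in> A) \<and> hasbit (2 * (t - p1 t)) (a t)"
  unfolding entry_def enters_def by simp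

lemma kap_eq: "kap t = (if entry t then p1 t else K t)"
  unfolding entry_def kap_def cut_def by simp

lemma K_Suc: "K (t + 1) = kap t + 1"
  using step[of t] unfolding next_state_def kap_def by simp

lemma kap_le: "kap t \<le> K t"
  unfolding kap_eq entry_iff by auto

lemma K_le: "K t \<le> t"
proof (rule rec_induct[where n = t])
  show "K (t + 1) \<le> t + 1" if "K t \<le> t" for t
    unfolding K_Suc using order_trans[OF kap_le that] by simp
qed (simp_all add: start rec_le K_rec recf_id)

lemma D_K: "D t + 2 * K t = 2 * t"
  using K_le[of t] unfolding D_def distrib_left[symmetric] by simp

lemma D_Suc: "D (t + 1) = pos A t (pr (K t) (a t))"
  unfolding D_def K_Suc pos_def kap_def by simp

lemma D_kap: "D (t + 1) + 2 * kap t = 2 * t"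
  using D_K[of "t + 1"] unfolding K_Suc emb_arith by simp

lemma D_mono: "D t \<le> D (t + 1)"
  using D_K[of t] D_kap[of t] kap_le[of t] unfolding emb_arith by linarith

lemma D_mono':
  assumes "s \<le> t"
  shows "D s \<le> D t"
proof (rule interval_induct[OF _ assms])
  show "rec (\<lambda>t. D s \<le> D t)"
    unfolding D_def by (intro rec_intro K_rec)
qed (auto intro: D_mono order_trans)

lemma D_Suc_le_base: "D (t + 1) \<le> base t"
  using D_kap[of t] emb_pos[of "kap t"] unfolding base_def emb_arith by linarith

lemma D_rec: "recf f \<Longrightarrow> recf (\<lambda>z. D (f z))"
  unfolding D_def by (intro rec_intro recf_comp[OF K_rec])

lemma a_Suc: "a (t + 1) = qt (a t) (pw (D (t + 1) + 2)) * pw (D (t + 1) + 4) +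
    (if entry t then 0 else pw (D (t + 1) + 2)) + pw (D (t + 1) + 1)"
  using step[of t] unfolding next_state_def D_Suc entry_def by simp

lemma a_pos: "0 < a t"
  by (cases t rule: mnum_zero_or_succ) (simp_all add: start a_Suc add_nonneg_pos)

text \<open>The payment exponent \<open>D t + 1\<close> is always present and \<open>D t\<close> is
  not: the lowest two digits of the quotient form the number 2.\<close>

lemma last_exponent: "\<exists>u. qt (a t) (pw (D t)) = 4 * u + 2"
proof (cases t rule: mnum_zero_or_succ)
  case 1
  then have "qt (a t) (pw (D t)) = 4 * 0 + 2"
    using qt_rm_unique(1)[of "a 0" 2 1 0] D_K[of 0] by (simp add: start)
  then show ?thesis
    by blast
next
  case (2 s)
  define P where "P = pw (D t)"
  have "a t = (4 * (4 * qt (a s) (pw (D t + 2)) + (if entry s then 0 else 1)) + 2) * P + 0"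
    unfolding P_def 2 a_Suc by (simp add: pw_add four_eq algebra_simps)
  then show ?thesis
    unfolding P_def using qt_rm_unique(1)[of "a t"] pw_pos by blast
qed

text \<open>Let \<open>P = pw (D (t + 1))\<close>. On an entry, the entering exponent is worth
  \<open>4 * P\<close> after the insertion and is replaced by \<open>2 * P\<close>. Otherwise the
  payment is worth \<open>8 * P\<close> and is replaced by \<open>4 * P + 2 * P\<close>. Higher
  exponents contribute equally to both sides.\<close>

lemma a_Suc_less:
  assumes "a t < pw (base t)"
  shows "a (t + 1) < shift (embed t) (a t) (base t)"
proof -
  define P Q u where "P = pw (D (t + 1))" and "Q = qt (a t) P" and "u = qt Q 4"
  from shift_insert_at[OF assms D_Suc_le_base] have shift: "4 * Q * P \<le> shift (embed t) (a t) (base t)"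
    unfolding embed_def P_def Q_def by simp
  have P: "0 < P"
    unfolding P_def by simp
  have "qt (a t) (P * 4) = u"
    unfolding u_def Q_def using qt_mult[of "rm (a t) P" P 4 "qt (a t) P"] qt_rm[OF P, of "a t"] by simp
  then have a: "a (t + 1) = u * (P * 16) + (if entry t then 0 else P * 4) + P * 2"
    unfolding a_Suc P_def by (simp add: pw_add four_eq)
  show ?thesis
  proof (cases "entry t")
    case True
    have "D (t + 1) = 2 * (t - p1 t)"
      using True unfolding D_Suc pos_def kap_def[symmetric] kap_eq by simp
    then have odd: "\<exists>k. Q = 2 * k + 1"
      using True unfolding entry_iff hasbit_iff Q_def P_def by simp
    have "rm Q 4 \<noteq> 0"
    proof
      assume "rm Q 4 = 0"
      then have "Q = 2 * (2 * u)"
        using qt_rm(1)[of 4 Q] unfolding u_def by (simp add: mult.commute)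
      then show False
        using odd even_neq_odd by metis
    qed
    then have "1 \<le> rm Q 4"
      using less_iff_succ_less_eq[of 0 "rm Q 4"] by (simp add: mnum_neq_zero(1))
    then have "4 * u + 1 \<le> Q"
      using qt_rm(1)[of 4 Q] unfolding u_def by (metis add_left_mono mult.commute zero_less_numeral)
    then have "(4 * u + 1) * P \<le> Q * P"
      by (rule mult_right_mono) simp
    then have "a (t + 1) < 4 * Q * P"
      using P True unfolding a emb_arith by (simp add: algebra_simps emb_arith)
    then show ?thesis
      using shift by simp
  next
    case False
    then have "D (t + 1) = D t"
      using D_Suc[of t] unfolding pos_def kap_def[symmetric] kap_eq by (simp add: D_def[of t])
    then obtain u' where "Q = 4 * u' + 2"
      using last_exponent[of t] unfolding Q_def P_def by auto
    then have "Q = 4 * u + 2"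
      unfolding u_def using qt_rm_unique(1)[of Q u' 4 2] by (simp add: mult.commute)
    then have "a (t + 1) < 4 * Q * P"
      using P False unfolding a emb_arith by (simp add: algebra_simps emb_arith)
    then show ?thesis
      using shift by simp
  qed
qed

lemma embed_rec: "recf2 embed"
  unfolding embed_def by (intro rec_intro D_rec)

lemma embed_iterate: "iterate embed i n i = n"
    "i \<le> k \<Longrightarrow> iterate embed i n (k + 1) = embed k (iterate embed i n k)"
  by (rule iterate_self[OF embed_rec], rule iterate_Suc[OF embed_rec])

lemma gsequence_dominates:
  assumes G: "gsequence base embed 2 G" and sys: "gsystem base embed"
  shows "a t \<le> G t"
proof (rule rec_induct[where n = t])
  have G_rec: "recf G"
    using G unfolding gsequence_def by blast
  have "2 < pw (base 0)"
    unfolding base_def by (simp add: four_eq)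
  then have less: "G t < pw (base t)" for t
    using gsequence_less[OF sys G] by blast
  show "rec (\<lambda>t. a t \<le> G t)"
    by (intro rec_intro a_rec G_rec)
  show "a 0 \<le> G 0"
    using G unfolding gsequence_def by (simp add: start)
  fix t assume le: "a t \<le> G t"
  then have "G t \<noteq> 0"
    using a_pos[of t] by auto
  then have "G (t + 1) + 1 = shift (embed t) (G t) (base t)"
    using G unfolding gsequence_def by metis
  then have "shift (embed t) (a t) (base t) \<le> G (t + 1) + 1"
    unfolding embed_def using shift_insert_at_mono[OF le less D_Suc_le_base] by simp
  then show "a (t + 1) \<le> G (t + 1)"
    using less_le_trans[OF a_Suc_less[OF le_less_trans[OF le less]]] less_eq_iff_succ_less by blast
qed

text \<open>For \<open>y < kap t\<close> the exponent \<open>2 * (t - y)\<close> is at least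
  \<open>D (t + 1) + 2\<close>, so it lies in the surviving part, which moves up by two just as
  \<open>2 * (t + 1 - y)\<close> does.\<close>

lemma kept_exponent:
  assumes y: "y < kap t"
  shows "hasbit (2 * (t + 1 - y)) (a (t + 1)) \<longleftrightarrow> hasbit (2 * (t - y)) (a t)"
proof -
  obtain j where j: "kap t = y + (j + 1)"
    using y by (auto simp: mnum_less_iff)
  have le: "y \<le> t" "y \<le> t + 1"
    using kap_le[of t] K_le[of t] y by (auto simp: add_increasing2)
  have q: "2 * (t - y) = D (t + 1) + 2 + 2 * j" "2 * (t + 1 - y) = D (t + 1) + 4 + 2 * j"
    using D_kap[of t] unfolding j emb_arith emb_diff[OF le(1)] emb_diff[OF le(2)] by simp_all
  define u where "u = qt (a t) (pw (D (t + 1) + 2))"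
  have 1: "qt (a t) (pw (2 * (t - y))) = qt u (pw (2 * j))"
    unfolding u_def q(1) pw_add[of "D (t + 1) + 2"]
    using qt_mult[of "rm (a t) (pw (D (t + 1) + 2))" "pw (D (t + 1) + 2)" "pw (2 * j)"] qt_rm[OF pw_pos, of "a t"]
    by (metis pw_pos)
  define P where "P = pw (D (t + 1))"
  have "(if entry t then 0 else pw (D (t + 1) + 2)) + pw (D (t + 1) + 1) < pw (D (t + 1) + 4)"
    using pw_pos[of "D (t + 1)"] unfolding pw_add four_eq P_def[symmetric] emb_arith
    by (auto simp: emb_arith)
  then have 2: "qt (a (t + 1)) (pw (2 * (t + 1 - y))) = qt u (pw (2 * j))"
    unfolding q(2) pw_add[of "D (t + 1) + 4"] a_Suc u_def[symmetric] add.assoc[of "u * _"] by (rule qt_mult) simp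
  show ?thesis
    unfolding hasbit_iff 1 2 ..
qed

lemma new_exponent: "hasbit (2 * (t + 1 - kap t)) (a (t + 1)) \<longleftrightarrow> \<not> entry t"
proof -
  have le: "kap t \<le> t + 1"
    using kap_le[of t] K_le[of t] by (meson add_increasing2 order_trans zero_le_one)
  have q: "2 * (t + 1 - kap t) = D (t + 1) + 2"
    using D_kap[of t] unfolding emb_arith emb_diff[OF le] by simp
  define P u where "P = pw (D (t + 1))" and "u = qt (a t) (pw (D (t + 1) + 2))"
  have "a (t + 1) = u * (P * 16) + (if entry t then 0 else P * 4) + P * 2"
    unfolding a_Suc u_def P_def by (simp add: pw_add four_eq)
  then have "a (t + 1) = (2 * (2 * u) + (if entry t then 0 else 1)) * (P * 4) + P * 2"
    by (simp add: algebra_simps)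
  moreover have "P * 2 < P * 4"
    using pw_pos[of "D (t + 1)"] unfolding P_def emb_arith by simp
  ultimately have "qt (a (t + 1)) (P * 4) = 2 * (2 * u) + (if entry t then 0 else 1)"
    by (rule qt_rm_unique(1))
  then show ?thesis
    unfolding hasbit_iff q pw_add four_eq P_def[symmetric] using even_neq_odd[of "2 * u"]
    by (cases "entry t") (auto intro: exI[of _ "2 * u"])
qed

text \<open>A new guess carries its exponent unless the stage is an entry for this very number, and
  later stages preserve the digit of a kept guess. So a missing exponent always has an entry behind
  it.\<close>

lemma missing_exponent:
  assumes "y < K t" "\<not> hasbit (2 * (t - y)) (a t)"
  shows "\<exists>s<t. entry s \<and> p1 s = y"
proof -
  have "rec (\<lambda>z. entry z)"
    unfolding entry_iff by (intro rec_intro A recf_comp[OF K_rec] recf_comp[OF a_rec] K_rec a_rec)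
  note entry_rec = rec_comp[OF this]
  have "\<forall>y<K t. hasbit (2 * (t - y)) (a t) \<or> (\<exists>s<t. entry s \<and> p1 s = y)"
  proof (rule rec_induct[where n = t])
    show "rec (\<lambda>t. \<forall>y<K t. hasbit (2 * (t - y)) (a t) \<or> (\<exists>s<t. entry s \<and> p1 s = y))"
      by (intro rec_intro entry_rec recf_comp[OF K_rec] recf_comp[OF a_rec] K_rec a_rec)
    show "\<forall>y<K 0. hasbit (2 * (0 - y)) (a 0) \<or> (\<exists>s<0. entry s \<and> p1 s = y)"
      by (simp add: start)
    fix t assume IH: "\<forall>y<K t. hasbit (2 * (t - y)) (a t) \<or> (\<exists>s<t. entry s \<and> p1 s = y)"
    show "\<forall>y<K (t + 1). hasbit (2 * (t + 1 - y)) (a (t + 1)) \<or> (\<exists>s<t + 1. entry s \<and> p1 s = y)"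
    proof (intro allI impI)
      fix y assume "y < K (t + 1)"
      then consider "y = kap t" | "y < kap t"
        unfolding K_Suc less_eq_iff_succ_less[symmetric] by (auto simp: order_le_less)
      then show "hasbit (2 * (t + 1 - y)) (a (t + 1)) \<or> (\<exists>s<t + 1. entry s \<and> p1 s = y)"
      proof cases
        case 1
        show ?thesis
        proof (cases "entry t")
          case True
          then show ?thesis
            using 1 kap_eq[of t] by (intro disjI2 exI[of _ t]) simp
        qed (use 1 new_exponent[of t] in simp)
      next
        case 2
        then have "y < K t"
          using kap_le[of t] by simp
        then show ?thesis
          using IH kept_exponent[OF 2] less_add_one[of t] by (metis less_trans)
      qed
    qed
  qed
  then show ?thesis
    using assms by blast
qed

section \<open>Reading the set off a descending sequence\<close>

lemma iterate_dead:
  assumes "p < D s" "s \<le> j"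
  shows "iterate embed s p j = p"
proof (rule interval_induct[OF _ assms(2)])
  \<comment> \<open>Insertion points never decrease, so an exponent below the current one is fixed
    for good.\<close>
  show "iterate embed s p (k + 1) = p" if "s \<le> k" "iterate embed s p k = p" for k
    using that assms(1) D_mono'[of s "k + 1"]
    by (simp add: embed_iterate embed_apply add_increasing2 less_le_trans)
qed (auto intro!: rec_intro recf_iterate embed_rec simp: embed_iterate)

lemma descending_sequence_decides:
  assumes d: "recf d" "\<And>i. d i < base i" and Y: "Y \<in> SS" "\<And>m. \<exists>n\<in>Y. m < n"
    and desc: "\<And>i j. i \<in> Y \<Longrightarrow> j \<in> Y \<Longrightarrow> i < j \<Longrightarrow> d j < iterate embed i (d i) j"
  shows "rec (\<lambda>y. \<exists>w. pr w y \<in> A)"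
proof -
  \<comment> \<open>An iterate below \<open>D s\<close> is fixed from then on. It would bound all
    later values of \<open>d\<close> on \<open>Y\<close>, which are fixed as well and hence descend
    strictly as plain numbers.\<close>
  have alive: "D s \<le> iterate embed i (d i) s" if i: "i \<in> Y" "i \<le> s" for i s
  proof (rule ccontr)
    define p where "p = iterate embed i (d i) s"
    assume "\<not> D s \<le> iterate embed i (d i) s"
    then have p: "p < D s"
      unfolding p_def by simp
    have d_less: "d j < p" if "j \<in> Y" "s < j" for j
    proof -
      have "iterate embed i (d i) j = p"
        using iterate_iterate[OF embed_rec i(2), of j "d i"] iterate_dead[OF p, of j] that(2)
        unfolding p_def by simp
      then show ?thesis
        using desc[OF i(1) that(1)] i(2) that(2) by simp
    qed
    \<comment> \<open>The number of descents is counted by \<open>n\<close>; \<open>p + 1\<close> of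
      them do not fit below \<open>p\<close>.\<close>
    have "\<exists>j. j \<in> Y \<and> s < j \<and> d j + (p + 1) \<le> p"
    proof (rule rec_induct_ex[of "\<lambda>j n. j \<in> Y \<and> s < j \<and> d j + n \<le> p"])
      show "rec (\<lambda>w. p1 w \<in> Y \<and> s < p1 w \<and> d (p1 w) + p2 w \<le> p)"
        by (intro rec_intro Y(1) recf_comp[OF d(1)])
      show "\<exists>j. j \<in> Y \<and> s < j \<and> d j + 0 \<le> p"
        using Y(2)[of s] d_less by (auto intro: less_imp_le)
      fix n j assume j: "j \<in> Y \<and> s < j \<and> d j + n \<le> p"
      obtain j' where j': "j' \<in> Y" "j < j'"
        using Y(2) by blast
      have "d j < D j"
        using d_less[of j] p D_mono'[of s j] j by (meson less_imp_le less_le_trans less_trans)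
      then have "d j' < d j"
        using desc[of j j'] iterate_dead[of "d j" j j'] j j' by simp
      then have "d j' + (n + 1) \<le> p"
        using j unfolding less_iff_succ_less_eq emb_arith by linarith
      then show "\<exists>j. j \<in> Y \<and> s < j \<and> d j + (n + 1) \<le> p"
        using j j' less_trans by blast
    qed
    then obtain j where "d j + (p + 1) \<le> p"
      by blast
    then show False
      using emb_pos[of "d j"] unfolding emb_arith by linarith
  qed
  \<comment> \<open>An iterate that stays at or above every insertion point gains exactly two per
    stage; the equation is written without subtraction.\<close>
  have moved: "iterate embed i (d i) j + 2 * i = d i + 2 * j" and alive': "D (j + 1) \<le> iterate embed i (d i) j"
    if i: "i \<in> Y" "i \<le> j" for i j
  proof -
    have alive': "D (j + 1) \<le> iterate embed i (d i) j" if "i \<le> j" for j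
      using alive[OF i(1), of "j + 1"] that embed_iterate(2)[OF that, of "d i"]
      by (auto simp: embed_apply add_increasing2 not_less split: if_splits)
    show "D (j + 1) \<le> iterate embed i (d i) j"
      by (rule alive'[OF i(2)])
    show "iterate embed i (d i) j + 2 * i = d i + 2 * j"
    proof (rule interval_induct[OF _ i(2)])
      show "rec (\<lambda>j. iterate embed i (d i) j + 2 * i = d i + 2 * j)"
        by (intro rec_intro recf_iterate embed_rec)
      show "iterate embed i (d i) (j + 1) + 2 * i = d i + 2 * (j + 1)"
        if "i \<le> j" "iterate embed i (d i) j + 2 * i = d i + 2 * j" for j
      proof -
        have "iterate embed i (d i) (j + 1) = iterate embed i (d i) j + 2"
          using alive'[OF that(1)] by (simp add: embed_iterate(2)[OF that(1)] embed_apply leD)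
        then show ?thesis
          using that(2) unfolding emb_arith by simp
      qed
    qed (simp add: embed_iterate)
  qed
  \<comment> \<open>Measured relative to the stage, \<open>d\<close> strictly decreases along
    \<open>Y\<close>, so \<open>2 * i + 1 - d i\<close> grows beyond every \<open>n\<close>. The
    start is \<open>d i < base i\<close>.\<close>
  have deep: "\<exists>i. i \<in> Y \<and> d i + n \<le> 2 * i + 1" for n
  proof (rule rec_induct_ex[of "\<lambda>i n. i \<in> Y \<and> d i + n \<le> 2 * i + 1"])
    show "rec (\<lambda>w. p1 w \<in> Y \<and> d (p1 w) + p2 w \<le> 2 * p1 w + 1)"
      by (intro rec_intro Y(1) recf_comp[OF d(1)])
    obtain i where i: "i \<in> Y"
      using Y(2) by blast
    have "d i + 0 \<le> 2 * i + 1"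
      using d(2)[of i] unfolding base_def less_iff_succ_less_eq emb_arith by simp
    then show "\<exists>i. i \<in> Y \<and> d i + 0 \<le> 2 * i + 1"
      using i by blast
    fix n i assume i: "i \<in> Y \<and> d i + n \<le> 2 * i + 1"
    obtain j where j: "j \<in> Y" "i < j"
      using Y(2) by blast
    have "d j < iterate embed i (d i) j"
      using desc i j by blast
    then have "d j + (n + 1) \<le> 2 * j + 1"
      using moved[of i j] i j unfolding less_iff_succ_less_eq emb_arith by (auto simp: emb_arith)
    then show "\<exists>i. i \<in> Y \<and> d i + (n + 1) \<le> 2 * i + 1"
      using j by blast
  qed
  \<comment> \<open>Now \<open>d i\<close> lies below the exponent \<open>2 * (i - y)\<close> and
    stays at or above the insertion points, so the guess about \<open>y\<close> is never discarded
    after stage \<open>i\<close> and must be right.\<close>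
  have decide: "(\<exists>w. pr w y \<in> A) \<longleftrightarrow> \<not> hasbit (2 * (i - y)) (a i)"
    if i: "i \<in> Y" and y: "d i + 2 * y < 2 * i" for i y
  proof
    have y_K: "y < K t" if "i \<le> t" for t
      using alive[OF i that] moved[OF i that] D_K[of t] y unfolding emb_arith by linarith
    have y_kap: "y < kap t" if "i \<le> t" for t
      using alive'[OF i that] moved[OF i that] D_kap[of t] y unfolding emb_arith by linarith
    show "\<not> hasbit (2 * (i - y)) (a i)" if J: "\<exists>w. pr w y \<in> A"
    proof
      assume bit: "hasbit (2 * (i - y)) (a i)"
      obtain w where w: "pr w y \<in> A"
        using J by blast
      \<comment> \<open>At this stage \<open>y\<close> is examined, the bound \<open>w + i\<close>
        admits the witness \<open>w\<close>, and stage \<open>i\<close> has been reached.\<close>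
      define t where "t = pr y (w + i)"
      have it: "i \<le> t"
        unfolding t_def using pr_ge(2)[of "w + i" y] by (metis add_increasing mnum_zero_le order_refl order_trans)
      have "hasbit (2 * (t - y)) (a t)"
      proof (rule interval_induct[OF _ it])
        show "rec (\<lambda>t. hasbit (2 * (t - y)) (a t))"
          by (intro rec_intro a_rec)
      qed (use bit kept_exponent y_kap in auto)
      then have "entry t"
        unfolding entry_iff using y_K[OF it] w by (auto simp: t_def intro!: exI[of _ w])
      then have "kap t = y"
        unfolding kap_eq by (simp add: t_def)
      then show False
        using y_kap[OF it] by simp
    qed
    show "\<exists>w. pr w y \<in> A" if "\<not> hasbit (2 * (i - y)) (a i)"
      using missing_exponent[OF y_K[OF order_refl] that] entry_iff by blast
  qed
  have ex: "\<exists>i. i \<in> Y \<and> d i + 2 * y < 2 * i" for y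
  proof -
    obtain i where i: "i \<in> Y" "d i + (2 * y + 2) \<le> 2 * i + 1"
      using deep by blast
    from i(2) have "d i + 2 * y < 2 * i"
      unfolding emb_arith by linarith
    then show ?thesis
      using i(1) by blast
  qed
  \<comment> \<open>Every sufficiently deep \<open>i\<close> gives the same answer and such an
    \<open>i\<close> exists, so the existential and the universal form agree.\<close>
  have "rec (\<lambda>y. \<exists>i. i \<in> Y \<and> d i + 2 * y < 2 * i \<and> \<not> hasbit (2 * (i - y)) (a i))"
  proof (rule rec_delta_ex[where Q = "\<lambda>i y. i \<in> Y \<and> d i + 2 * y < 2 * i \<longrightarrow> \<not> hasbit (2 * (i - y)) (a i)"])
    show "(\<exists>i. i \<in> Y \<and> d i + 2 * y < 2 * i \<and> \<not> hasbit (2 * (i - y)) (a i)) \<longleftrightarrow>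
      (\<forall>i. i \<in> Y \<and> d i + 2 * y < 2 * i \<longrightarrow> \<not> hasbit (2 * (i - y)) (a i))" for y
      using decide[of _ y] ex[of y] by metis
  qed (intro rec_intro Y(1) recf_comp[OF d(1)] recf_comp[OF a_rec])+
  moreover have "(\<exists>i. i \<in> Y \<and> d i + 2 * y < 2 * i \<and> \<not> hasbit (2 * (i - y)) (a i)) \<longleftrightarrow> (\<exists>w. pr w y \<in> A)" for y
    using decide[of _ y] ex[of y] by metis
  ultimately show ?thesis
    by simp
qed

lemma gsystem_or_decided: "gsystem base embed \<or> rec (\<lambda>y. \<exists>w. pr w y \<in> A)"
proof -
  have "embed i n < base (i + 1)" if "n < base i" for i n
    using that unfolding embed_apply base_def emb_arith by (auto simp: emb_arith)
  moreover have "embed i n < embed i n'" if "n < n'" for i n n'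
    using that less_trans[OF that, of "n' + 2"] unfolding embed_apply by auto
  moreover have "base i \<le> base j" if "i \<le> j" for i j :: "'a mnum"
    using that unfolding base_def by (simp add: mult_left_mono)
  moreover have "0 < base (0 :: 'a mnum)"
    unfolding base_def by simp
  ultimately have "gsystem base embed \<longleftrightarrow> (\<forall>d Y. recf d \<and> (\<forall>i. d i < base i) \<and> Y \<in> SS \<and> (\<forall>m. \<exists>n\<in>Y. m < n) \<longrightarrow>
       (\<exists>i\<in>Y. \<exists>j\<in>Y. i < j \<and> iterate embed i (d i) j \<le> d j))"
    unfolding gsystem_def using base_rec[where 'a = 'a] embed_rec by simp
  then show ?thesis
    using descending_sequence_decides by (metis not_le)
qed

end

theorem goodstein_imp_jump:
  assumes "goodstein_terminates TYPE('a)"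
  shows "jump_closed TYPE('a)"
  unfolding jump_closed_def
proof
  fix A :: "'a mnum set"
  assume A: "A \<in> SS"
  then obtain K a where Ka: "recf K" "recf a" "K 0 = 0" "a 0 = 2"
    "\<And>t. pr (K (t + 1)) (a (t + 1)) = next_state A t (pr (K t) (a t))"
    using next_state_exists by blast
  note rules = A Ka
  show "rec (\<lambda>y. \<exists>w. pr w y \<in> A)"
  proof (rule ccontr)
    assume "\<not> ?thesis"
    then have sys: "gsystem base (embed K)"
      using gsystem_or_decided[OF rules] by blast
    moreover have "2 < pw (base 0 :: 'a mnum)"
      unfolding base_def by (simp add: four_eq)
    ultimately obtain G i where G: "gsequence base (embed K) 2 G" "G i = 0"
      using assms[unfolded goodstein_terminates_def, rule_format, of base "embed K" 2] by blast
    then show False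
      using gsequence_dominates[OF rules G(1) sys, of i] a_pos[OF rules, of i] by simp
  qed
qed

section \<open>Sums of distinct powers\<close>

text \<open>Follows the recursion of \<open>sum_exp2\<close>, whereas \<open>shift\<close> works on
  digits; the two lemmas below connect the descriptions.\<close>

definition psum :: "('a mnum \<Rightarrow> 'a mnum) \<Rightarrow> 'a mnum \<Rightarrow> 'a mnum" where
  "psum t = (SOME S. recf S \<and> S 0 = pw (t 0) \<and> (\<forall>j. S (j + 1) = S j + pw (t (j + 1))))"

lemma psum_spec:
  assumes t: "recf t"
  shows "recf (psum t)" "psum t 0 = pw (t 0)" "psum t (j + 1) = psum t j + pw (t (j + 1))"
proof -
  have "recf2 (\<lambda>j v. v + pw (t (j + 1)))"
    by (intro rec_intro recf_comp[OF t])
  then have "\<exists>S. recf S \<and> S 0 = pw (t 0) \<and> (\<forall>j. S (j + 1) = S j + pw (t (j + 1)))"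
    by (elim recursion[where a = "pw (t 0)"]) blast
  from someI_ex[OF this] show "recf (psum t)" "psum t 0 = pw (t 0)"
    "psum t (j + 1) = psum t j + pw (t (j + 1))"
    unfolding psum_def by blast+
qed

text \<open>Exponents descend, so the sum up to \<open>j\<close> is divisible by
  \<open>pw (s j)\<close> and the next power is smaller; \<open>shift_add\<close> then splits it
  off.\<close>

lemma shift_psum:
  assumes s: "recf s" "s 0 < b" "\<And>j j'. j < j' \<Longrightarrow> j' \<le> k \<Longrightarrow> s j' < s j" and f: "recf f"
  shows "shift f (psum s k) b = psum (\<lambda>j. f (s j)) k"
proof -
  have fs: "recf (\<lambda>j. f (s j))"
    by (rule recf_comp[OF f s(1)])
  note simps = psum_spec(2,3)[OF s(1)] psum_spec(2,3)[OF fs]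
  have "j \<le> k \<longrightarrow> s j < b \<and> pw (s j) dvd psum s j \<and> shift f (psum s j) b = psum (\<lambda>j. f (s j)) j" for j
  proof (rule rec_induct[where n = j])
    show "rec (\<lambda>j. j \<le> k \<longrightarrow> s j < b \<and> pw (s j) dvd psum s j \<and> shift f (psum s j) b = psum (\<lambda>j. f (s j)) j)"
    proof -
      \<comment> \<open>Recursiveness in the number being shifted is available only from the uniform
        version, so \<open>f\<close> is presented as a constant family.\<close>
      have "recf (\<lambda>j. shift ((\<lambda>_. f) 0) (psum s j) b)"
        using f by (intro recf_shift_uniform recf_comp[OF f] rec_intro psum_spec(1) s(1))
          (simp_all add: recf_comp[OF f recf_p2])
      then show ?thesis
        by (intro rec_intro s(1) psum_spec(1) fs) simp
    qed
    show "0 \<le> k \<longrightarrow> s 0 < b \<and> pw (s 0) dvd psum s 0 \<and> shift f (psum s 0) b = psum (\<lambda>j. f (s j)) 0"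
      using s(2) by (simp add: simps shift_pw[OF f])
    fix j
    assume IH: "j \<le> k \<longrightarrow> s j < b \<and> pw (s j) dvd psum s j \<and> shift f (psum s j) b = psum (\<lambda>j. f (s j)) j"
    show "j + 1 \<le> k \<longrightarrow> s (j + 1) < b \<and> pw (s (j + 1)) dvd psum s (j + 1) \<and>
      shift f (psum s (j + 1)) b = psum (\<lambda>j. f (s j)) (j + 1)"
    proof
      assume j: "j + 1 \<le> k"
      then have "j < k"
        by (simp add: less_iff_succ_less_eq)
      then have IH: "s j < b" "pw (s j) dvd psum s j" "shift f (psum s j) b = psum (\<lambda>j. f (s j)) j"
        using IH by auto
      have less: "s (j + 1) < s j"
        using s(3)[of j "j + 1"] j by simp
      then have "pw (s (j + 1)) dvd psum s j"
        using IH(2) pw_dvd dvd_trans less_imp_le by blast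
      moreover have "shift f (psum s (j + 1)) b = psum (\<lambda>j. f (s j)) j + pw (f (s (j + 1)))"
        unfolding simps using shift_add[OF f IH(2), of "pw (s (j + 1))" b] less IH(1,3)
        by (simp add: shift_pw[OF f])
      ultimately show "s (j + 1) < b \<and> pw (s (j + 1)) dvd psum s (j + 1) \<and>
          shift f (psum s (j + 1)) b = psum (\<lambda>j. f (s j)) (j + 1)"
        using less IH(1) by (auto simp: simps)
    qed
  qed
  then show ?thesis
    by blast
qed

text \<open>The leading power is removed repeatedly; \<open>R j\<close> is what remains after
  \<open>j\<close> removals.\<close>

lemma psum_exists:
  assumes g: "0 < g" "g < pw b"
  obtains s k where "recf s" "s 0 < b" "\<And>j j'. j < j' \<Longrightarrow> j' \<le> k \<Longrightarrow> s j' < s j" "psum s k = g"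
proof -
  have "recf2 (\<lambda>j r. r - pw (topbit r))"
    by (intro rec_intro)
  then obtain R where R: "recf R" "R 0 = g" "\<And>j. R (j + 1) = R j - pw (topbit (R j))"
    using recursion[where a = g and h = "\<lambda>j r. r - pw (topbit r)"] by blast
  define s where "s j = topbit (R j)" for j
  have s: "recf s"
    unfolding s_def by (intro rec_intro R(1))
  have split: "R j = pw (s j) + R (j + 1)" "R (j + 1) < pw (s j)" if "0 < R j" for j
    using topbit_split[OF that] by (simp_all add: s_def R(3))
  \<comment> \<open>Each removal takes away at least 1, so nothing is left after
    \<open>g + 1\<close> steps.\<close>
  have "R (g + 1) = 0 \<or> R (g + 1) + (g + 1) \<le> g"
  proof (rule rec_induct[where n = "g + 1"])
    show "rec (\<lambda>j. R j = 0 \<or> R j + j \<le> g)"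
      by (intro rec_intro R(1))
    show "R (j + 1) = 0 \<or> R (j + 1) + (j + 1) \<le> g" if "R j = 0 \<or> R j + j \<le> g" for j
    proof (cases "R j = 0")
      case True
      then show ?thesis
        by (simp add: R(3) mnum_minus_eq_zero)
    next
      case False
      then have "R j = pw (s j) + R (j + 1)"
        using split(1) by (simp add: mnum_neq_zero(1))
      then show ?thesis
        using that False one_le_pw[of "s j"] unfolding emb_arith by (auto simp: emb_arith)
    qed
  qed (simp add: R)
  then have "R (g + 1) = 0"
    using emb_pos[of "R (g + 1)"] unfolding emb_arith by auto
  moreover have "rec (\<lambda>j. R j = 0)"
    by (intro rec_intro R(1))
  ultimately obtain l where l: "R l = 0" "\<And>j. j < l \<Longrightarrow> R j \<noteq> 0"
    using rec_least by blast
  then obtain k where k: "l = k + 1"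
    using g(1) R(2) by (cases l rule: mnum_zero_or_succ) auto
  have pos: "0 < R j" if "j \<le> k" for j
    using l(2)[of j] that unfolding k less_eq_iff_succ_less by (simp add: mnum_neq_zero(1))
  have s_Suc: "s (j + 1) < s j" if "j + 1 \<le> k" for j
    using topbit_less_iff[OF pos[OF that]] split(2)[of j] pos[of j] that
    unfolding s_def by (auto simp: less_iff_succ_less_eq[symmetric])
  have desc: "s j' < s j" if "j < j'" "j' \<le> k" for j j'
  proof -
    have "j + 1 \<le> j'"
      using that(1) by (simp add: less_iff_succ_less_eq)
    then have "j' \<le> k \<longrightarrow> s j' < s j"
    proof (rule interval_induct[rotated])
      show "rec (\<lambda>j'. j' \<le> k \<longrightarrow> s j' < s j)"
        by (intro rec_intro s)
      show "j + 1 \<le> k \<longrightarrow> s (j + 1) < s j"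
        using s_Suc by blast
      show "i + 1 \<le> k \<longrightarrow> s (i + 1) < s j" if "i \<le> k \<longrightarrow> s i < s j" for i
        using that s_Suc[of i] by (auto simp: less_iff_succ_less_eq[symmetric] dest: less_trans)
    qed
    then show ?thesis
      using that(2) by blast
  qed
  have "k \<le> k \<longrightarrow> psum s k + R (k + 1) = g"
  proof (rule rec_induct[where n = k and P = "\<lambda>j. j \<le> k \<longrightarrow> psum s j + R (j + 1) = g"])
    show "rec (\<lambda>j. j \<le> k \<longrightarrow> psum s j + R (j + 1) = g)"
      by (intro rec_intro recf_comp[OF R(1)] psum_spec(1) s)
    show "0 \<le> k \<longrightarrow> psum s 0 + R (0 + 1) = g"
      using split(1)[of 0] pos[of 0] by (simp add: psum_spec(2)[OF s] R(2))
    show "j + 1 \<le> k \<longrightarrow> psum s (j + 1) + R (j + 1 + 1) = g" if "j \<le> k \<longrightarrow> psum s j + R (j + 1) = g" for j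
      using that split(1)[OF pos, of "j + 1"]
      by (auto simp: psum_spec(3)[OF s] less_iff_succ_less_eq[symmetric] add.assoc)
  qed
  then have "psum s k = g"
    using l(1) unfolding k by simp
  moreover have "s 0 < b"
    using topbit_less_iff[of g b] g unfolding s_def R(2) by blast
  ultimately show ?thesis
    using that s desc by blast
qed

section \<open>Translation into the type of numbers\<close>

context
  fixes M :: "'a l2_structure" and \<phi> :: "'a \<Rightarrow> 'a mnum"
  assumes bij: "bij \<phi>" and transport: "num_model = transport \<phi> M"
begin

abbreviation \<psi> :: "'a mnum \<Rightarrow> 'a" where
  "\<psi> \<equiv> inv \<phi>"

lemma \<phi>_hom:
  "\<phi> (zero M) = 0" "\<phi> (one M) = 1" "\<phi> (add M x y) = \<phi> x + \<phi> y" "\<phi> (mul M x y) = \<phi> x * \<phi> y"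
  using transport_sel[OF bij, of M, folded transport] by simp_all

lemma \<phi>_inject: "\<phi> x = \<phi> y \<longleftrightarrow> x = y"
  using bij by (auto simp: bij_def inj_eq)

lemma less_\<phi>: "less M x y \<longleftrightarrow> \<phi> x < \<phi> y"
  using transport_sel(5)[OF bij, of M, folded transport] by simp

lemma leq_\<phi>: "leq M x y \<longleftrightarrow> \<phi> x \<le> \<phi> y"
  by (auto simp: leq_def less_\<phi> order_le_less \<phi>_inject)

lemma pair_\<phi>: "\<phi> (pair M x y) = pr (\<phi> x) (\<phi> y)"
  by (simp add: pair_def pr_def \<phi>_hom)

lemma \<psi>_\<phi> [simp]: "\<psi> (\<phi> x) = x" "\<phi> (\<psi> z) = z"
  using inv_transport[OF bij] by auto

lemma sets_\<phi>: "A \<in> sets M \<longleftrightarrow> \<phi> ` A \<in> SS"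
  unfolding transport transport_sel[OF bij] by (metis bij bij_is_inj image_iff inj_image_eq_iff)

lemma mem_\<phi>: "\<phi> x \<in> \<phi> ` A \<longleftrightarrow> x \<in> A"
  by (rule inj_image_mem_iff[OF bij_is_inj[OF bij]])

lemma rec_imp_set:
  assumes "rec P"
  shows "{x. P (\<phi> x)} \<in> sets M"
proof -
  have "\<phi> ` {x. P (\<phi> x)} = Collect P"
    by (auto simp: image_iff) (metis \<psi>_\<phi>(2))
  then show ?thesis
    using assms unfolding sets_\<phi> rec_def by simp
qed

lemma set_imp_rec:
  assumes "A \<in> sets M"
  shows "rec (\<lambda>z. \<psi> z \<in> A)"
proof -
  have "\<phi> ` A = {z. \<psi> z \<in> A}"
    by (auto simp: image_iff) (metis \<psi>_\<phi>(2))
  then show ?thesis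
    using assms unfolding sets_\<phi> rec_def by simp
qed

lemma sat_\<phi>: "sat M e E p \<longleftrightarrow> sat num_model (\<lambda>i. \<phi> (e i)) (\<lambda>X. \<phi> ` E X) p"
  unfolding transport sat_transport[OF bij] ..

text \<open>Each number quantifier costs one jump. Variables are assigned recursive functions of
  \<open>z\<close>, so that a quantified variable can become a projection of an enlarged
  argument.\<close>

lemma arithmetical_rec:
  fixes E :: "nat \<Rightarrow> 'a mnum set"
  assumes jump: "jump_closed TYPE('a)" and E: "\<And>X. E X \<in> SS"
  shows "arithmetical p \<Longrightarrow> (\<And>i. recf (g i)) \<Longrightarrow> rec (\<lambda>z. sat num_model (\<lambda>i. g i z) E p)"
proof (induction p arbitrary: g)
  have tval_rec: "recf (\<lambda>z. tval num_model (\<lambda>i. g i z) t)" if "\<And>i. recf (g i)" for g t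
    using that by (induction t) (auto intro!: rec_intro)
  {
    case (Eq s t)
    then show ?case
      by (auto intro!: rec_eq tval_rec)
  next
    case (Less s t)
    then show ?case
      by (auto intro!: rec_less tval_rec)
  next
    case (Mem t X)
    then show ?case
      by (auto intro!: rec_mem E tval_rec)
  }
  have upd: "rec (\<lambda>z. \<exists>y. sat num_model ((\<lambda>i. g i z)(x := y)) E p)"
    if IH: "\<And>g. (\<And>i. recf (g i)) \<Longrightarrow> rec (\<lambda>z. sat num_model (\<lambda>i. g i z) E p)" and g: "\<And>i. recf (g i)" for g x p
  proof (rule rec_ex_jump[OF jump])
    define g' where "g' i = (if i = x then p1 else (\<lambda>w. g i (p2 w)))" for i
    have "recf (g' i)" for i
      unfolding g'_def using g recf_comp[OF g recf_p2] recf_p1[where 'a = 'a] by simp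
    from IH[of g', OF this] have "rec (\<lambda>w. sat num_model (\<lambda>i. g' i w) E p)" .
    moreover have "(\<lambda>i. g' i w) = (\<lambda>i. g i (p2 w))(x := p1 w)" for w
      by (auto simp: g'_def)
    ultimately show "rec (\<lambda>w. sat num_model ((\<lambda>i. g i (p2 w))(x := p1 w)) E p)"
      by simp
  qed
  {
    case (ExN x p)
    then show ?case
      using upd[of p g x] by simp
  next
    case (AllN x p)
    then have "rec (\<lambda>z. \<exists>y. sat num_model ((\<lambda>i. g i z)(x := y)) E (Neg p))"
      by (intro upd) (auto intro: rec_not)
    from rec_not[OF this] show ?case
      by simp
  }
qed (auto intro: rec_not rec_conj rec_disj rec_imp rec_iff)

lemma arithmetical_comprehension_iff: "arithmetical_comprehension M \<longleftrightarrow> jump_closed TYPE('a)"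
proof
  assume AC: "arithmetical_comprehension M"
  show "jump_closed TYPE('a)"
    unfolding jump_closed_def
  proof
    fix A :: "'a mnum set" assume "A \<in> SS"
    then have "\<psi> ` A \<in> sets M"
      unfolding sets_\<phi> by (simp add: image_image)
    then have "assignment M (\<lambda>_. \<psi> ` A)"
      unfolding assignment_def by simp
    then obtain B where B: "B \<in> sets M"
      "\<And>n. n \<in> B \<longleftrightarrow> sat M ((\<lambda>_. zero M)(0 := n)) (\<lambda>_. \<psi> ` A) (ExN 1 (Mem (pairt (Var 1) (Var 0)) 0))"
      using AC unfolding arithmetical_comprehension_def by (metis arithmetical.simps(3,10))
    have "(\<psi> z \<in> B) \<longleftrightarrow> (\<exists>y. pr y z \<in> A)" for z
      unfolding B(2) sat_\<phi> by (simp add: image_image)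
    then show "rec (\<lambda>x. \<exists>y. pr y x \<in> A)"
      using set_imp_rec[OF B(1)] by simp
  qed
next
  assume jump: "jump_closed TYPE('a)"
  show "arithmetical_comprehension M"
    unfolding arithmetical_comprehension_def
  proof (intro allI impI)
    fix p x and e :: "nat \<Rightarrow> 'a" and E :: "nat \<Rightarrow> 'a set"
    assume p: "arithmetical p" "assignment M E"
    have "rec (\<lambda>z. sat num_model (\<lambda>i. (if i = x then (\<lambda>z. z) else (\<lambda>_. \<phi> (e i))) z) (\<lambda>X. \<phi> ` E X) p)"
      using p by (intro arithmetical_rec[OF jump]) (auto simp: assignment_def sets_\<phi> recf_id recf_const)
    from rec_imp_set[OF this] have "{n. sat M (e(x := n)) E p} \<in> sets M"
      unfolding sat_\<phi> by (simp add: fun_upd_def if_distrib[of \<phi>] if_distrib[of "\<lambda>f. f _"] cong: if_cong)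
    then show "\<exists>A\<in>sets M. \<forall>n. n \<in> A \<longleftrightarrow> sat M (e(x := n)) E p"
      by (rule bexI[rotated]) (simp only: mem_Collect_eq simp_thms)
  qed
qed

section \<open>Functions and recursion of the structure\<close>

lemma app_iff:
  assumes "is_fun M C F" "x \<in> C"
  shows "pair M x y \<in> F \<longleftrightarrow> y = app M F x"
proof -
  have "\<exists>!y. pair M x y \<in> F"
    using assms unfolding is_fun_def by blast
  from theI'[OF this] this show ?thesis
    unfolding app_def by blast
qed

lemma fun_imp_recf:
  assumes F: "is_fun M UNIV F"
  shows "recf (\<lambda>z. \<phi> (app M F (\<psi> z)))"
proof (rule recfI[of "\<lambda>x y. pr x y \<in> \<phi> ` F"])
  show "rec (\<lambda>w. pr (p1 w) (p2 w) \<in> \<phi> ` F)"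
    using F by (intro rec_intro) (auto simp: is_fun_def sets_\<phi>)
  show "pr x y \<in> \<phi> ` F \<longleftrightarrow> y = \<phi> (app M F (\<psi> x))" for x y
  proof -
    have "pr x y \<in> \<phi> ` F \<longleftrightarrow> pair M (\<psi> x) (\<psi> y) \<in> F"
      using mem_\<phi>[of "pair M (\<psi> x) (\<psi> y)" F] by (simp add: pair_\<phi>)
    then show ?thesis
      using app_iff[OF F, of "\<psi> x" "\<psi> y"] by (metis UNIV_I \<psi>_\<phi>)
  qed
qed

lemma graph_fun:
  assumes R: "rec (\<lambda>w. R (p1 w) (p2 w))" and C: "\<And>x. x \<in> C \<Longrightarrow> R (\<phi> x) (f x)"
    "\<And>x y. R (\<phi> x) y \<Longrightarrow> x \<in> C \<and> y = f x"
  shows "\<exists>F. is_fun M C F \<and> (\<forall>x\<in>C. \<phi> (app M F x) = f x)"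
proof -
  define F where "F = {z. \<phi> z = pr (p1 (\<phi> z)) (p2 (\<phi> z)) \<and> R (p1 (\<phi> z)) (p2 (\<phi> z))}"
  have pair: "pair M x y \<in> F \<longleftrightarrow> x \<in> C \<and> \<phi> y = f x" for x y
    unfolding F_def using C by (auto simp: pair_\<phi>)
  have "F \<in> sets M"
    unfolding F_def by (rule rec_imp_set) (intro rec_conj rec_eq rec_intro R)
  moreover have "\<exists>x\<in>C. \<exists>y. z = pair M x y" if z: "z \<in> F" for z
  proof -
    have "\<phi> z = \<phi> (pair M (\<psi> (p1 (\<phi> z))) (\<psi> (p2 (\<phi> z))))"
      using z unfolding F_def by (simp add: pair_\<phi>)
    then have "z = pair M (\<psi> (p1 (\<phi> z))) (\<psi> (p2 (\<phi> z)))"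
      by (simp only: \<phi>_inject)
    then show ?thesis
      using z pair by metis
  qed
  moreover have "\<exists>!y. pair M x y \<in> F" if "x \<in> C" for x
    using that pair by (intro ex1I[of _ "\<psi> (f x)"]) (auto simp: \<phi>_inject[symmetric])
  ultimately have F: "is_fun M C F"
    unfolding is_fun_def by blast
  have "\<phi> (app M F x) = f x" if "x \<in> C" for x
    using app_iff[OF F that, of "app M F x"] pair by blast
  then show ?thesis
    using F by blast
qed

lemma recf_imp_fun:
  assumes "recf f"
  obtains F where "is_fun M UNIV F" "\<And>x. \<phi> (app M F x) = f (\<phi> x)"
proof -
  have "rec (\<lambda>w. p2 w = f (p1 w))"
    by (intro rec_intro recf_comp[OF assms])
  then show ?thesis
    using graph_fun[of "\<lambda>x y. y = f x" UNIV "\<lambda>x. f (\<phi> x)"] that by auto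
qed

text \<open>The description in \<open>iter\<close> is unique because any competing solution agrees
  with \<open>H\<close> on the interval by induction. Only these two functions occur in the
  induction predicate, so \<open>h\<close> may be arbitrary.\<close>

lemma iter_eq:
  assumes H: "recf H" "H (\<phi> i) = \<phi> a" and ij: "\<phi> i \<le> \<phi> j"
    and step: "\<And>k. \<phi> i \<le> k \<Longrightarrow> k < \<phi> j \<Longrightarrow> H (k + 1) = \<phi> (h (\<psi> k) (\<psi> (H k)))"
  shows "\<phi> (iter M i a h j) = H (\<phi> j)"
proof -
  obtain F where F: "is_fun M UNIV F" "\<And>x. \<phi> (app M F x) = H (\<phi> x)"
    using recf_imp_fun[OF H(1)] by blast
  have app: "app M F x = \<psi> (H (\<phi> x))" for x
    by (simp flip: F(2))
  have "iter M i a h j = \<psi> (H (\<phi> j))"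
    unfolding iter_def
  proof (rule the_equality)
    have "app M F (add M k (one M)) = h k (app M F k)" if "leq M i k \<and> less M k j" for k
      using step[of "\<phi> k"] that by (simp add: app leq_\<phi> less_\<phi> \<phi>_hom)
    moreover have "app M F i = a"
      by (simp add: app H(2))
    ultimately show "\<exists>F. is_fun M UNIV F \<and> app M F i = a \<and>
        (\<forall>k. leq M i k \<and> less M k j \<longrightarrow> app M F (add M k (one M)) = h k (app M F k)) \<and> app M F j = \<psi> (H (\<phi> j))"
      using F(1) app by blast
  next
    fix v
    assume "\<exists>F. is_fun M UNIV F \<and> app M F i = a \<and>
        (\<forall>k. leq M i k \<and> less M k j \<longrightarrow> app M F (add M k (one M)) = h k (app M F k)) \<and> app M F j = v"
    then obtain F' where F': "is_fun M UNIV F'" "app M F' i = a" "app M F' j = v"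
      "\<And>k. leq M i k \<Longrightarrow> less M k j \<Longrightarrow> app M F' (add M k (one M)) = h k (app M F' k)"
      by blast
    define f where "f z = \<phi> (app M F' (\<psi> z))" for z
    have f: "recf f"
      unfolding f_def by (rule fun_imp_recf[OF F'(1)])
    have "\<phi> j \<le> \<phi> j \<longrightarrow> f (\<phi> j) = H (\<phi> j)"
    proof (rule interval_induct[OF _ ij, of "\<lambda>k. k \<le> \<phi> j \<longrightarrow> f k = H k"])
      show "rec (\<lambda>k. k \<le> \<phi> j \<longrightarrow> f k = H k)"
        by (intro rec_intro f H(1))
      show "\<phi> i \<le> \<phi> j \<longrightarrow> f (\<phi> i) = H (\<phi> i)"
        by (simp add: f_def F'(2) H(2))
      show "k + 1 \<le> \<phi> j \<longrightarrow> f (k + 1) = H (k + 1)" if k: "\<phi> i \<le> k" "k \<le> \<phi> j \<longrightarrow> f k = H k" for k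
      proof
        assume "k + 1 \<le> \<phi> j"
        then have kj: "k < \<phi> j"
          by (simp add: less_iff_succ_less_eq)
        have "k + 1 = \<phi> (add M (\<psi> k) (one M))"
          by (simp add: \<phi>_hom)
        then have "f (k + 1) = \<phi> (h (\<psi> k) (\<psi> (f k)))"
          unfolding f_def using F'(4)[of "\<psi> k"] k(1) kj by (simp add: leq_\<phi> less_\<phi>)
        then show "f (k + 1) = H (k + 1)"
          using step[OF k(1) kj] k(2) kj by simp
      qed
    qed
    then show "v = \<psi> (H (\<phi> j))"
      using F'(3) unfolding f_def by (metis \<psi>_\<phi> order_refl)
  qed
  then show ?thesis
    by simp
qed

lemma exp2_eq: "\<phi> (exp2 M n) = pw (\<phi> n)"
  unfolding exp2_def
proof (rule iter_eq)
  show "recf pw"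
    using recf_pw[OF recf_id] .
qed (simp_all add: \<phi>_hom pw_Suc)

text \<open>Agreement is asked only up to \<open>k\<close>, as later exponents may leave the domain
  of the family, where \<open>fam\<close> has no specified value.\<close>

lemma sum_exp2_eq:
  assumes t: "recf t" "\<And>j. leq M j k \<Longrightarrow> \<phi> (f j) = t (\<phi> j)"
  shows "\<phi> (sum_exp2 M f k) = psum t (\<phi> k)"
  unfolding sum_exp2_def
proof (rule iter_eq)
  show "recf (psum t)"
    by (rule psum_spec(1)[OF t(1)])
  show "psum t (\<phi> (zero M)) = \<phi> (exp2 M (f (zero M)))"
    using t(2)[of "zero M"] by (simp add: \<phi>_hom psum_spec(2)[OF t(1)] exp2_eq leq_\<phi>)
  show "psum t (j + 1) = \<phi> (add M (\<psi> (psum t j)) (exp2 M (f (add M (\<psi> j) (one M)))))"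
    if "j < \<phi> k" for j
    using t(2)[of "add M (\<psi> j) (one M)"] that
    by (simp add: \<phi>_hom psum_spec(3)[OF t(1)] exp2_eq leq_\<phi> less_iff_succ_less_eq)
qed (simp add: \<phi>_hom)

definition family_dom :: "'a set \<Rightarrow> 'a set" where
  "family_dom B = {pair M i n | i n. less M n (app M B i)}"

text \<open>Links a system given by sets of the structure with total functions on numbers;
  \<open>c\<close> is tied to \<open>F\<close> only on the domain of the latter.\<close>

definition codes :: "'a set \<Rightarrow> 'a set \<Rightarrow> ('a mnum \<Rightarrow> 'a mnum) \<Rightarrow> ('a mnum \<Rightarrow> 'a mnum \<Rightarrow> 'a mnum) \<Rightarrow> bool" where
  "codes B F b c \<longleftrightarrow> is_fun M UNIV B \<and> is_fun M (family_dom B) F \<and> recf b \<and> recf2 c \<and>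
     (\<forall>i. \<phi> (app M B i) = b (\<phi> i)) \<and> (\<forall>i n. \<phi> n < b (\<phi> i) \<longrightarrow> \<phi> (fam M F i n) = c (\<phi> i) (\<phi> n))"

lemma code_exists_sets:
  assumes b: "recf b" and c: "recf2 c"
  obtains B F where "codes B F b c"
proof -
  obtain B where B: "is_fun M UNIV B" "\<And>i. \<phi> (app M B i) = b (\<phi> i)"
    using recf_imp_fun[OF b] by blast
  define R where "R x y \<longleftrightarrow> x = pr (p1 x) (p2 x) \<and> p2 x < b (p1 x) \<and> y = c (p1 x) (p2 x)" for x y
  have "rec (\<lambda>w. R (p1 w) (p2 w))"
    unfolding R_def by (intro rec_intro recf_comp[OF b] recf2_comp[OF c])
  moreover have "R (\<phi> x) (c (p1 (\<phi> x)) (p2 (\<phi> x)))" if "x \<in> family_dom B" for x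
    using that unfolding family_dom_def R_def by (auto simp: pair_\<phi> less_\<phi> B(2))
  moreover have "x \<in> family_dom B \<and> y = c (p1 (\<phi> x)) (p2 (\<phi> x))" if "R (\<phi> x) y" for x y
  proof -
    have "\<phi> x = \<phi> (pair M (\<psi> (p1 (\<phi> x))) (\<psi> (p2 (\<phi> x))))"
      using that unfolding R_def by (simp add: pair_\<phi>)
    then have "x = pair M (\<psi> (p1 (\<phi> x))) (\<psi> (p2 (\<phi> x)))"
      by (simp only: \<phi>_inject)
    moreover have "less M (\<psi> (p2 (\<phi> x))) (app M B (\<psi> (p1 (\<phi> x))))"
      using that unfolding R_def by (simp add: less_\<phi> B(2))
    ultimately show ?thesis
      using that unfolding family_dom_def R_def by blast
  qed
  ultimately obtain F where F: "is_fun M (family_dom B) F"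
    "\<And>x. x \<in> family_dom B \<Longrightarrow> \<phi> (app M F x) = c (p1 (\<phi> x)) (p2 (\<phi> x))"
    using graph_fun[of R "family_dom B" "\<lambda>x. c (p1 (\<phi> x)) (p2 (\<phi> x))"] by blast
  have "\<phi> (fam M F i n) = c (\<phi> i) (\<phi> n)" if "\<phi> n < b (\<phi> i)" for i n
  proof -
    have "pair M i n \<in> family_dom B"
      using that unfolding family_dom_def by (auto simp: less_\<phi> B(2))
    from F(2)[OF this] show ?thesis
      by (simp add: fam_def pair_\<phi>)
  qed
  then have "codes B F b c"
    unfolding codes_def using B F(1) b c by blast
  then show ?thesis
    using that by blast
qed

lemma code_exists_functions:
  assumes B: "is_fun M UNIV B" and F: "is_fun M (family_dom B) F"
  obtains b c where "codes B F b c"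
proof -
  define b where "b z = \<phi> (app M B (\<psi> z))" for z
  \<comment> \<open>The default 0 makes the family total and keeps it recursive, as
    \<open>n < b i\<close> is decidable.\<close>
  define c where "c i n = (if n < b i then \<phi> (fam M F (\<psi> i) (\<psi> n)) else 0)" for i n
  have b: "recf b"
    unfolding b_def by (rule fun_imp_recf[OF B])
  have F_SS: "\<phi> ` F \<in> SS"
    using F by (simp add: is_fun_def sets_\<phi>)
  have "recf2 c"
  proof (rule recfI[of "\<lambda>x y. p2 x < b (p1 x) \<and> pr (pr (p1 x) (p2 x)) y \<in> \<phi> ` F \<or> \<not> p2 x < b (p1 x) \<and> y = 0"])
    show "(p2 x < b (p1 x) \<and> pr (pr (p1 x) (p2 x)) y \<in> \<phi> ` F \<or> \<not> p2 x < b (p1 x) \<and> y = 0) \<longleftrightarrow>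
      y = c (p1 x) (p2 x)" for x y
    proof (cases "p2 x < b (p1 x)")
      case True
      let ?i = "\<psi> (p1 x)" and ?n = "\<psi> (p2 x)"
      have "pair M ?i ?n \<in> family_dom B"
      proof -
        have "\<phi> ?n < \<phi> (app M B ?i)"
          using True unfolding b_def by simp
        then show ?thesis
          unfolding family_dom_def less_\<phi> by blast
      qed
      from app_iff[OF F this, of "\<psi> y"] have "pair M (pair M ?i ?n) (\<psi> y) \<in> F \<longleftrightarrow> y = \<phi> (fam M F ?i ?n)"
        unfolding fam_def by (metis \<psi>_\<phi>)
      then show ?thesis
        using True mem_\<phi>[of "pair M (pair M ?i ?n) (\<psi> y)" F] unfolding c_def by (simp add: pair_\<phi>)
    qed (simp add: c_def)
  qed (intro rec_intro F_SS recf_comp[OF b])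
  then have "codes B F b c"
    unfolding codes_def using b B F by (simp add: b_def c_def)
  then show ?thesis
    using that by blast
qed

section \<open>Systems and single steps under a coding\<close>

context
  fixes B F b c
  assumes codes: "codes B F b c"
begin

lemma code_facts:
  "is_fun M UNIV B" "is_fun M (family_dom B) F" "recf b" "recf2 c" "\<phi> (app M B i) = b (\<phi> i)"
  "\<phi> n < b (\<phi> i) \<Longrightarrow> \<phi> (fam M F i n) = c (\<phi> i) (\<phi> n)"
  using codes unfolding codes_def by blast+

lemma fam_comp_eq:
  assumes c: "\<And>i n. n < b i \<Longrightarrow> c i n < b (i + 1)" and n: "\<phi> n < b (\<phi> i)" and ij: "\<phi> i \<le> \<phi> j"
  shows "\<phi> (fam_comp M F i j n) = iterate c (\<phi> i) (\<phi> n) (\<phi> j)"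
  unfolding fam_comp_def
proof (rule iter_eq[OF _ _ ij])
  note rules = iterate_self[OF code_facts(4)] iterate_Suc[OF code_facts(4)]
  have less: "iterate c (\<phi> i) (\<phi> n) k < b k" if "\<phi> i \<le> k" for k
  proof (rule interval_induct[OF _ that])
    show "rec (\<lambda>k. iterate c (\<phi> i) (\<phi> n) k < b k)"
      by (intro rec_intro recf_iterate code_facts)
  qed (use n c in \<open>auto simp: rules\<close>)
  show "recf (iterate c (\<phi> i) (\<phi> n))"
    using recf_iterate[OF code_facts(4) recf_id] .
  show "iterate c (\<phi> i) (\<phi> n) (\<phi> i) = \<phi> n"
    by (simp add: rules)
  show "iterate c (\<phi> i) (\<phi> n) (k + 1) = \<phi> (fam M F (\<psi> k) (\<psi> (iterate c (\<phi> i) (\<phi> n) k)))"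
    if "\<phi> i \<le> k" for k
    using code_facts(6)[of "\<psi> (iterate c (\<phi> i) (\<phi> n) k)" "\<psi> k"] less[OF that] that by (simp add: rules)
qed

lemma goodstein_system_iff: "goodstein_system M B F \<longleftrightarrow> gsystem b c"
proof -
  have all: "(\<forall>z. P z) \<longleftrightarrow> (\<forall>x. P (\<phi> x))" for P
    by (rule transport_all[OF bij])
  have mono: "(\<forall>i j. leq M i j \<longrightarrow> leq M (app M B i) (app M B j)) \<longleftrightarrow> (\<forall>i j. i \<le> j \<longrightarrow> b i \<le> b j)"
    by (simp add: all leq_\<phi> code_facts(5))
  have zero: "less M (zero M) (app M B (zero M)) \<longleftrightarrow> 0 < b 0"
    by (simp add: less_\<phi> \<phi>_hom code_facts(5))
  have range: "(\<forall>i n. less M n (app M B i) \<longrightarrow> less M (fam M F i n) (app M B (add M i (one M)))) \<longleftrightarrow>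
    (\<forall>i n. n < b i \<longrightarrow> c i n < b (i + 1))"
    by (simp add: all less_\<phi> \<phi>_hom code_facts(5,6))
  have strict: "(\<forall>i n n'. less M n n' \<and> less M n' (app M B i) \<longrightarrow> less M (fam M F i n) (fam M F i n')) \<longleftrightarrow>
    (\<forall>i n n'. n < n' \<and> n' < b i \<longrightarrow> c i n < c i n')"
  proof -
    have "(\<phi> n < \<phi> n' \<and> \<phi> n' < b (\<phi> i) \<longrightarrow> \<phi> (fam M F i n) < \<phi> (fam M F i n')) \<longleftrightarrow>
      (\<phi> n < \<phi> n' \<and> \<phi> n' < b (\<phi> i) \<longrightarrow> c (\<phi> i) (\<phi> n) < c (\<phi> i) (\<phi> n'))" for i n n'
      using code_facts(6)[of n i] code_facts(6)[of n' i] less_trans[of "\<phi> n" "\<phi> n'" "b (\<phi> i)"] by auto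
    then show ?thesis
      by (simp only: all less_\<phi> code_facts(5))
  qed
  \<comment> \<open>Iterates correspond only if they stay in the domains, so this clause is
    translated under the range condition. Where that condition fails, both notions of a system
    fail.\<close>
  have main: "(\<forall>d Y. is_fun M UNIV d \<and> (\<forall>i. less M (app M d i) (app M B i)) \<and> Y \<in> sets M \<and>
        (\<forall>m. \<exists>n\<in>Y. less M m n) \<longrightarrow>
        (\<exists>i\<in>Y. \<exists>j\<in>Y. less M i j \<and> leq M (fam_comp M F i j (app M d i)) (app M d j))) \<longleftrightarrow>
    (\<forall>d Y. recf d \<and> (\<forall>i. d i < b i) \<and> Y \<in> SS \<and> (\<forall>m. \<exists>n\<in>Y. m < n) \<longrightarrow>
       (\<exists>i\<in>Y. \<exists>j\<in>Y. i < j \<and> iterate c i (d i) j \<le> d j))"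
    (is "?L \<longleftrightarrow> ?R") if c: "\<forall>i n. n < b i \<longrightarrow> c i n < b (i + 1)"
  proof
    assume L: ?L
    show ?R
    proof (intro allI impI, elim conjE)
      fix d and Y :: "'a mnum set"
      assume d: "recf d" "\<forall>i. d i < b i" and Y: "Y \<in> SS" "\<forall>m. \<exists>n\<in>Y. m < n"
      obtain d' where d': "is_fun M UNIV d'" "\<And>x. \<phi> (app M d' x) = d (\<phi> x)"
        using recf_imp_fun[OF d(1)] by blast
      have less: "less M (app M d' i) (app M B i)" for i
        using d(2) by (simp add: less_\<phi> d'(2) code_facts(5))
      have Y': "\<psi> ` Y \<in> sets M"
        using Y(1) unfolding sets_\<phi> by (simp add: image_image)
      have "\<forall>m. \<exists>n\<in>\<psi> ` Y. less M m n"
        using Y(2) by (simp add: less_\<phi>)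
      then obtain i j where ij: "i \<in> Y" "j \<in> Y" "less M (\<psi> i) (\<psi> j)"
        "leq M (fam_comp M F (\<psi> i) (\<psi> j) (app M d' (\<psi> i))) (app M d' (\<psi> j))"
        using L[rule_format, of d' "\<psi> ` Y"] d'(1) less Y' by blast
      have "i < j"
        using ij(3) by (simp add: less_\<phi>)
      moreover have "iterate c i (d i) j \<le> d j"
        using ij(4) fam_comp_eq[of "app M d' (\<psi> i)" "\<psi> i" "\<psi> j"] c d(2) \<open>i < j\<close> by (simp add: leq_\<phi> d'(2))
      ultimately show "\<exists>i\<in>Y. \<exists>j\<in>Y. i < j \<and> iterate c i (d i) j \<le> d j"
        using ij(1,2) by blast
    qed
  next
    assume R: ?R
    show ?L
    proof (intro allI impI, elim conjE)
      fix d Y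
      assume d: "is_fun M UNIV d" "\<forall>i. less M (app M d i) (app M B i)"
        and Y: "Y \<in> sets M" "\<forall>m. \<exists>n\<in>Y. less M m n"
      define d' where "d' z = \<phi> (app M d (\<psi> z))" for z
      have d': "recf d'"
        unfolding d'_def by (rule fun_imp_recf[OF d(1)])
      have less: "d' i < b i" for i
        using d(2)[rule_format, of "\<psi> i"] by (simp add: less_\<phi> d'_def code_facts(5))
      have Y': "\<phi> ` Y \<in> SS"
        using Y(1) unfolding sets_\<phi> .
      have "\<forall>m. \<exists>n\<in>\<phi> ` Y. m < n"
        using Y(2) by (simp add: all less_\<phi>)
      then obtain i j where ij: "i \<in> Y" "j \<in> Y" "\<phi> i < \<phi> j"
        "iterate c (\<phi> i) (d' (\<phi> i)) (\<phi> j) \<le> d' (\<phi> j)"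
        using R[rule_format, of d' "\<phi> ` Y"] d' less Y' by blast
      have "leq M (fam_comp M F i j (app M d i)) (app M d j)"
        using ij(3,4) fam_comp_eq[of "app M d i" i j] c less[of "\<phi> i"] by (simp add: leq_\<phi> d'_def)
      then show "\<exists>i\<in>Y. \<exists>j\<in>Y. less M i j \<and> leq M (fam_comp M F i j (app M d i)) (app M d j)"
        using ij by (auto simp: less_\<phi>)
    qed
  qed
  show ?thesis
    unfolding goodstein_system_def gsystem_def mono zero range strict family_dom_def[symmetric]
  proof (cases "\<forall>i n. n < b i \<longrightarrow> c i n < b (i + 1)", goal_cases)
    case 1
    then show ?case
      by (simp only: main code_facts(1-4) simp_thms)
  next
    case 2
    then show ?case
      by (simp only: simp_thms)
  qed
qed

lemma goodstein_step_imp: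
  assumes "goodstein_step M B F i g g'"
  shows "if \<phi> g = 0 then \<phi> g' = 0 else \<phi> g' + 1 = shift (c (\<phi> i)) (\<phi> g) (b (\<phi> i))"
proof (cases "g = zero M")
  case True
  then show ?thesis
    using assms by (simp add: goodstein_step_def \<phi>_hom)
next
  case False
  then obtain s k where s: "is_fun M UNIV s" "less M (app M s (zero M)) (app M B i)"
    "\<And>j j'. less M j j' \<Longrightarrow> leq M j' k \<Longrightarrow> less M (app M s j') (app M s j)"
    and g: "g = sum_exp2 M (\<lambda>j. app M s j) k" and g': "add M g' (one M) = sum_exp2 M (\<lambda>j. fam M F i (app M s j)) k"
    using assms unfolding goodstein_step_def by auto
  define s' where "s' z = \<phi> (app M s (\<psi> z))" for z
  have s': "recf s'"
    unfolding s'_def by (rule fun_imp_recf[OF s(1)])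
  have ci: "recf (c (\<phi> i))"
    using recf2_comp[OF code_facts(4) recf_const recf_id] .
  have s0: "s' 0 < b (\<phi> i)"
    using s(2) \<phi>_hom(1) unfolding s'_def less_\<phi> code_facts(5) by (metis \<psi>_\<phi>(1))
  have desc: "s' j' < s' j" if "j < j'" "j' \<le> \<phi> k" for j j'
    using s(3)[of "\<psi> j" "\<psi> j'"] that unfolding s'_def by (simp add: less_\<phi> leq_\<phi>)
  have less: "s' j < b (\<phi> i)" if "j \<le> \<phi> k" for j
    using desc[of 0 j] s0 that by (cases "j = 0") (auto simp: mnum_neq_zero(1) dest: less_trans)
  have 1: "\<phi> g = psum s' (\<phi> k)"
    unfolding g by (rule sum_exp2_eq[OF s']) (simp add: s'_def)
  have "\<phi> g' + 1 = \<phi> (add M g' (one M))"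
    by (simp add: \<phi>_hom)
  also have "\<dots> = psum (\<lambda>j. c (\<phi> i) (s' j)) (\<phi> k)"
    unfolding g'
  proof (rule sum_exp2_eq)
    show "recf (\<lambda>j. c (\<phi> i) (s' j))"
      by (rule recf_comp[OF ci s'])
    show "\<phi> (fam M F i (app M s j)) = c (\<phi> i) (s' (\<phi> j))" if "leq M j k" for j
      using less[of "\<phi> j"] that by (simp add: leq_\<phi> s'_def code_facts(6))
  qed
  also have "\<dots> = shift (c (\<phi> i)) (\<phi> g) (b (\<phi> i))"
    unfolding 1 by (rule shift_psum[OF s' s0 _ ci, symmetric]) (rule desc)
  finally show ?thesis
    using False \<phi>_inject[of g "zero M"] by (simp add: \<phi>_hom)
qed

lemma goodstein_stepI:
  assumes g: "\<phi> g < pw (b (\<phi> i))"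
    and "if \<phi> g = 0 then \<phi> g' = 0 else \<phi> g' + 1 = shift (c (\<phi> i)) (\<phi> g) (b (\<phi> i))"
  shows "goodstein_step M B F i g g'"
proof (cases "g = zero M")
  case True
  then show ?thesis
    using assms(2) \<phi>_inject[of g' "zero M"] by (simp add: goodstein_step_def \<phi>_hom)
next
  case False
  then have "0 < \<phi> g"
    using \<phi>_inject[of g "zero M"] by (simp add: \<phi>_hom mnum_neq_zero(1))
  then have g': "\<phi> g' + 1 = shift (c (\<phi> i)) (\<phi> g) (b (\<phi> i))"
    using assms(2) by (simp split: if_splits)
  obtain s k where s: "recf s" "s 0 < b (\<phi> i)" "\<And>j j'. j < j' \<Longrightarrow> j' \<le> k \<Longrightarrow> s j' < s j" "psum s k = \<phi> g"
    using psum_exists[OF \<open>0 < \<phi> g\<close> g] by blast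
  obtain s' where s': "is_fun M UNIV s'" "\<And>x. \<phi> (app M s' x) = s (\<phi> x)"
    using recf_imp_fun[OF s(1)] by blast
  have ci: "recf (c (\<phi> i))"
    using recf2_comp[OF code_facts(4) recf_const recf_id] .
  have less: "s j < b (\<phi> i)" if "j \<le> k" for j
    using s(3)[of 0 j] s(2) that by (cases "j = 0") (auto simp: mnum_neq_zero(1) dest: less_trans)
  have "\<phi> (sum_exp2 M (\<lambda>j. app M s' j) (\<psi> k)) = psum s (\<phi> (\<psi> k))"
    by (rule sum_exp2_eq[OF s(1)]) (simp add: s'(2))
  then have 1: "g = sum_exp2 M (\<lambda>j. app M s' j) (\<psi> k)"
    using s(4) \<phi>_inject by simp
  have "\<phi> (sum_exp2 M (\<lambda>j. fam M F i (app M s' j)) (\<psi> k)) = psum (\<lambda>j. c (\<phi> i) (s j)) (\<phi> (\<psi> k))"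
  proof (rule sum_exp2_eq)
    show "recf (\<lambda>j. c (\<phi> i) (s j))"
      by (rule recf_comp[OF ci s(1)])
    show "\<phi> (fam M F i (app M s' j)) = c (\<phi> i) (s (\<phi> j))" if "leq M j (\<psi> k)" for j
      using less[of "\<phi> j"] that by (simp add: leq_\<phi> s'(2) code_facts(6))
  qed
  also have "\<dots> = \<phi> (add M g' (one M))"
  proof -
    have "shift (c (\<phi> i)) (psum s k) (b (\<phi> i)) = psum (\<lambda>j. c (\<phi> i) (s j)) k"
      by (rule shift_psum[OF s(1,2) _ ci]) (rule s(3))
    then show ?thesis
      using g' s(4) by (simp add: \<phi>_hom)
  qed
  finally have 2: "add M g' (one M) = sum_exp2 M (\<lambda>j. fam M F i (app M s' j)) (\<psi> k)"
    using \<phi>_inject by metis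
  have "less M (app M s' (zero M)) (app M B i)"
    using s(2) by (simp add: less_\<phi> s'(2) \<phi>_hom code_facts(5))
  moreover have "\<forall>j j'. less M j j' \<and> leq M j' (\<psi> k) \<longrightarrow> less M (app M s' j') (app M s' j)"
    using s(3) by (simp add: less_\<phi> leq_\<phi> s'(2))
  ultimately show ?thesis
    unfolding goodstein_step_def using False s'(1) 1 2 by auto
qed

end

lemma extended_goodstein_theorem_iff: "extended_goodstein_theorem M \<longleftrightarrow> goodstein_terminates TYPE('a)"
proof
  assume EGT: "extended_goodstein_theorem M"
  show "goodstein_terminates TYPE('a)"
    unfolding goodstein_terminates_def
  proof (intro allI impI, elim conjE)
    fix b c and m :: "'a mnum"
    assume sys: "gsystem b c" and m: "m < pw (b 0)"
    obtain B F where codes: "codes B F b c"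
      using code_exists_sets[OF b_rec[OF sys] c_rec[OF sys]] .
    have "goodstein_system M B F"
      using goodstein_system_iff[OF codes] sys by blast
    moreover have "less M (\<psi> m) (exp2 M (app M B (zero M)))"
      using m by (simp add: less_\<phi> exp2_eq code_facts(5)[OF codes] \<phi>_hom)
    ultimately obtain G i where G: "goodstein_sequence M B F (\<psi> m) G" "app M G i = zero M"
      using EGT[unfolded extended_goodstein_theorem_def, rule_format, of B F "\<psi> m"] by blast
    define G' where "G' z = \<phi> (app M G (\<psi> z))" for z
    have G': "recf G'"
      using G(1) unfolding G'_def goodstein_sequence_def by (intro fun_imp_recf) blast
    have "if G' i = 0 then G' (i + 1) = 0 else G' (i + 1) + 1 = shift (c i) (G' i) (b i)" for i
    proof -
      have "goodstein_step M B F (\<psi> i) (app M G (\<psi> i)) (app M G (add M (\<psi> i) (one M)))"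
        using G(1) unfolding goodstein_sequence_def by blast
      moreover have "add M (\<psi> i) (one M) = \<psi> (i + 1)"
        by (simp add: \<phi>_inject[symmetric] \<phi>_hom)
      ultimately show ?thesis
        using goodstein_step_imp[OF codes] unfolding G'_def by (metis \<psi>_\<phi>(2))
    qed
    moreover have "G' 0 = m"
      using G(1) \<phi>_hom(1) unfolding G'_def goodstein_sequence_def by (metis \<psi>_\<phi>)
    ultimately have "gsequence b c m G'"
      unfolding gsequence_def using G' by blast
    moreover have "G' (\<phi> i) = 0"
      unfolding G'_def by (simp add: G(2) \<phi>_hom)
    ultimately show "\<exists>G. gsequence b c m G \<and> (\<exists>i. G i = 0)"
      by blast
  qed
next
  assume terminates: "goodstein_terminates TYPE('a)"
  show "extended_goodstein_theorem M"
    unfolding extended_goodstein_theorem_def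
  proof (intro allI impI, elim conjE)
    fix B F m
    assume sys: "goodstein_system M B F" and m: "less M m (exp2 M (app M B (zero M)))"
    have "is_fun M UNIV B" "is_fun M (family_dom B) F"
      using sys unfolding goodstein_system_def family_dom_def by simp_all
    then obtain b c where codes: "codes B F b c"
      by (rule code_exists_functions)
    have gsys: "gsystem b c"
      using goodstein_system_iff[OF codes] sys by blast
    have m': "\<phi> m < pw (b 0)"
      using m by (simp add: less_\<phi> exp2_eq code_facts(5)[OF codes] \<phi>_hom)
    then obtain G i where G: "gsequence b c (\<phi> m) G" "G i = 0"
      using terminates[unfolded goodstein_terminates_def, rule_format, of b c "\<phi> m"] gsys by blast
    have "recf G"
      using G(1) unfolding gsequence_def by blast
    then obtain G' where G': "is_fun M UNIV G'" "\<And>x. \<phi> (app M G' x) = G (\<phi> x)"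
      by (rule recf_imp_fun) blast
    have "goodstein_step M B F i (app M G' i) (app M G' (add M i (one M)))" for i
    proof (rule goodstein_stepI[OF codes])
      show "\<phi> (app M G' i) < pw (b (\<phi> i))"
        unfolding G'(2) by (rule gsequence_less[OF gsys G(1) m'])
      show "if \<phi> (app M G' i) = 0 then \<phi> (app M G' (add M i (one M))) = 0
        else \<phi> (app M G' (add M i (one M))) + 1 = shift (c (\<phi> i)) (\<phi> (app M G' i)) (b (\<phi> i))"
        using G(1) unfolding G'(2) gsequence_def \<phi>_hom by blast
    qed
    moreover have "app M G' (zero M) = m"
      using G(1) by (simp add: \<phi>_inject[symmetric] G'(2) \<phi>_hom gsequence_def)
    moreover have "app M G' (\<psi> i) = zero M"
      using G(2) by (simp add: \<phi>_inject[symmetric] G'(2) \<phi>_hom)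
    ultimately show "\<exists>G. goodstein_sequence M B F m G \<and> (\<exists>i. app M G i = zero M)"
      unfolding goodstein_sequence_def using G'(1) by blast
  qed
qed

end

theorem theorem2p9:
  fixes M :: "'a l2_structure"
  assumes "RCA0_model M"
  shows "arithmetical_comprehension M \<longleftrightarrow> extended_goodstein_theorem M"
proof (rule ccontr)
  assume "\<not> ?thesis"
  then have "counterexample M"
    using assms unfolding counterexample_def by blast
  then have ex: "\<exists>M :: 'a l2_structure. counterexample M"
    by blast
  \<comment> \<open>The given structure only shows that a counterexample exists. The contradiction
    is derived for the chosen \<open>N\<close>, of which \<open>num_model\<close> is a copy.\<close>
  define N :: "'a l2_structure" where "N = (SOME M. counterexample M)"
  have N: "counterexample N"
    unfolding N_def using ex by (rule someI_ex)
  have bij: "bij (of_elem :: 'a \<Rightarrow> 'a mnum)"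
    by (rule bij_of_elem[OF N])
  have model: "num_model = transport of_elem N"
    using ex unfolding num_model_def N_def by simp
  have "jump_closed TYPE('a) \<longleftrightarrow> goodstein_terminates TYPE('a)"
    using jump_imp_goodstein goodstein_imp_jump by blast
  then show False
    using N arithmetical_comprehension_iff[OF bij model] extended_goodstein_theorem_iff[OF bij model]
    unfolding counterexample_def by simp
qed

end
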